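(* Let $\alpha,\delta>0$ satisfy $\alpha-\frac{1}{\delta}>\frac12$. Let $(a_n)_{n\in\mathbb{N}}$ be a real sequence with $a_n\sim n^{-\alpha}$, and let $\{\omega_n\}_{n\in\mathbb{N}}$ be real i.i.d. random variables on a probability space $(\Omega,\mathbb{P})$ with common distribution $\mu$ such that $\int_{-K}^{K}x\,d\mu(x)=0$ for every $K>0$, and such that for some $C>0$, $\mu((-R,R)^c)\le \frac{C}{R^\delta}$ for all sufficiently large $R$. Let $H^\omega$ be the random operator on $\ell^2(\mathbb{N})$ given by $$(H^\omega u)_n=u_{n+1}+u_{n-1}+a_n\omega_nu_n\ \ (n>1),\qquad (H^\omega u)_1=u_2+a_1\omega_1u_1,$$ and let $H^\omega_L$ be its restriction to $\ell^2(\{1,\dots,L\})$. Let $E_0\in(-2,2)$, and let $\xi^\omega_{E_0,L}$ be the point process defined by $$\xi^\omega_{E_0,L}(f)=\mathrm{tr}\big(f(L(H^\omega_L-E_0))\big),\qquad f\in C_c(\mathbb{R}).$$ Then for every increasing sequence $\{L_n\}_{n\in\mathbb{N}}$ in $\mathbb{N}$ there exists a subsequence $\{L_{n_k}\}_k$ such that the point processes $\{\xi^\omega_{E_0,L_{n_k}}\}_k$ converge in distribution, as $k\to\infty$, to the clock process.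
   Context: $\mathbb{N}=\{1,2,3,\dots\}$. $a_n\sim n^{-\alpha}$ means $a_n n^{\alpha}\to 1$ as $n\to\infty$. The measure $\mu$ may be singular and may have unbounded support. The restriction $H^\omega_L$ is the $L\times L$ real symmetric tridiagonal matrix with diagonal entries $a_1\omega_1,\dots,a_L\omega_L$ and off-diagonal entries $1$; thus $\xi^\omega_{E_0,L}=\sum_{i=1}^{L}\delta_{L(E_i^{\omega,L}-E_0)}$, where $E_1^{\omega,L},\dots,E_L^{\omega,L}$ are the eigenvalues of $H^\omega_L$. Clock process: write $E_0=2\cos\theta$ with $\theta\in(0,\pi)$. A clock process (at energy $E_0$) is a point process of the form $\sum_{k\in\mathbb{Z}}\delta_{-2(k\pi+\phi^\omega)\sin\theta}$, where $\phi^\omega$ is a real-valued random variable; i.e. an equally spaced set of atoms with deterministic spacing $2\pi\sin\theta$ and a possibly random shift (the law of the shift may depend on the chosen subsequence). Convergence in distribution of point processes $\xi_k^\omega$ to $\xi^\omega$ means $\mathbb{E}[e^{i\xi_k^\omega(f)}]\to\mathbb{E}[e^{i\xi^\omega(f)}]$ for every real-valued $f\in C_c(\mathbb{R})$, where $\xi(f)=\int f\,d\xi$. *)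

theory Defs
  imports "HOL-Probability.Probability" "Jordan_Normal_Form.Jordan_Normal_Form_Existence"
    "Jordan_Normal_Form.Jordan_Normal_Form_Uniqueness"
begin

text \<open>
  Sites are numbered from 1: the value at 0 of the sequences \<open>a\<close>, \<open>w\<close> and \<open>u\<close> plays no role.
\<close>

definition decaying_op :: "(nat \<Rightarrow> real) \<Rightarrow> (nat \<Rightarrow> real) \<Rightarrow> (nat \<Rightarrow> real) \<Rightarrow> nat \<Rightarrow> real" where
  "decaying_op a w u n =
     (if n > 1 then u (n + 1) + u (n - 1) + a n * w n * u n else u 2 + a 1 * w 1 * u 1)"

text \<open>
  The restriction to \<open>{1..L}\<close> is the compression of the operator, as a matrix in the canonical
  basis; the matrix index \<open>i\<close> stands for the site \<open>i + 1\<close>.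
\<close>

definition restricted_op :: "(nat \<Rightarrow> real) \<Rightarrow> (nat \<Rightarrow> real) \<Rightarrow> nat \<Rightarrow> real mat" where
  "restricted_op a w L =
     Matrix.mat L L (\<lambda>(i, j). decaying_op a w (\<lambda>n. if n = j + 1 then 1 else 0) (i + 1))"

lemma restricted_op_eq:
  "restricted_op a w L = Matrix.mat L L (\<lambda>(i, j).
     if i = j then a (i + 1) * w (i + 1) else if i = j + 1 \<or> j = i + 1 then 1 else 0)"
  unfolding restricted_op_def decaying_op_def by (intro eq_matI) auto

text \<open>
  The real eigenvalues in increasing order, repeated according to multiplicity (all eigenvalues,
  for a symmetric matrix).
\<close>

definition eigvals_list :: "real mat \<Rightarrow> real list" where
  "eigvals_list A = sorted_list_of_multiset (proots (char_poly A))"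

text \<open>
  A point process is represented by the random measure \<open>\<Sum>i\<in>I. \<delta>(x i)\<close>, i.e. by the image of the
  counting measure on the index set \<open>I\<close> under the enumeration \<open>x\<close> of the atoms.
\<close>

definition point_measure_of :: "'i set \<Rightarrow> ('i \<Rightarrow> real) \<Rightarrow> real measure" where
  "point_measure_of I x = distr (count_space I) borel x"

definition eigval_process :: "(nat \<Rightarrow> real) \<Rightarrow> real \<Rightarrow> nat \<Rightarrow> (nat \<Rightarrow> real) \<Rightarrow> real measure" where
  "eigval_process a E0 L w =
     point_measure_of {..<L} (\<lambda>i. real L * (eigvals_list (restricted_op a w L) ! i - E0))"

definition clock_process :: "real \<Rightarrow> real \<Rightarrow> real measure" where
  "clock_process \<theta> \<phi> =
     point_measure_of (UNIV :: int set) (\<lambda>k. - 2 * (real_of_int k * pi + \<phi>) * sin \<theta>)"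

definition compactly_supported_continuous :: "(real \<Rightarrow> real) \<Rightarrow> bool" where
  "compactly_supported_continuous f \<longleftrightarrow> continuous_on UNIV f \<and> compact (closure {x. f x \<noteq> 0})"

definition converges_in_distribution ::
  "'a measure \<Rightarrow> (nat \<Rightarrow> 'a \<Rightarrow> real measure) \<Rightarrow> ('a \<Rightarrow> real measure) \<Rightarrow> bool" where
  "converges_in_distribution M \<xi> \<eta> \<longleftrightarrow>
     (\<forall>f. compactly_supported_continuous f \<longrightarrow>
        (\<lambda>k. \<integral>\<omega>. exp (\<i> * of_real (\<integral>x. f x \<partial>\<xi> k \<omega>)) \<partial>M)
          \<longlonglongrightarrow> (\<integral>\<omega>. exp (\<i> * of_real (\<integral>x. f x \<partial>\<eta> \<omega>)) \<partial>M))"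

text \<open>
  The process is equivalently given by \<open>\<xi>(f) = tr(f(L(H - E0)))\<close>; this is proved in
  \<open>eigval_process_trace\<close> below. Here \<open>f(A)\<close>, for \<open>A\<close> symmetric, is the matrix acting as \<open>f(x)\<close> on
  the eigenspace of \<open>A\<close> for the eigenvalue \<open>x\<close>.
\<close>

definition mat_fun :: "(real \<Rightarrow> real) \<Rightarrow> real mat \<Rightarrow> real mat" where
  "mat_fun f A = (THE B. B \<in> carrier_mat (dim_row A) (dim_row A) \<and>
     (\<forall>x v. eigenvector A v x \<longrightarrow> B *\<^sub>v v = f x \<cdot>\<^sub>v v))"

lemma symmetric_char_poly_splits:
  fixes A :: "real mat"
  assumes A: "A \<in> carrier_mat n n" and sym: "transpose_mat A = A"
  shows "\<exists>as. char_poly A = (\<Prod>a\<leftarrow>as. [:- a, 1:])"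
proof -
  let ?B = "map_mat complex_of_real A"
  have B: "?B \<in> carrier_mat n n" using A by auto
  have symB: "transpose_mat ?B = ?B" using sym by (metis map_mat_transpose)
  obtain as where as: "char_poly ?B = (\<Prod>a\<leftarrow>as. [:- a, 1:])"
    using char_poly_factorized[OF B] by blast
  have real: "complex_of_real (Re a) = a" if "a \<in> set as" for a
  proof -
    have "poly (char_poly ?B) a = 0"
      unfolding as using that by (auto simp: poly_prod_list prod_list_zero_iff)
    then obtain v where "eigenvector ?B v a"
      using eigenvalue_root_char_poly[OF B] unfolding eigenvalue_def by blast
    then have v: "v \<in> carrier_vec n" "v \<noteq> 0\<^sub>v n" and ev: "?B *\<^sub>v v = a \<cdot>\<^sub>v v"
      using B unfolding eigenvector_def by auto
    have cv: "conjugate v \<in> carrier_vec n" using v by auto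
    have "?B *\<^sub>v conjugate v = conjugate (?B *\<^sub>v v)"
      using A v by (intro eq_vecI) (auto simp: scalar_prod_def)
    then have ev': "?B *\<^sub>v conjugate v = cnj a \<cdot>\<^sub>v conjugate v"
      unfolding ev using v by (auto simp: conjugate_smult_vec)
    have "scalar_prod (?B *\<^sub>v v) (conjugate v) = scalar_prod v (?B *\<^sub>v conjugate v)"
      using transpose_vec_mult_scalar[OF B cv v(1)] symB by simp
    then have "a * (v \<bullet>c v) = cnj a * (v \<bullet>c v)"
      unfolding ev ev' using v cv by simp
    moreover have "v \<bullet>c v \<noteq> 0" using v by simp
    ultimately have "a = cnj a" by simp
    then show ?thesis by (simp add: complex_eq_iff)
  qed
  interpret h: map_poly_inj_idom_hom complex_of_real ..
  have "map_poly complex_of_real (char_poly A) = char_poly ?B"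
    using of_real_hom.char_poly_hom[OF A, where 'a = complex] by simp
  also have "\<dots> = (\<Prod>a\<leftarrow>as. [:- complex_of_real (Re a), 1:])"
    unfolding as using real by (intro arg_cong[where f = prod_list] map_cong) auto
  also have "\<dots> = map_poly complex_of_real (\<Prod>a\<leftarrow>as. [:- Re a, 1:])"
    by (induction as) (simp_all add: h.hom_mult hom_distribs del: mult_pCons_left mult_pCons_right)
  finally have "char_poly A = (\<Prod>a\<leftarrow>as. [:- Re a, 1:])"
    using h.injectivity by blast
  then show ?thesis by (intro exI[of _ "map Re as"]) (simp add: comp_def)
qed

lemma jordan_matrix_of_ones:
  fixes es :: "real list"
  shows "jordan_matrix (map (Pair 1) es) = mat_diag (length es) ((!) es)"
proof (induction es)
  case Nil
  then show ?case by (intro eq_matI) (auto simp: jordan_matrix_def mat_diag_def)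
next
  case (Cons e es)
  have l: "sum_list (map fst (map (Pair (1::nat)) es)) = length es"
    by (induction es) auto
  show ?case
    unfolding list.map jordan_matrix_Cons l Cons
    by (intro eq_matI)
      (auto simp: mat_diag_def nth_Cons' less_Suc_eq_0_disj split: if_splits)
qed

lemma symmetric_diagonalizable:
  fixes A :: "real mat"
  assumes A: "A \<in> carrier_mat n n" and sym: "transpose_mat A = A"
  shows "\<exists>d. similar_mat A (mat_diag n d)"
proof -
  obtain as where as: "char_poly A = (\<Prod>a\<leftarrow>as. [:- a, 1:])"
    using symmetric_char_poly_splits[OF A sym] by blast
  obtain nas where jnf: "jordan_nf A nas" using jordan_nf_exists[OF A as] by blast
  have one: "k = 1" if k: "(k, e) \<in> set nas" for k e
  proof -
    let ?C = "char_matrix A e"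
    have C: "?C \<in> carrier_mat n n" using A by simp
    have Aij: "A $$ (j, i) = A $$ (i, j)" if "i < n" "j < n" for i j
    proof -
      have "A $$ (j, i) = transpose_mat A $$ (i, j)" using A that by simp
      then show ?thesis unfolding sym .
    qed
    have symC: "transpose_mat ?C = ?C"
    proof (intro eq_matI)
      fix i j assume "i < dim_row ?C" "j < dim_col ?C"
      then have ij: "i < n" "j < n" using C by auto
      then show "transpose_mat ?C $$ (i, j) = ?C $$ (i, j)"
        using A Aij[OF ij] unfolding char_matrix_def by simp
    qed (use C in auto)
    have C2: "?C ^\<^sub>m 2 = ?C * ?C"
      unfolding numeral_2_eq_2 pow_mat.simps carrier_matD(1)[OF C] left_mult_one_mat[OF C] ..
    have "mat_kernel (?C * ?C) = mat_kernel ?C"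
    proof (intro equalityI subsetI)
      fix v assume "v \<in> mat_kernel (?C * ?C)"
      then have v: "v \<in> carrier_vec n" and "?C * ?C *\<^sub>v v = 0\<^sub>v n"
        using C unfolding mat_kernel_def by auto
      then have 0: "?C *\<^sub>v (?C *\<^sub>v v) = 0\<^sub>v n"
        unfolding assoc_mult_mat_vec[OF C C v] by simp
      have cv: "?C *\<^sub>v v \<in> carrier_vec n" using C v by simp
      have "scalar_prod (?C *\<^sub>v v) (?C *\<^sub>v v) = scalar_prod (transpose_mat ?C *\<^sub>v (?C *\<^sub>v v)) v"
        using transpose_vec_mult_scalar[OF C v cv] by simp
      also have "\<dots> = 0" unfolding symC 0 using v by simp
      finally have "scalar_prod (?C *\<^sub>v v) (?C *\<^sub>v v) = 0" .
      moreover have "conjugate y = y" for y :: "real vec"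
        by (intro eq_vecI) simp_all
      ultimately have "?C *\<^sub>v v = 0\<^sub>v n"
        using conjugate_square_eq_0_vec[OF cv] by metis
      then show "v \<in> mat_kernel ?C" using C v unfolding mat_kernel_def by simp
    next
      fix v assume "v \<in> mat_kernel ?C"
      then have v: "v \<in> carrier_vec n" and 0: "?C *\<^sub>v v = 0\<^sub>v n"
        using C unfolding mat_kernel_def by auto
      have "?C * ?C *\<^sub>v v = 0\<^sub>v n"
        unfolding assoc_mult_mat_vec[OF C C v] 0 using C by (intro eq_vecI) auto
      then show "v \<in> mat_kernel (?C * ?C)"
        using C v unfolding mat_kernel_def by simp
    qed
    then have "kernel_dim (?C * ?C) = kernel_dim ?C"
      unfolding kernel_dim_def using C by simp
    then have "dim_gen_eigenspace A e 2 = dim_gen_eigenspace A e 1"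
      unfolding dim_gen_eigenspace_def C2 using C by simp
    then have eq: "(\<Sum>n\<leftarrow>map fst [(n, e')\<leftarrow>nas. e' = e]. min 2 n) =
        (\<Sum>n\<leftarrow>map fst [(n, e')\<leftarrow>nas. e' = e]. min 1 n)"
      unfolding dim_gen_eigenspace[OF jnf] .
    have pos: "k > 0"
      using k jnf unfolding jordan_nf_def by (cases k) force+
    have *: "min 2 m \<le> min 1 m" if ns: "(\<Sum>n\<leftarrow>ns. min 2 n) = (\<Sum>n\<leftarrow>ns. min 1 n)" "m \<in> set ns"
      for ns :: "nat list" and m
    proof (rule ccontr)
      assume "\<not> min 2 m \<le> min 1 m"
      moreover obtain xs ys where "ns = xs @ m # ys" using split_list[OF ns(2)] by blast
      moreover have "(\<Sum>n\<leftarrow>zs. min 1 n) \<le> (\<Sum>n\<leftarrow>zs. min 2 n)" for zs :: "nat list"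
        by (intro sum_list_mono) auto
      from this[of xs] this[of ys] have "min 2 m + ((\<Sum>n\<leftarrow>xs. min 1 n) + (\<Sum>n\<leftarrow>ys. min 1 n))
          \<le> min 2 m + ((\<Sum>n\<leftarrow>xs. min 2 n) + (\<Sum>n\<leftarrow>ys. min 2 n))"
        by (intro add_mono order_refl)
      ultimately show False using ns(1) by simp
    qed
    have "(k, e) \<in> set [(n, e')\<leftarrow>nas. e' = e]" using k by simp
    then have "k \<in> set (map fst [(n, e')\<leftarrow>nas. e' = e])" by (metis fst_conv image_eqI list.set_map)
    from *[OF eq this] show ?thesis using pos by linarith
  qed
  have "map (Pair 1) (map snd nas) = map (\<lambda>p. p) nas"
    unfolding map_map comp_def by (rule map_cong) (auto dest: one)
  then have nas: "map (Pair 1) (map snd nas) = nas" by (simp only: map_ident)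
  have "similar_mat A (jordan_matrix nas)" using jnf unfolding jordan_nf_def by blast
  then have sim: "similar_mat A (mat_diag (length nas) ((!) (map snd nas)))"
    using jordan_matrix_of_ones[of "map snd nas"] unfolding nas length_map by simp
  obtain P Q where "similar_mat_wit A (mat_diag (length nas) ((!) (map snd nas))) P Q"
    using sim unfolding similar_mat_def by blast
  from similar_mat_witD2(5)[OF A this] have "length nas = n"
    using carrier_matD(1) mat_diag_dim by metis
  then show ?thesis using sim by blast
qed

lemma mat_fun_trace:
  assumes wit: "similar_mat_wit A (mat_diag n d) P Q" and A: "A \<in> carrier_mat n n"
  shows "sum_list (diag_mat (mat_fun f A)) = (\<Sum>i<n. f (d i))"
proof -
  note D = similar_mat_witD2[OF A wit]
  let ?F = "P * mat_diag n (\<lambda>i. f (d i)) * Q"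
  have F: "?F \<in> carrier_mat n n" using D by auto
  have Fv: "?F *\<^sub>v v = f x \<cdot>\<^sub>v v" if "eigenvector A v x" for x v
  proof -
    have v: "v \<in> carrier_vec n" and ev: "A *\<^sub>v v = x \<cdot>\<^sub>v v"
      using that A unfolding eigenvector_def by auto
    let ?u = "Q *\<^sub>v v"
    have u: "?u \<in> carrier_vec n" using D v by simp
    have dm: "(mat_diag n g *\<^sub>v y) $ i = g i * y $ i"
      if "i < n" "y \<in> carrier_vec n" for g i y
    proof -
      have "(mat_diag n g *\<^sub>v y) $ i = (\<Sum>j = 0..<n. (if i = j then g j else 0) * y $ j)"
        using that unfolding mat_diag_def by (auto simp: scalar_prod_def intro!: sum.cong)
      also have "\<dots> = (\<Sum>j = 0..<n. if i = j then g j * y $ j else 0)"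
        by (intro sum.cong) auto
      finally show ?thesis using that by simp
    qed
    have "Q * A = mat_diag n d * Q"
    proof -
      have "Q * A = Q * (P * (mat_diag n d * Q))"
        using D by (subst D(3)) (simp add: assoc_mult_mat[of _ n n _ n _ n])
      also have "\<dots> = (Q * P) * (mat_diag n d * Q)"
        using D mult_carrier_mat[OF mat_diag_dim D(7)]
        by (intro assoc_mult_mat[symmetric, of _ n n _ n _ n]) auto
      also have "\<dots> = mat_diag n d * Q"
        unfolding D(2) by (rule left_mult_one_mat[OF mult_carrier_mat[OF mat_diag_dim D(7)]])
      finally show ?thesis .
    qed
    then have "mat_diag n d *\<^sub>v ?u = Q *\<^sub>v (A *\<^sub>v v)"
      using D A v by (metis assoc_mult_mat_vec mat_diag_dim)
    then have eq: "mat_diag n d *\<^sub>v ?u = x \<cdot>\<^sub>v ?u"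
      unfolding ev using D v by (simp add: mult_mat_vec)
    have "mat_diag n (\<lambda>i. f (d i)) *\<^sub>v ?u = f x \<cdot>\<^sub>v ?u"
    proof (intro eq_vecI)
      fix i assume "i < dim_vec (f x \<cdot>\<^sub>v ?u)"
      then have i: "i < n" using carrier_matD(1)[OF D(7)] by simp
      have qi: "(y \<cdot>\<^sub>v ?u) $ i = y * ?u $ i" for y
        using i carrier_matD(1)[OF D(7)] by simp
      have "d i * ?u $ i = x * ?u $ i"
        using arg_cong[OF eq, of "\<lambda>y. y $ i"] dm[OF i u] qi by simp
      then show "(mat_diag n (\<lambda>i. f (d i)) *\<^sub>v ?u) $ i = (f x \<cdot>\<^sub>v ?u) $ i"
        using dm[OF i u] qi by auto
    qed (use carrier_matD(1)[OF D(7)] in \<open>auto simp: mat_diag_def\<close>)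
    then have "?F *\<^sub>v v = P *\<^sub>v (f x \<cdot>\<^sub>v ?u)"
      using D v by (simp add: assoc_mult_mat_vec[of _ n n _ n])
    also have "\<dots> = f x \<cdot>\<^sub>v (P *\<^sub>v ?u)"
      by (rule mult_mat_vec[OF D(6) u])
    also have "P *\<^sub>v ?u = v"
      using assoc_mult_mat_vec[OF D(6,7) v] D(1) v by simp
    finally show ?thesis .
  qed
  have uniq: "B = ?F"
    if B: "B \<in> carrier_mat n n" and Bv: "\<And>x v. eigenvector A v x \<Longrightarrow> B *\<^sub>v v = f x \<cdot>\<^sub>v v" for B
  proof -
    have AP: "A * P = P * mat_diag n d"
    proof -
      have "A * P = (P * mat_diag n d) * (Q * P)"
        unfolding D(3) using D by (simp add: assoc_mult_mat[of _ n n _ n _ n] mult_carrier_mat[of _ n n _ n])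
      then show ?thesis using D by (simp add: right_mult_one_mat[of _ n n])
    qed
    have "B * P = ?F * P"
    proof (intro mat_col_eqI)
      fix j assume "j < dim_col (?F * P)"
      then have j: "j < n" using D by simp
      have cj: "col P j \<in> carrier_vec n" using D j by auto
      have "A *\<^sub>v col P j = col (A * P) j" by (rule col_mult2[OF A D(6) j, symmetric])
      also have "\<dots> = d j \<cdot>\<^sub>v col P j"
        unfolding AP mat_diag_mult_right[OF D(6)] using D j by (intro eq_vecI) auto
      finally have e: "A *\<^sub>v col P j = d j \<cdot>\<^sub>v col P j" .
      have "col P j \<noteq> 0\<^sub>v n"
      proof
        assume "col P j = 0\<^sub>v n"
        then have "(Q * P) $$ (j, j) = 0" using D(6,7) j by simp
        then show False unfolding D(2) using j by simp
      qed
      then have "eigenvector A (col P j) (d j)"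
        using e cj A unfolding eigenvector_def by auto
      then have "B *\<^sub>v col P j = ?F *\<^sub>v col P j" using Bv Fv by simp
      then show "col (B * P) j = col (?F * P) j"
        unfolding col_mult2[OF B D(6) j] col_mult2[OF F D(6) j] .
    qed (use B F D in auto)
    moreover have "X * P * Q = X" if "X \<in> carrier_mat n n" for X
      using assoc_mult_mat[OF that D(6,7)] that unfolding D(1) by simp
    ultimately show ?thesis using B F by metis
  qed
  have "mat_fun f A = ?F"
    unfolding mat_fun_def carrier_matD(1)[OF A]
  proof (rule the_equality)
    show "?F \<in> carrier_mat n n \<and> (\<forall>x v. eigenvector A v x \<longrightarrow> ?F *\<^sub>v v = f x \<cdot>\<^sub>v v)"
      by (intro conjI allI impI F Fv)
  next
    fix B
    assume "B \<in> carrier_mat n n \<and> (\<forall>x v. eigenvector A v x \<longrightarrow> B *\<^sub>v v = f x \<cdot>\<^sub>v v)"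
    then show "B = ?F" by (elim conjE) (rule uniq, assumption, blast)
  qed
  moreover have "sum_list (diag_mat ?F) = (\<Sum>i<n. f (d i))"
  proof -
    have "sum_list (diag_mat ?F) = (\<Sum>i<n. \<Sum>j<n. P $$ (i, j) * f (d j) * Q $$ (j, i))"
      unfolding diag_mat_def mat_diag_mult_right[OF D(6)] using D
      by (simp add: sum_list_sum_nth atLeast0LessThan scalar_prod_def)
    also have "\<dots> = (\<Sum>j<n. f (d j) * (\<Sum>i<n. Q $$ (j, i) * P $$ (i, j)))"
      by (subst sum.swap) (simp add: sum_distrib_left mult_ac)
    also have "\<dots> = (\<Sum>j<n. f (d j) * (Q * P) $$ (j, j))"
      using D(6,7) by (intro sum.cong refl) (simp add: scalar_prod_def atLeast0LessThan)
    finally show ?thesis unfolding D(2) by simp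
  qed
  ultimately show ?thesis by simp
qed

lemma eigvals_list_diag:
  assumes "similar_mat A (mat_diag n d)"
  shows "mset (eigvals_list A) = image_mset d (mset_set {..<n})"
proof -
  have "upper_triangular (mat_diag n d)" unfolding mat_diag_def by auto
  then have "char_poly (mat_diag n d) = (\<Prod>a\<leftarrow>diag_mat (mat_diag n d). [:- a, 1:])"
    by (intro char_poly_upper_triangular[of _ n]) auto
  also have "diag_mat (mat_diag n d) = map d [0..<n]"
    unfolding diag_mat_def mat_diag_def by auto
  finally have "char_poly A = (\<Prod>a\<leftarrow>map d [0..<n]. [:- a, 1:])"
    using char_poly_similar[OF assms] by simp
  also have "\<dots> = (\<Prod>i<n. [:- d i, 1:])"
    using prod.distinct_set_conv_list[of "[0..<n]" "\<lambda>i. [:- d i, 1:]"]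
    by (simp add: atLeast0LessThan comp_def)
  finally have "char_poly A = (\<Prod>i<n. [:- d i, 1:])" .
  then show ?thesis
    unfolding eigvals_list_def by (simp add: proots_prod sum_unfold_sum_mset)
qed

lemma eigval_process_trace:
  assumes f: "continuous_on UNIV f"
  shows "(\<integral>x. f x \<partial>eigval_process a E0 L w) =
    sum_list (diag_mat (mat_fun f (real L \<cdot>\<^sub>m (restricted_op a w L - E0 \<cdot>\<^sub>m 1\<^sub>m L))))"
proof -
  let ?H = "restricted_op a w L" and ?g = "\<lambda>x. real L * (x - E0)"
  have H: "?H \<in> carrier_mat L L" unfolding restricted_op_def by simp
  have sym: "transpose_mat ?H = ?H" unfolding restricted_op_eq by (intro eq_matI) auto
  obtain d where sim: "similar_mat ?H (mat_diag L d)"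
    using symmetric_diagonalizable[OF H sym] by blast
  then obtain P Q where wit: "similar_mat_wit ?H (mat_diag L d) P Q"
    unfolding similar_mat_def by blast
  note D = similar_mat_witD2[OF H wit]
  note ev = eigvals_list_diag[OF sim]
  have len: "length (eigvals_list ?H) = L"
    using arg_cong[OF ev, of size] by simp
  have "f \<in> borel_measurable borel" using f by (intro borel_measurable_continuous_onI)
  then have "(\<integral>x. f x \<partial>eigval_process a E0 L w) = (\<Sum>i<L. f (?g (eigvals_list ?H ! i)))"
    unfolding eigval_process_def point_measure_of_def
    by (subst integral_distr) (auto simp: lebesgue_integral_count_space_finite)
  also have "\<dots> = (\<Sum>x\<leftarrow>eigvals_list ?H. f (?g x))"
    using len by (simp add: sum_list_sum_nth atLeast0LessThan)
  also have "\<dots> = (\<Sum>x\<in>#mset (eigvals_list ?H). f (?g x))"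
    by (simp flip: sum_mset_sum_list)
  also have "\<dots> = (\<Sum>i<L. f (?g (d i)))"
    unfolding ev by (simp add: image_mset.compositionality comp_def sum_unfold_sum_mset)
  also have "\<dots> = sum_list (diag_mat (mat_fun f (real L \<cdot>\<^sub>m (?H - E0 \<cdot>\<^sub>m 1\<^sub>m L))))"
  proof (rule mat_fun_trace[symmetric])
    have eq: "mat_diag L (\<lambda>i. ?g (d i)) = real L \<cdot>\<^sub>m (mat_diag L d - E0 \<cdot>\<^sub>m 1\<^sub>m L)"
      by (intro eq_matI) (auto simp: mat_diag_def)
    have "P * (mat_diag L d - E0 \<cdot>\<^sub>m 1\<^sub>m L) * Q = P * mat_diag L d * Q - E0 \<cdot>\<^sub>m (P * Q)"
      using D
      by (simp add: mult_minus_distrib_mat[of _ L L _ L] minus_mult_distrib_mat[of _ L L _ _ L]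
          mult_smult_distrib[of _ L L _ L] mult_smult_assoc_mat[of _ L L _ L])
    then have "P * (mat_diag L d - E0 \<cdot>\<^sub>m 1\<^sub>m L) * Q = ?H - E0 \<cdot>\<^sub>m 1\<^sub>m L"
      using D by simp
    moreover have "P * (real L \<cdot>\<^sub>m X) * Q = real L \<cdot>\<^sub>m (P * X * Q)" if "X \<in> carrier_mat L L" for X
      using D that
      by (simp add: mult_smult_distrib[of _ L L _ L] mult_smult_assoc_mat[of _ L L _ L]
          mult_carrier_mat[of _ L L _ L])
    ultimately have "P * mat_diag L (\<lambda>i. ?g (d i)) * Q = real L \<cdot>\<^sub>m (?H - E0 \<cdot>\<^sub>m 1\<^sub>m L)"
      unfolding eq by (metis mat_diag_dim minus_carrier_mat one_carrier_mat smult_carrier_mat)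
    then show "similar_mat_wit (real L \<cdot>\<^sub>m (?H - E0 \<cdot>\<^sub>m 1\<^sub>m L)) (mat_diag L (\<lambda>i. ?g (d i))) P Q"
      using D H by (intro similar_mat_witI[of _ _ L]) auto
  qed (use H in auto)
  finally show ?thesis .
qed

end

(*
  Write u_n for the solution of u_{n+1} + u_{n-1} + v_n u_n = E u_n with u_0 = 0, u_1 = 1, where
  v_n = a_n w_n; the eigenvalues of the restriction to {1..L} are the zeros of E -> u_{L+1}(E).
  Since n^{1/delta} a_n is square summable up to an arbitrarily small power, truncating the w_n
  changes only finitely many v_n almost surely and turns the amplitudes
  z^{-n} (u_{n+1} - z^{-1} u_n), z = exp(i theta), at the energy E0 into L^2-bounded martingales.
  Their L^2 convergence gives, along a subsequence of the given lengths L, almost sure convergence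
  at the sites L and in mean square over {1..L}; no maximal inequality is needed for this.

  At the energy E0 + x / L, variation of constants expresses u_{L+1} through the solutions at E0,
  with coefficients that solve a slow system whose matrix is oscillating up to a small mean error.
  Averaging the oscillation yields convergence of x -> u_{L+1}(E0 + x / L), uniformly on compact
  subsets of the complex plane, to a multiple of sin (A - x / (2 sin theta)). Cauchy's inequality
  upgrades this to C^1 convergence, so the zeros converge with multiplicity one to the zeros of the
  limit, which form the clock. The convergence in distribution follows by dominated convergence.
*)
theory Submission
  imports Defs "HOL-Complex_Analysis.Complex_Analysis" "HOL-Real_Asymp.Real_Asymp"
begin

section \<open>Solutions of the Jacobi recursion\<close>

text \<open>What holds the argument together is the Wronskian. If the amplitudes of the solutions
  with initial values (0, 1) and (1, 0) converge to c and d, conservation of the Wronskian gives Im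
  (cnj c * d) = sin \<theta> > 0. Hence c is nonzero, so the limiting sine does not degenerate and
  its zeros are simple; and (x, y) -> (c x + d y, cnj c x + cnj d y) is an invertible change of
  coordinates, the one in which the averaged system is diagonal. The second solution is forced for
  another reason too: finitely many untruncated sites turn the solution of interest into a
  combination of both truncated ones. The integrals of x over [-K, K] vanish for every K, so cutting
  at a threshold that grows with the site keeps the variables centred. Subsequences are extracted
  for two unrelated reasons: L^2 convergence becomes almost sure, and the phases cis ((L + 1)
  \<theta>), which need not converge, are made to converge on the circle. The second choice is
  deterministic, but it enters the shift of the clock. Since the clock sees its shift only modulo
  pi, an argument of the limit suffices and no continuous phase has to be followed along the
  sites.\<close>

text \<open>The term \<open>v 0\<close> does not enter; the boundary condition of the half-line operator corresponds to the
  initial values \<open>0, 1\<close> at the sites 0 and 1.\<close>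

fun sol :: "(nat \<Rightarrow> real) \<Rightarrow> 'a::real_algebra_1 \<Rightarrow> 'a \<Rightarrow> 'a \<Rightarrow> nat \<Rightarrow> 'a" where
  "sol v E x y 0 = x"
| "sol v E x y (Suc 0) = y"
| "sol v E x y (Suc (Suc n)) = (E - of_real (v (Suc n))) * sol v E x y (Suc n) - sol v E x y n"

lemma sol_of_real:
  "sol v (of_real E) (of_real x) (of_real y) n = (of_real (sol v E x y n) :: 'a::real_algebra_1)"
  by (induction v E x y n rule: sol.induct) simp_all

text \<open>The one-step transfer matrices have determinant one, so the Wronskian keeps the value it
  has at \<open>n = 0\<close>.\<close>

lemma sol_Wronskian:
  fixes E :: "'a::{real_algebra_1, comm_ring_1}"
  shows "sol v E 0 1 (Suc n) * sol v E 1 0 n - sol v E 0 1 n * sol v E 1 0 (Suc n) = 1"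
  by (induction n) (simp_all add: algebra_simps)

text \<open>For the free recursion at the energy \<open>2 * cos \<theta>\<close> this is constant in \<open>n\<close>; by \<open>Im_amp_Suc\<close> it
  encodes a real solution by a single complex number.\<close>

definition amp :: "real \<Rightarrow> (nat \<Rightarrow> real) \<Rightarrow> nat \<Rightarrow> complex" where
  "amp \<theta> u n = cis (- (real n * \<theta>)) * (of_real (u (Suc n)) - cis (- \<theta>) * of_real (u n))"

lemma Im_amp_Suc: "Im (cis (real (Suc n) * \<theta>) * amp \<theta> u n) = sin \<theta> * u (Suc n)"
proof -
  have "cis (real (Suc n) * \<theta>) * amp \<theta> u n = cis \<theta> * of_real (u (Suc n)) - of_real (u n)"
    unfolding amp_def mult.assoc[symmetric] cis_mult
    by (simp add: algebra_simps cis_mult)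
  then show ?thesis by simp
qed

lemma amp_Wronskian:
  "Im (cnj (amp \<theta> u n) * amp \<theta> w n) = sin \<theta> * (u (Suc n) * w n - u n * w (Suc n))"
proof -
  have "cnj (amp \<theta> u n) * amp \<theta> w n =
     (cis (real n * \<theta>) * cis (- (real n * \<theta>))) *
     ((of_real (u (Suc n)) - cis \<theta> * of_real (u n)) * (of_real (w (Suc n)) - cis (- \<theta>) * of_real (w n)))"
    unfolding amp_def by (simp add: cis_cnj)
  also have "\<dots> = (of_real (u (Suc n)) - cis \<theta> * of_real (u n)) * (of_real (w (Suc n)) - cis (- \<theta>) * of_real (w n))"
    by (simp add: cis_mult)
  finally have eq: "cnj (amp \<theta> u n) * amp \<theta> w n = \<dots>" .
  show ?thesis unfolding eq by (simp add: algebra_simps)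
qed

text \<open>The Wronskian survives the limit because \<open>amp_Wronskian\<close> expresses it
  continuously in the two amplitudes. As \<open>sin \<theta>\<close> is nonzero, this yields both
  \<open>c \<noteq> 0\<close> and the linear independence of (c, d) and its conjugate.\<close>

lemma amp_limit_Wronskian:
  fixes E \<theta> :: real
  assumes p: "(\<lambda>k. amp \<theta> (sol v E 0 1) (L k)) \<longlonglongrightarrow> c" and q: "(\<lambda>k. amp \<theta> (sol v E 1 0) (L k)) \<longlonglongrightarrow> d"
  shows "Im (cnj c * d) = sin \<theta>"
proof -
  have "(\<lambda>k. Im (cnj (amp \<theta> (sol v E 0 1) (L k)) * amp \<theta> (sol v E 1 0) (L k))) \<longlonglongrightarrow> Im (cnj c * d)"
    by (intro tendsto_intros p q)
  moreover have "Im (cnj (amp \<theta> (sol v E 0 1) n) * amp \<theta> (sol v E 1 0) n) = sin \<theta>" for n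
    using sol_Wronskian[of v E n] unfolding amp_Wronskian by simp
  ultimately show ?thesis using LIMSEQ_unique tendsto_const by (simp only:) blast
qed

text \<open>The coefficients of the solution at a shifted energy with respect to the two solutions \<open>p\<close> and \<open>q\<close>
  at the original one; they are normalized so that the pair at \<open>n\<close> represents the solution at both
  \<open>n\<close> and \<open>n + 1\<close>.\<close>

fun coeffs :: "(nat \<Rightarrow> real) \<Rightarrow> (nat \<Rightarrow> real) \<Rightarrow> complex \<Rightarrow> nat \<Rightarrow> complex \<times> complex" where
  "coeffs p q h 0 = (1, 0)"
| "coeffs p q h (Suc n) = (case coeffs p q h n of (x, y) \<Rightarrow>
     let u = x * of_real (p (Suc n)) + y * of_real (q (Suc n))
     in (x + h * of_real (q (Suc n)) * u, y - h * of_real (p (Suc n)) * u))"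

text \<open>The correction of the pair points along (q (Suc n), - p (Suc n)). It therefore leaves
  the value at \<open>Suc n\<close> alone and, by the Wronskian, adds exactly \<open>h * u\<close>
  to the value at \<open>Suc (Suc n)\<close>, which is the effect of the energy shift. Each pair has
  to match two adjacent sites for the second-order recursion to continue, so both claims go through
  one induction.\<close>

lemma sol_variation_of_constants:
  fixes v :: "nat \<Rightarrow> real" and E :: real and h :: complex
  defines "p \<equiv> sol v E 0 1" and "q \<equiv> sol v E 1 0"
  shows "sol v (of_real E + h) 0 1 n = fst (coeffs p q h n) * of_real (p n) + snd (coeffs p q h n) * of_real (q n)"
    and "sol v (of_real E + h) 0 1 (Suc n) =
      fst (coeffs p q h n) * of_real (p (Suc n)) + snd (coeffs p q h n) * of_real (q (Suc n))"
proof (induction n)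
  case 0
  {
    case 1 show ?case by (simp add: p_def q_def)
  next
    case 2 show ?case by (simp add: p_def q_def)
  }
next
  case (Suc n)
  obtain x y where xy: "coeffs p q h n = (x, y)" by force
  define u where "u = x * of_real (p (Suc n)) + y * of_real (q (Suc n))"
  have xy': "coeffs p q h (Suc n) = (x + h * of_real (q (Suc n)) * u, y - h * of_real (p (Suc n)) * u)"
    by (simp add: xy u_def Let_def)
  have uS: "sol v (of_real E + h) 0 1 (Suc n) = u" using Suc(2) by (simp add: xy u_def)
  have un: "sol v (of_real E + h) 0 1 n = x * of_real (p n) + y * of_real (q n)"
    using Suc(1) by (simp add: xy)
  { case 1 show ?case unfolding uS xy' by (simp add: u_def algebra_simps) }
  { case 2
    have W: "complex_of_real (p (Suc (Suc n))) * of_real (q (Suc n)) = of_real (p (Suc n)) * of_real (q (Suc (Suc n))) + 1"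
      using sol_Wronskian[of v E "Suc n"] unfolding p_def[symmetric] q_def[symmetric]
      by (metis add.commute diff_add_cancel of_real_add of_real_mult of_real_1)
    have p2: "p (Suc (Suc n)) = (E - v (Suc n)) * p (Suc n) - p n"
      and q2: "q (Suc (Suc n)) = (E - v (Suc n)) * q (Suc n) - q n"
      by (simp_all add: p_def q_def)
    have "fst (coeffs p q h (Suc n)) * of_real (p (Suc (Suc n))) + snd (coeffs p q h (Suc n)) * of_real (q (Suc (Suc n)))
       = x * of_real (p (Suc (Suc n))) + y * of_real (q (Suc (Suc n))) +
         h * u * (of_real (p (Suc (Suc n))) * of_real (q (Suc n)) - of_real (p (Suc n)) * of_real (q (Suc (Suc n))))"
      unfolding xy' by (simp add: algebra_simps)
    also have "\<dots> = x * of_real (p (Suc (Suc n))) + y * of_real (q (Suc (Suc n))) + h * u"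
      unfolding W by simp
    also have "\<dots> = (of_real E + h - of_real (v (Suc n))) * u - (x * of_real (p n) + y * of_real (q n))"
      unfolding p2 q2 by (simp add: u_def algebra_simps)
    finally show ?case unfolding sol.simps uS un by simp }
qed

section \<open>Elementary bounds for perturbed recursions and oscillating sums\<close>

lemma linear_recursion_bound:
  fixes X :: "nat \<Rightarrow> complex"
  assumes "\<And>n. n < L \<Longrightarrow> norm (X (Suc n) - a * X n) \<le> e n" and "norm a \<le> exp h" "0 \<le> h"
  shows "m \<le> L \<Longrightarrow> norm (X m - a ^ m * X 0) \<le> exp (h * real m) * (\<Sum>n<m. e n)"
proof (induction m)
  case 0 show ?case by simp
next
  case (Suc m)
  have em: "0 \<le> e m" using assms(1)[of m] Suc.prems norm_ge_zero by (meson Suc_le_lessD order_trans)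
  have "X (Suc m) - a ^ Suc m * X 0 = (X (Suc m) - a * X m) + a * (X m - a ^ m * X 0)"
    by (simp add: algebra_simps)
  then have "norm (X (Suc m) - a ^ Suc m * X 0) \<le> norm (X (Suc m) - a * X m) + norm a * norm (X m - a ^ m * X 0)"
    by (metis norm_mult norm_triangle_ineq)
  also have "\<dots> \<le> e m + exp h * (exp (h * real m) * (\<Sum>n<m. e n))"
    using assms Suc by (intro add_mono mult_mono) auto
  also have "\<dots> \<le> exp (h * real (Suc m)) * e m + exp h * (exp (h * real m) * (\<Sum>n<m. e n))"
    using em assms(3) by (intro add_right_mono) (simp add: mult_le_cancel_right1)
  also have "\<dots> = exp (h * real (Suc m)) * (\<Sum>n<Suc m. e n)"
    by (simp add: algebra_simps exp_add)
  finally show ?case .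
qed

text \<open>The point is uniformity in \<open>n\<close>: an oscillation with a fixed frequency has a
  bounded primitive. This is the constant \<open>G\<close> in all later bounds; it is finite because
  \<theta> is not a multiple of pi.\<close>

lemma geometric_unit_bound:
  fixes w :: complex
  assumes "norm w = 1" "w \<noteq> 1"
  shows "norm (\<Sum>j<n. w ^ Suc j) \<le> 2 / norm (1 - w)"
proof -
  have "(\<Sum>j<n. w ^ Suc j) = w * (\<Sum>j<n. w ^ j)" by (simp add: sum_distrib_left)
  also have "\<dots> = w * ((1 - w ^ n) / (1 - w))" using assms by (simp add: sum_gp_strict)
  finally have "norm (\<Sum>j<n. w ^ Suc j) = norm (1 - w ^ n) / norm (1 - w)"
    using assms by (simp add: norm_mult norm_divide)
  also have "norm (1 - w ^ n) \<le> 2"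
    using norm_triangle_ineq4[of 1 "w ^ n"] assms by (simp add: norm_power)
  then have "norm (1 - w ^ n) / norm (1 - w) \<le> 2 / norm (1 - w)" by (simp add: divide_right_mono)
  finally show ?thesis .
qed

lemma norm_exp_minus_linear:
  fixes w :: complex
  shows "norm (exp w - (1 + w)) \<le> exp (norm w) * (norm w)\<^sup>2"
proof -
  have "norm (exp w - (\<Sum>k\<le>1. w ^ k / fact k)) \<le> exp \<bar>Re w\<bar> * norm w ^ Suc 1 / fact 1"
    by (rule Taylor_exp)
  also have "\<dots> \<le> exp (norm w) * norm w ^ 2"
    using abs_Re_le_cmod[of w] by (simp add: mult_right_mono power2_eq_square)
  finally show ?thesis by simp
qed

section \<open>Averaging\<close>

text \<open>The error term is controlled by the near-identity transformation
  \<open>Y \<mapsto> Y + h * g n * Y'\<close>, where \<open>g\<close> is a bounded primitive of the oscillating coefficient.\<close>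

lemma averaging:
  fixes Y Y' :: "nat \<Rightarrow> complex" and h w :: complex and R :: "nat \<Rightarrow> real" and B :: real
  assumes w: "norm w = 1" "w \<noteq> 1"
    and R: "\<And>n. 0 \<le> R n"
    and e: "\<And>n. n < L \<Longrightarrow> norm (Y (Suc n) - Y n - h * (Y n - w ^ Suc n * Y' n)) \<le> R n * (norm (Y n) + norm (Y' n))"
    and e': "\<And>n. n < L \<Longrightarrow> norm (Y' (Suc n) - Y' n) \<le> (norm h + R n) * (norm (Y n) + norm (Y' n))"
    and B: "\<And>n. n \<le> L \<Longrightarrow> norm (Y n) + norm (Y' n) \<le> B"
  defines "G \<equiv> 2 / norm (1 - w)" and "H \<equiv> norm h"
  shows "norm (Y L - exp (real L * h) * Y 0)
    \<le> H * G * B + exp (H * L) * B * ((1 + H * G) * (\<Sum>n<L. R n) + L * H\<^sup>2 * (2 * G + exp H * (1 + H * G)))"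
proof -
  define g where "g n = (\<Sum>j<n. w ^ Suc j)" for n
  have g: "norm (g n) \<le> G" for n unfolding g_def G_def by (rule geometric_unit_bound[OF w])
  have H0: "0 \<le> H" and G0: "0 \<le> G" by (auto simp: H_def G_def)
  have B0: "0 \<le> B" using B[of 0] norm_ge_zero[of "Y 0"] norm_ge_zero[of "Y' 0"] by linarith
  define Z where "Z n = Y n + h * g n * Y' n" for n
  have step: "norm (Z (Suc n) - exp h * Z n)
      \<le> B * ((1 + H * G) * R n + H\<^sup>2 * (2 * G + exp H * (1 + H * G)))" if n: "n < L" for n
  proof -
    have B': "norm (Y n) + norm (Y' n) \<le> B" and Yn: "norm (Y n) \<le> B" and Y'n: "norm (Y' n) \<le> B"
      using B[of n] n norm_ge_zero[of "Y n"] norm_ge_zero[of "Y' n"] by linarith+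
    let ?a = "Y (Suc n) - Y n - h * (Y n - w ^ Suc n * Y' n)"
    let ?b = "h * g (Suc n) * (Y' (Suc n) - Y' n)"
    let ?c = "h\<^sup>2 * g n * Y' n"
    let ?d = "(exp h - (1 + h)) * Z n"
    have gS: "g (Suc n) = g n + w ^ Suc n" by (simp add: g_def)
    \<comment> \<open>The oscillating term \<open>h * w ^ Suc n * Y' n\<close> cancels against the
      increment of \<open>g\<close>. What is left is the given error, \<open>h\<close> times a small
      increment of \<open>Y'\<close>, and two terms of second order in \<open>h\<close>.\<close>
    have eq: "Z (Suc n) - exp h * Z n = ?a + ?b - ?c - ?d"
      unfolding Z_def gS by (simp add: algebra_simps power2_eq_square)
    have a: "norm ?a \<le> R n * B"
      using e[OF n] mult_left_mono[OF B' R[of n]] by linarith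
    have "norm (Y' (Suc n) - Y' n) \<le> (H + R n) * B"
      using e'[OF n] mult_left_mono[OF B', of "H + R n"] R[of n] H0 by (simp add: H_def)
    then have b: "norm ?b \<le> H * G * ((H + R n) * B)"
      unfolding norm_mult using g[of "Suc n"] H0 G0 by (intro mult_mono) (auto simp: H_def)
    have c: "norm ?c \<le> H\<^sup>2 * G * B"
      unfolding norm_mult norm_power using g[of n] Y'n G0 by (intro mult_mono) (auto simp: H_def)
    have "norm (Z n) \<le> norm (Y n) + H * norm (g n) * norm (Y' n)"
      unfolding Z_def H_def by (metis norm_mult norm_triangle_ineq)
    also have "\<dots> \<le> B + H * G * B"
      using Yn Y'n g[of n] H0 G0 by (intro add_mono mult_mono) auto
    finally have Zn: "norm (Z n) \<le> (1 + H * G) * B" by (simp add: algebra_simps)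
    have d: "norm ?d \<le> (exp H * H\<^sup>2) * ((1 + H * G) * B)"
      unfolding norm_mult using norm_exp_minus_linear[of h] Zn by (intro mult_mono) (auto simp: H_def)
    have "norm (?a + ?b - ?c - ?d) \<le> norm ?a + norm ?b + norm ?c + norm ?d"
      by (smt (verit) norm_triangle_ineq norm_triangle_ineq4)
    also have "\<dots> \<le> R n * B + H * G * ((H + R n) * B) + H\<^sup>2 * G * B + (exp H * H\<^sup>2) * ((1 + H * G) * B)"
      using a b c d by linarith
    also have "\<dots> = B * ((1 + H * G) * R n + H\<^sup>2 * (2 * G + exp H * (1 + H * G)))"
      by (simp add: algebra_simps power2_eq_square)
    finally show ?thesis unfolding eq .
  qed
  have "norm (Z L - exp h ^ L * Z 0)
     \<le> exp (H * real L) * (\<Sum>n<L. B * ((1 + H * G) * R n + H\<^sup>2 * (2 * G + exp H * (1 + H * G))))"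
    by (rule linear_recursion_bound[where e = "\<lambda>n. B * ((1 + H * G) * R n + H\<^sup>2 * (2 * G + exp H * (1 + H * G)))", OF _ _ H0 order_refl])
      (use step abs_Re_le_cmod[of h] in \<open>auto simp: H_def norm_exp\<close>)
  also have "(\<Sum>n<L. B * ((1 + H * G) * R n + H\<^sup>2 * (2 * G + exp H * (1 + H * G))))
     = B * ((1 + H * G) * (\<Sum>n<L. R n) + L * H\<^sup>2 * (2 * G + exp H * (1 + H * G)))"
    by (simp add: sum.distrib sum_distrib_left algebra_simps)
  also have "exp h ^ L = exp (real L * h)" by (simp add: exp_of_nat_mult)
  finally have 1: "norm (Z L - exp (real L * h) * Y 0)
     \<le> exp (H * L) * B * ((1 + H * G) * (\<Sum>n<L. R n) + L * H\<^sup>2 * (2 * G + exp H * (1 + H * G)))"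
    by (simp add: Z_def g_def mult.assoc)
  have Y'L: "norm (Y' L) \<le> B" using B[of L] norm_ge_zero[of "Y L"] by linarith
  have 2: "norm (h * g L * Y' L) \<le> H * G * B"
    unfolding norm_mult using g[of L] Y'L G0 by (intro mult_mono) (auto simp: H_def)
  have "Y L - exp (real L * h) * Y 0 = (Z L - exp (real L * h) * Y 0) - h * g L * Y' L"
    by (simp add: Z_def)
  then have "norm (Y L - exp (real L * h) * Y 0) \<le> norm (Z L - exp (real L * h) * Y 0) + norm (h * g L * Y' L)"
    using norm_triangle_ineq4 by metis
  then show ?thesis using 1 2 by linarith
qed

lemma discrete_Gronwall:
  fixes S K :: "nat \<Rightarrow> real"
  assumes "\<And>n. n < L \<Longrightarrow> S (Suc n) \<le> (1 + K n) * S n" "\<And>n. 0 \<le> K n" "\<And>n. 0 \<le> S n"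
  shows "m \<le> L \<Longrightarrow> S m \<le> exp (\<Sum>n<L. K n) * S 0"
proof -
  have *: "m \<le> L \<Longrightarrow> S m \<le> exp (\<Sum>n<m. K n) * S 0" for m
  proof (induction m)
    case 0 show ?case by simp
  next
    case (Suc m)
    have "S (Suc m) \<le> (1 + K m) * S m" using assms(1) Suc.prems by auto
    also have "\<dots> \<le> exp (K m) * (exp (\<Sum>n<m. K n) * S 0)"
      using Suc exp_ge_add_one_self[of "K m"] assms(2)[of m] assms(3) by (intro mult_mono) auto
    also have "\<dots> = exp (\<Sum>n<Suc m. K n) * S 0" by (simp add: exp_add mult_ac)
    finally show ?case .
  qed
  assume "m \<le> L"
  then have "S m \<le> exp (\<Sum>n<m. K n) * S 0" by (rule *)
  also have "\<dots> \<le> exp (\<Sum>n<L. K n) * S 0"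
    using \<open>m \<le> L\<close> assms(2,3) by (intro mult_right_mono) (auto intro!: sum_mono2)
  finally show ?thesis .
qed

text \<open>Cramer's rule: the determinant of the coordinate change has modulus
  \<open>2 * \<bar>s\<bar>\<close>.\<close>

lemma coordinates_bound:
  fixes x y c d :: complex and s K :: real
  assumes s: "s \<noteq> 0" and cd: "Im (cnj c * d) = s" and K: "norm c \<le> K" "norm d \<le> K"
  shows "norm x \<le> K * (norm (c * x + d * y) + norm (cnj c * x + cnj d * y)) / (2 * \<bar>s\<bar>)"
    and "norm y \<le> K * (norm (c * x + d * y) + norm (cnj c * x + cnj d * y)) / (2 * \<bar>s\<bar>)"
proof -
  define j Y Y' where "j = 2 * \<i> * of_real s" and "Y = c * x + d * y" and "Y' = cnj c * x + cnj d * y"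
  have j0: "j \<noteq> 0" and nj: "norm j = 2 * \<bar>s\<bar>" using s by (auto simp: j_def norm_mult)
  have cdj: "cnj c * d - c * cnj d = j"
    using cd by (simp add: j_def complex_eq_iff algebra_simps)
  have "x * j = Y' * d - Y * cnj d" "y * j = Y * cnj c - Y' * c"
    unfolding cdj[symmetric] Y_def Y'_def by (simp_all add: algebra_simps)
  then have "x = (Y' * d - Y * cnj d) / j" "y = (Y * cnj c - Y' * c) / j" using j0 by (simp_all add: field_simps)
  moreover have "norm (Y' * d - Y * cnj d) \<le> K * (norm Y + norm Y')" "norm (Y * cnj c - Y' * c) \<le> K * (norm Y + norm Y')"
    using norm_triangle_ineq4[of "Y' * d" "Y * cnj d"] norm_triangle_ineq4[of "Y * cnj c" "Y' * c"]
      mult_right_mono[OF K(1), of "norm Y"] mult_right_mono[OF K(1), of "norm Y'"]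
      mult_right_mono[OF K(2), of "norm Y"] mult_right_mono[OF K(2), of "norm Y'"]
    by (simp_all add: norm_mult algebra_simps)
  ultimately show "norm x \<le> K * (norm (c * x + d * y) + norm (cnj c * x + cnj d * y)) / (2 * \<bar>s\<bar>)"
    and "norm y \<le> K * (norm (c * x + d * y) + norm (cnj c * x + cnj d * y)) / (2 * \<bar>s\<bar>)"
    unfolding Y_def[symmetric] Y'_def[symmetric] by (simp_all add: norm_divide nj divide_right_mono)
qed

text \<open>In the coordinates \<open>Y\<close>, \<open>Y'\<close>, the averaged system is diagonal: it multiplies \<open>Y\<close> by
  \<open>1 + h / j\<close>. The matching statement for \<open>Y'\<close> is obtained by conjugating \<open>c\<close>, \<open>d\<close> and negating \<open>s\<close>, \<open>t\<close>.\<close>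

lemma coeffs_step:
  fixes x y c d h :: complex and P Q P' Q' s t K :: real
  defines "\<zeta> \<equiv> cis t" and "j \<equiv> 2 * \<i> * of_real s"
    and "Y \<equiv> c * x + d * y" and "Y' \<equiv> cnj c * x + cnj d * y" and "r \<equiv> \<bar>P'\<bar> + \<bar>Q'\<bar>"
    and "u \<equiv> x * of_real P + y * of_real Q"
  assumes s: "s \<noteq> 0" and cd: "Im (cnj c * d) = s" and K: "1 \<le> K" "norm c \<le> K" "norm d \<le> K"
    and P: "P = Im (cis t * c) / s + P'" and Q: "Q = Im (cis t * d) / s + Q'"
  shows "norm (c * (h * of_real Q * u) - d * (h * of_real P * u) - h / j * (Y - (cnj \<zeta>)\<^sup>2 * Y'))
     \<le> norm h * (K\<^sup>2 / \<bar>s\<bar> * (r + r\<^sup>2)) * (norm Y + norm Y')"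
proof -
  have j0: "j \<noteq> 0" and nj: "norm j = 2 * \<bar>s\<bar>" using s by (auto simp: j_def norm_mult)
  have zz: "\<zeta> * cnj \<zeta> = 1" by (simp add: \<zeta>_def cis_cnj cis_mult)
  have nz: "norm \<zeta> = 1" "norm (cnj \<zeta>) = 1" by (auto simp: \<zeta>_def)
  have im: "of_real (Im w / s) = (w - cnj w) / j" for w
    using s by (simp add: j_def complex_diff_cnj)
  have cdj: "cnj c * d - c * cnj d = j"
    using cd by (simp add: j_def complex_eq_iff algebra_simps)
  \<comment> \<open>Each solution value is its asymptotic form, the sum of two conjugate
    oscillations, plus a deviation \<open>P'\<close> or \<open>Q'\<close>. The deviations are
    collected in \<open>D\<close> and \<open>v\<close>, the asymptotic parts in
    \<open>cnj \<zeta>\<close> and \<open>w\<close>.\<close>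
  have Pc: "of_real P = (\<zeta> * c - cnj \<zeta> * cnj c) / j + of_real P'"
    and Qc: "of_real Q = (\<zeta> * d - cnj \<zeta> * cnj d) / j + of_real Q'"
    unfolding P Q of_real_add im \<zeta>_def by simp_all
  define D where "D = c * of_real Q' - d * of_real P'"
  define v where "v = x * of_real P' + y * of_real Q'"
  define w where "w = (\<zeta> * Y - cnj \<zeta> * Y') / j"
  have u: "u = w + v"
    unfolding u_def Pc Qc w_def v_def Y_def Y'_def using j0 by (simp add: field_simps)
  \<comment> \<open>The terms with \<open>\<zeta>\<close> cancel, and the rest is
    \<open>cnj \<zeta>\<close> times the Wronskian \<open>j\<close>, divided by
    \<open>j\<close>.\<close>
  have "c * of_real Q - d * of_real P = cnj \<zeta> * (cnj c * d - c * cnj d) / j + D"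
    unfolding Pc Qc D_def using j0 by (simp add: field_simps)
  then have cQ: "c * of_real Q - d * of_real P = cnj \<zeta> + D" unfolding cdj using j0 by simp
  \<comment> \<open>Here the mean separates from the oscillation: the phases cancel in front of
    \<open>Y\<close> and add up in front of \<open>Y'\<close>.\<close>
  have wz: "w * cnj \<zeta> = (Y - (cnj \<zeta>)\<^sup>2 * Y') / j"
  proof -
    have "w * cnj \<zeta> = ((\<zeta> * cnj \<zeta>) * Y - (cnj \<zeta>)\<^sup>2 * Y') / j"
      unfolding w_def power2_eq_square by (simp add: algebra_simps)
    then show ?thesis unfolding zz by simp
  qed
  have "c * (h * of_real Q * u) - d * (h * of_real P * u) = h * u * (c * of_real Q - d * of_real P)"
    by (simp add: algebra_simps)
  also have "\<dots> = h * (w + v) * (cnj \<zeta> + D)" unfolding cQ u ..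
  also have "\<dots> = h * (w * cnj \<zeta>) + h * (w * D + v * (cnj \<zeta> + D))" by (simp add: algebra_simps)
  finally have eq: "c * (h * of_real Q * u) - d * (h * of_real P * u) - h / j * (Y - (cnj \<zeta>)\<^sup>2 * Y')
     = h * (w * D + v * (cnj \<zeta> + D))" unfolding wz by simp
  define S where "S = norm Y + norm Y'"
  have S0: "0 \<le> S" and r0: "0 \<le> r" by (auto simp: S_def r_def)
  have a: "0 < \<bar>s\<bar>" using s by simp
  have nw: "norm w \<le> S / (2 * \<bar>s\<bar>)"
    unfolding w_def norm_divide nj S_def
    using norm_triangle_ineq4[of "\<zeta> * Y" "cnj \<zeta> * Y'"] nz by (intro divide_right_mono) (auto simp: norm_mult)
  have nD: "norm D \<le> K * r"
  proof -
    have "norm D \<le> norm c * \<bar>Q'\<bar> + norm d * \<bar>P'\<bar>"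
      unfolding D_def using norm_triangle_ineq4[of "c * of_real Q'" "d * of_real P'"] by (simp add: norm_mult)
    also have "\<dots> \<le> K * \<bar>Q'\<bar> + K * \<bar>P'\<bar>" using K by (intro add_mono mult_right_mono) auto
    finally show ?thesis by (simp add: r_def algebra_simps)
  qed
  have nx: "norm x \<le> K * S / (2 * \<bar>s\<bar>)" and ny: "norm y \<le> K * S / (2 * \<bar>s\<bar>)"
    using coordinates_bound[OF s cd K(2,3), where x = x and y = y] by (simp_all add: S_def Y_def Y'_def)
  have nv: "norm v \<le> K * S / (2 * \<bar>s\<bar>) * r"
  proof -
    have "norm v \<le> norm x * \<bar>P'\<bar> + norm y * \<bar>Q'\<bar>"
      unfolding v_def using norm_triangle_ineq[of "x * of_real P'" "y * of_real Q'"] by (simp add: norm_mult)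
    also have "\<dots> \<le> K * S / (2 * \<bar>s\<bar>) * \<bar>P'\<bar> + K * S / (2 * \<bar>s\<bar>) * \<bar>Q'\<bar>"
      using nx ny by (intro add_mono mult_right_mono) auto
    finally show ?thesis by (simp add: r_def algebra_simps add_divide_distrib)
  qed
  have "norm (w * D + v * (cnj \<zeta> + D)) \<le> norm w * norm D + norm v * (norm (cnj \<zeta>) + norm D)"
    by (metis (no_types, opaque_lifting) add_mono_thms_linordered_semiring(2) mult_left_mono norm_ge_zero norm_mult
        norm_triangle_ineq norm_triangle_le)
  also have "\<dots> \<le> S / (2 * \<bar>s\<bar>) * (K * r) + K * S / (2 * \<bar>s\<bar>) * r * (1 + K * r)"
    using nw nD nv nz r0 S0 K by (intro add_mono mult_mono) auto
  also have "\<dots> = S / (2 * \<bar>s\<bar>) * (2 * (K * r) + K\<^sup>2 * r\<^sup>2)"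
    using a by (simp add: field_simps power2_eq_square)
  \<comment> \<open>Since \<open>1 \<le> K\<close>, the linear and the quadratic term can share the
    constant \<open>K\<^sup>2\<close>, which leaves \<open>r + r\<^sup>2\<close> as the only
    dependence on the deviations.\<close>
  also have "\<dots> \<le> S / (2 * \<bar>s\<bar>) * (2 * (K\<^sup>2 * r) + 2 * (K\<^sup>2 * r\<^sup>2))"
  proof -
    have "K * r \<le> K\<^sup>2 * r" using K r0 by (intro mult_right_mono) (auto simp: power2_eq_square)
    then show ?thesis using S0 a by (intro mult_left_mono add_mono) auto
  qed
  also have "\<dots> = K\<^sup>2 / \<bar>s\<bar> * (r + r\<^sup>2) * S" using a by (simp add: field_simps)
  finally have "norm h * norm (w * D + v * (cnj \<zeta> + D)) \<le> norm h * (K\<^sup>2 / \<bar>s\<bar> * (r + r\<^sup>2) * S)"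
    by (rule mult_left_mono) simp
  then show ?thesis unfolding eq unfolding S_def norm_mult mult.assoc .
qed

text \<open>The bound of \<open>averaging\<close> after \<open>norm h\<close> has been replaced by
  \<open>H0 / N\<close> and the sum of the errors by \<open>l * \<rho>\<close>. The spectral
  parameter has disappeared from it, which is what makes the later convergence uniform on
  discs.\<close>

definition avg_err :: "real \<Rightarrow> real \<Rightarrow> real \<Rightarrow> real \<Rightarrow> real \<Rightarrow> real \<Rightarrow> real" where
  "avg_err G B H0 l N \<rho> = (H0 / N) * G * B + exp H0 * B * ((1 + (H0 / N) * G) * (l * \<rho>) +
      H0 * (H0 / N) * (2 * G + exp (H0 / N) * (1 + (H0 / N) * G)))"

lemma averaging_uniform:
  fixes Y Y' :: "nat \<Rightarrow> complex" and h w :: complex and R :: "nat \<Rightarrow> real" and B H0 :: real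
  assumes w: "norm w = 1" "w \<noteq> 1" and N: "0 < N"
    and R: "\<And>n. 0 \<le> R n"
    and e: "\<And>n. n < N \<Longrightarrow> norm (Y (Suc n) - Y n - h * (Y n - w ^ Suc n * Y' n)) \<le> R n * (norm (Y n) + norm (Y' n))"
    and e': "\<And>n. n < N \<Longrightarrow> norm (Y' (Suc n) - Y' n) \<le> (norm h + R n) * (norm (Y n) + norm (Y' n))"
    and B: "\<And>n. n \<le> N \<Longrightarrow> norm (Y n) + norm (Y' n) \<le> B"
    and h: "norm h \<le> H0 / N" and RS: "(\<Sum>n<N. R n) \<le> l * \<rho>"
    and G: "2 / norm (1 - w) \<le> G"
  shows "norm (Y N - exp (real N * h) * Y 0) \<le> avg_err G B H0 l N \<rho>"
proof -
  let ?G = "2 / norm (1 - w)" and ?H = "norm h"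
  have G0: "0 \<le> ?G" by simp
  then have G1: "0 \<le> G" using G by linarith
  have B0: "0 \<le> B" using B[of 0] norm_ge_zero[of "Y 0"] norm_ge_zero[of "Y' 0"] by linarith
  have H00: "0 \<le> H0" using h N norm_ge_zero[of h] by (metis divide_eq_0_iff divide_nonneg_pos mult_of_nat_commute not_le of_nat_0_less_iff order_trans pos_le_divide_eq zero_le_divide_iff)
  have HN: "?H * N \<le> H0" using h N by (simp add: field_simps)
  have NH: "N * ?H\<^sup>2 \<le> H0 * (H0 / N)"
  proof -
    have "(?H * N) * ?H \<le> H0 * (H0 / N)" using HN h H00 by (intro mult_mono) auto
    then show ?thesis by (simp add: power2_eq_square mult_ac)
  qed
  have "norm (Y N - exp (real N * h) * Y 0)
    \<le> ?H * ?G * B + exp (?H * N) * B * ((1 + ?H * ?G) * (\<Sum>n<N. R n) + N * ?H\<^sup>2 * (2 * ?G + exp ?H * (1 + ?H * ?G)))"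
    by (rule averaging[OF w R e e' B])
  also have "\<dots> \<le> avg_err G B H0 l N \<rho>"
  proof -
    have HG: "?H * ?G \<le> (H0 / N) * G" using h G G0 H00 by (intro mult_mono) auto
    have b1: "?H * ?G * B \<le> (H0 / N) * G * B" using HG B0 by (intro mult_right_mono)
    have b2: "(1 + ?H * ?G) * (\<Sum>n<N. R n) \<le> (1 + (H0 / N) * G) * (l * \<rho>)"
      using HG RS R H00 G1 h G by (intro mult_mono[of "1 + ?H * ?G"] add_mono sum_nonneg) auto
    have b3: "N * ?H\<^sup>2 * (2 * ?G + exp ?H * (1 + ?H * ?G))
        \<le> H0 * (H0 / N) * (2 * G + exp (H0 / N) * (1 + (H0 / N) * G))"
      by (rule mult_mono[OF NH]) (use HG G h H00 in \<open>auto intro!: add_mono mult_mono add_nonneg_nonneg\<close>)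
    have b4: "exp (?H * N) * B \<le> exp H0 * B" using HN B0 by (intro mult_right_mono) auto
    have "0 \<le> (1 + ?H * ?G) * (\<Sum>n<N. R n) + N * ?H\<^sup>2 * (2 * ?G + exp ?H * (1 + ?H * ?G))"
      using R by (intro add_nonneg_nonneg mult_nonneg_nonneg sum_nonneg) auto
    then have "exp (?H * N) * B * ((1 + ?H * ?G) * (\<Sum>n<N. R n) + N * ?H\<^sup>2 * (2 * ?G + exp ?H * (1 + ?H * ?G)))
       \<le> exp H0 * B * ((1 + (H0 / N) * G) * (l * \<rho>) + H0 * (H0 / N) * (2 * G + exp (H0 / N) * (1 + (H0 / N) * G)))"
      using b2 b3 b4 B0 by (intro mult_mono[OF b4] add_mono) auto
    then show ?thesis unfolding avg_err_def using b1 by linarith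
  qed
  finally show ?thesis .
qed

lemma avg_err_tendsto:
  assumes "filterlim N at_top sequentially" "\<rho> \<longlonglongrightarrow> 0"
  shows "(\<lambda>k. avg_err G B H0 l (real (N k)) (\<rho> k)) \<longlonglongrightarrow> 0"
proof -
  have H: "(\<lambda>k. H0 / real (N k)) \<longlonglongrightarrow> 0"
    by (intro tendsto_divide_0[OF tendsto_const] filterlim_compose[OF filterlim_at_top_imp_at_infinity assms(1)]
       filterlim_compose[OF filterlim_real_sequentially assms(1)] filterlim_at_top_imp_at_infinity)
  have "(\<lambda>k. avg_err G B H0 l (real (N k)) (\<rho> k)) \<longlonglongrightarrow> 0 * G * B + exp H0 * B * ((1 + 0 * G) * (l * 0) +
      H0 * 0 * (2 * G + exp 0 * (1 + 0 * G)))"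
    unfolding avg_err_def by (intro tendsto_intros H assms(2))
  then show ?thesis by simp
qed

lemma cis_minus_double_power: "cis (-2 * \<theta>) ^ n = (cnj (cis (real n * \<theta>)))\<^sup>2"
  by (simp add: cis_cnj cis_mult Complex.DeMoivre power2_eq_square algebra_simps)

lemma cis_double_neq_1:
  assumes "sin \<theta> \<noteq> 0" shows "cis (2 * \<theta>) \<noteq> 1" "cis (-2 * \<theta>) \<noteq> 1"
proof -
  have "Re (cis (2 * \<theta>)) \<noteq> 1" "Re (cis (-2 * \<theta>)) \<noteq> 1"
    using assms by (simp_all add: cos_double_sin)
  then show "cis (2 * \<theta>) \<noteq> 1" "cis (-2 * \<theta>) \<noteq> 1" by (metis one_complex.sel(1))+
qed

text \<open>Averaging multiplies \<open>Y\<close> by \<open>1 + h / j\<close> and \<open>Y'\<close>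
  by \<open>1 - h / j\<close> in each of the \<open>N\<close> steps, where
  \<open>h = lam / N\<close> and \<open>j = 2 * \<i> * s\<close>; hence the two exponentials, and
  the initial pair (1, 0) contributes the factors \<open>c\<close> and \<open>cnj c\<close>. The
  constant \<open>B\<close> is a Gronwall bound: \<open>2 * K\<close> dominates the initial values,
  \<open>\<Lambda> / s\<close> comes from the mean drift and the other exponent from the accumulated
  errors, each doubled because two components grow. \<open>G\<close> is a maximum because
  \<open>Y\<close> and \<open>Y'\<close> oscillate with conjugate frequencies.\<close>

lemma coeffs_asymptotics:
  fixes c d lam :: complex and p q :: "nat \<Rightarrow> real" and \<theta> K \<Lambda> \<rho> :: real and N :: nat
  defines "s \<equiv> sin \<theta>" 
  defines "X \<equiv> \<lambda>n. fst (coeffs p q (lam / N) n)" and "Z \<equiv> \<lambda>n. snd (coeffs p q (lam / N) n)"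
  defines "Y \<equiv> \<lambda>n. c * X n + d * Z n" and "Y' \<equiv> \<lambda>n. cnj c * X n + cnj d * Z n"
  defines "r \<equiv> \<lambda>n. \<bar>p (Suc n) - Im (cis (real (Suc n) * \<theta>) * c) / s\<bar> + \<bar>q (Suc n) - Im (cis (real (Suc n) * \<theta>) * d) / s\<bar>"
  defines "B \<equiv> 2 * K * exp (\<Lambda> / s + 2 * \<Lambda> * (K\<^sup>2 / s))"
  defines "G \<equiv> max (2 / norm (1 - cis (2 * \<theta>))) (2 / norm (1 - cis (-2 * \<theta>)))"
  assumes s: "0 < s" and cd: "Im (cnj c * d) = s" and K: "1 \<le> K" "norm c \<le> K" "norm d \<le> K"
    and N: "0 < N" and lam: "norm lam \<le> \<Lambda>"
    and rho: "(\<Sum>n<N. r n + (r n)\<^sup>2) \<le> N * \<rho>" "\<rho> \<le> 1"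
  shows "norm (Y N) + norm (Y' N) \<le> B"
    and "norm (Y N - exp (lam / (2 * \<i> * s)) * c) \<le> avg_err G B (\<Lambda> / (2 * s)) (\<Lambda> * (K\<^sup>2 / s)) N \<rho>"
    and "norm (Y' N - exp (- (lam / (2 * \<i> * s))) * cnj c) \<le> avg_err G B (\<Lambda> / (2 * s)) (\<Lambda> * (K\<^sup>2 / s)) N \<rho>"
proof -
  define h where "h = lam / of_nat N"
  define j where "j = 2 * \<i> * complex_of_real s"
  define R where "R n = norm h * (K\<^sup>2 / s * (r n + (r n)\<^sup>2))" for n
  have nj: "norm j = 2 * s" and j0: "j \<noteq> 0" using s by (auto simp: j_def norm_mult)
  have K0: "0 \<le> K" using K by simp
  have lam0: "0 \<le> \<Lambda>" using lam norm_ge_zero order_trans by blast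
  have r0: "0 \<le> r n" for n by (auto simp: r_def)
  have R0: "0 \<le> R n" for n using r0 s by (auto simp: R_def)
  have h: "norm h \<le> \<Lambda> / N" using lam N by (simp add: h_def norm_divide divide_right_mono)
  have hj: "norm (h / j) \<le> (\<Lambda> / (2 * s)) / N"
    using h s N by (simp add: norm_divide nj field_simps)
  have step: "X (Suc n) = X n + h * of_real (q (Suc n)) * (X n * of_real (p (Suc n)) + Z n * of_real (q (Suc n)))"
    "Z (Suc n) = Z n - h * of_real (p (Suc n)) * (X n * of_real (p (Suc n)) + Z n * of_real (q (Suc n)))" for n
    by (simp_all add: X_def Z_def h_def Let_def split: prod.split)
  have YS: "norm (Y (Suc n) - Y n - h / j * (Y n - cis (-2 * \<theta>) ^ Suc n * Y' n)) \<le> R n * (norm (Y n) + norm (Y' n))" for n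
  proof -
    have "Y (Suc n) - Y n = c * (h * of_real (q (Suc n)) * (X n * of_real (p (Suc n)) + Z n * of_real (q (Suc n)))) -
        d * (h * of_real (p (Suc n)) * (X n * of_real (p (Suc n)) + Z n * of_real (q (Suc n))))"
      unfolding Y_def step by (simp add: algebra_simps)
    then show ?thesis
      using coeffs_step[where s = s and c = c and d = d and K = K and t = "real (Suc n) * \<theta>" and P = "p (Suc n)"
        and Q = "q (Suc n)" and h = h and x = "X n" and y = "Z n"
        and P' = "p (Suc n) - Im (cis (real (Suc n) * \<theta>) * c) / s" and Q' = "q (Suc n) - Im (cis (real (Suc n) * \<theta>) * d) / s"]
      using s cd K unfolding cis_minus_double_power R_def r_def Y_def Y'_def j_def by (simp del: of_nat_Suc)
  qed
  have YS': "norm (Y' (Suc n) - Y' n - (- h / j) * (Y' n - cis (2 * \<theta>) ^ Suc n * Y n)) \<le> R n * (norm (Y' n) + norm (Y n))" for n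
  proof -
    have "Y' (Suc n) - Y' n = cnj c * (h * of_real (q (Suc n)) * (X n * of_real (p (Suc n)) + Z n * of_real (q (Suc n)))) -
        cnj d * (h * of_real (p (Suc n)) * (X n * of_real (p (Suc n)) + Z n * of_real (q (Suc n))))"
      unfolding Y'_def step by (simp add: algebra_simps)
    \<comment> \<open>Conjugating \<open>c\<close> and negating both the angle and \<open>s\<close>
      does not change the asymptotic values of \<open>p\<close> and \<open>q\<close>, so the same
      deviations, and hence the same \<open>R\<close>, serve for \<open>Y'\<close>.\<close>
    moreover have im: "Im (cis (- (real (Suc n) * \<theta>)) * cnj z) / - s = Im (cis (real (Suc n) * \<theta>) * z) / s" for z
    proof -
      have "Im (cis (- x) * cnj z) = - Im (cis x * z)" for x by simp
      then show ?thesis by (simp only: minus_divide_divide)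
    qed
    moreover have "cis (2 * \<theta>) ^ Suc n = (cnj (cis (- (real (Suc n) * \<theta>))))\<^sup>2"
      using cis_minus_double_power[of "- \<theta>" "Suc n"] by (simp del: of_nat_Suc)
    moreover have "Im (cnj (cnj c) * cnj d) = - s" using cd by simp
    ultimately show ?thesis
      using coeffs_step[where s = "- s" and c = "cnj c" and d = "cnj d" and K = K and t = "- (real (Suc n) * \<theta>)" and P = "p (Suc n)"
        and Q = "q (Suc n)" and h = h and x = "X n" and y = "Z n"
        and P' = "p (Suc n) - Im (cis (real (Suc n) * \<theta>) * c) / s" and Q' = "q (Suc n) - Im (cis (real (Suc n) * \<theta>) * d) / s"]
      using s K unfolding R_def r_def Y_def Y'_def j_def im by (simp del: of_nat_Suc)
  qed
  \<comment> \<open>Forgetting the cancellation gives a crude increment bound. It is used twice: as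
    the slow-variation hypothesis of the averaging lemma and in the Gronwall argument for
    \<open>B\<close>.\<close>
  have drop: "norm (a - b) \<le> (norm g + \<epsilon>) * (norm b + norm f)"
    if "norm (a - b - g * (b - w * f)) \<le> \<epsilon> * (norm b + norm f)" "norm w = 1" for a b f g w :: complex and \<epsilon>
  proof -
    have "norm (a - b) \<le> norm (a - b - g * (b - w * f)) + norm (g * (b - w * f))"
      using norm_triangle_ineq[of "a - b - g * (b - w * f)" "g * (b - w * f)"] by simp
    moreover have "norm (g * (b - w * f)) \<le> norm g * (norm b + norm f)"
      unfolding norm_mult using norm_triangle_ineq4[of b "w * f"] that(2) by (intro mult_left_mono) (auto simp: norm_mult)
    ultimately show ?thesis using that(1) by (simp add: algebra_simps)
  qed
  have YD: "norm (Y (Suc n) - Y n) \<le> (norm (h / j) + R n) * (norm (Y n) + norm (Y' n))" for n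
    by (rule drop[OF YS]) (simp add: norm_power norm_mult)
  have YD': "norm (Y' (Suc n) - Y' n) \<le> (norm (h / j) + R n) * (norm (Y' n) + norm (Y n))" for n
    using drop[OF YS'] by (simp add: norm_power norm_divide norm_mult)
  have RS: "(\<Sum>n<N. R n) \<le> \<Lambda> * (K\<^sup>2 / s) * \<rho>"
  proof -
    have "(\<Sum>n<N. R n) = norm h * (K\<^sup>2 / s) * (\<Sum>n<N. r n + (r n)\<^sup>2)"
      unfolding R_def by (simp only: sum_distrib_left mult.assoc)
    also have "\<dots> \<le> (\<Lambda> / N) * (K\<^sup>2 / s) * (N * \<rho>)"
      using s r0 lam0 by (intro mult_mono[OF mult_right_mono[OF h] rho(1)] sum_nonneg) auto
    finally show ?thesis using N by (simp add: mult_ac)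
  qed
  have S0: "norm (Y 0) + norm (Y' 0) \<le> 2 * K" using K by (simp add: Y_def Y'_def X_def Z_def)
  have B: "norm (Y m) + norm (Y' m) \<le> B" if "m \<le> N" for m
  proof -
    have "norm (Y m) + norm (Y' m) \<le> exp (\<Sum>n<N. 2 * (norm (h / j) + R n)) * (norm (Y 0) + norm (Y' 0))"
    proof (rule discrete_Gronwall[where L = N, OF _ _ _ that])
      fix n
      have "norm (Y (Suc n)) \<le> norm (Y n) + (norm (h / j) + R n) * (norm (Y n) + norm (Y' n))"
        using YD[of n] norm_triangle_ineq[of "Y n" "Y (Suc n) - Y n"] by simp
      moreover have "norm (Y' (Suc n)) \<le> norm (Y' n) + (norm (h / j) + R n) * (norm (Y n) + norm (Y' n))"
        using YD'[of n] norm_triangle_ineq[of "Y' n" "Y' (Suc n) - Y' n"] by (simp add: add.commute)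
      ultimately show "norm (Y (Suc n)) + norm (Y' (Suc n)) \<le> (1 + 2 * (norm (h / j) + R n)) * (norm (Y n) + norm (Y' n))"
        by (simp add: algebra_simps)
    qed (use R0 in auto)
    also have "\<dots> \<le> exp (\<Lambda> / s + 2 * \<Lambda> * (K\<^sup>2 / s)) * (2 * K)"
    proof (intro mult_mono S0)
      have "(\<Sum>n<N. 2 * (norm (h / j) + R n)) = 2 * (N * norm (h / j) + (\<Sum>n<N. R n))"
        by (simp add: sum.distrib sum_distrib_left[symmetric])
      also have "\<dots> \<le> 2 * (\<Lambda> / (2 * s) + \<Lambda> * (K\<^sup>2 / s) * \<rho>)"
      proof -
        have "N * norm (h / j) \<le> N * ((\<Lambda> / (2 * s)) / N)" using hj by (intro mult_left_mono) auto
        then show ?thesis using RS N by simp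
      qed
      \<comment> \<open>Using \<open>\<rho> \<le> 1\<close> here keeps \<open>B\<close> independent
        of \<open>\<rho>\<close>, so that the error can tend to zero with a fixed
        \<open>B\<close>.\<close>
      also have "\<dots> \<le> 2 * (\<Lambda> / (2 * s) + \<Lambda> * (K\<^sup>2 / s) * 1)"
        using rho lam0 s by (intro mult_left_mono add_mono) auto
      finally show "exp (\<Sum>n<N. 2 * (norm (h / j) + R n)) \<le> exp (\<Lambda> / s + 2 * \<Lambda> * (K\<^sup>2 / s))" by simp
    qed (use K0 in auto)
    finally show ?thesis by (simp add: B_def mult_ac)
  qed
  then show "norm (Y N) + norm (Y' N) \<le> B" by simp
  have sn: "sin \<theta> \<noteq> 0" using s by (simp add: s_def)
  have "norm (Y N - exp (real N * (h / j)) * Y 0) \<le> avg_err G B (\<Lambda> / (2 * s)) (\<Lambda> * (K\<^sup>2 / s)) N \<rho>"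
    by (rule averaging_uniform[OF _ _ N R0 YS _ B hj RS]) (use YD' cis_double_neq_1[OF sn] in \<open>auto simp: G_def add.commute\<close>)
  then show "norm (Y N - exp (lam / (2 * \<i> * s)) * c) \<le> avg_err G B (\<Lambda> / (2 * s)) (\<Lambda> * (K\<^sup>2 / s)) N \<rho>"
    using N by (simp add: h_def j_def Y_def X_def Z_def)
  have "norm (Y' N - exp (real N * (- h / j)) * Y' 0) \<le> avg_err G B (\<Lambda> / (2 * s)) (\<Lambda> * (K\<^sup>2 / s)) N \<rho>"
    by (rule averaging_uniform[OF _ _ N R0 YS' _ _ _ RS]) (use YD B hj cis_double_neq_1[OF sn] in \<open>auto simp: G_def add.commute\<close>)
  then show "norm (Y' N - exp (- (lam / (2 * \<i> * s))) * cnj c) \<le> avg_err G B (\<Lambda> / (2 * s)) (\<Lambda> * (K\<^sup>2 / s)) N \<rho>"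
    using N by (simp add: h_def j_def Y'_def X_def Z_def)
qed

section \<open>Asymptotics on the scale $1/L$\<close>

text \<open>Cauchy-Schwarz. The errors of \<open>coeffs_step\<close> are of first and second power
  in the deviations, while the probabilistic input controls only mean squares.\<close>

lemma Cesaro_root_bound:
  fixes t :: "nat \<Rightarrow> real"
  assumes "\<And>n. 0 \<le> t n" "0 < N"
  shows "(\<Sum>n<N. t n) / N \<le> sqrt ((\<Sum>n<N. (t n)\<^sup>2) / N)"
proof (rule real_le_rsqrt)
  have "(\<Sum>n<N. t n)\<^sup>2 \<le> (\<Sum>n<N. (t n)\<^sup>2) * card {..<N}" by (rule sum_squared_le_sum_of_squares)
  then show "((\<Sum>n<N. t n) / N)\<^sup>2 \<le> (\<Sum>n<N. (t n)\<^sup>2) / N"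
    using assms by (simp add: power_divide field_simps power2_eq_square)
qed

text \<open>The mean-square hypothesis feeds the averaging along \<open>{..<L k}\<close>. It says
  nothing about a single site, so convergence at \<open>L k\<close> itself is a separate hypothesis:
  the coefficients must finally be combined with \<open>p\<close> and \<open>q\<close> at
  \<open>Suc (L k)\<close>, whose deviations are governed by the amplitudes at
  \<open>L k\<close>.\<close>

theorem sol_asymptotics:
  fixes \<theta> E0 \<Lambda> :: real and v :: "nat \<Rightarrow> real" and L :: "nat \<Rightarrow> nat" and c d \<zeta> :: complex
  defines "p \<equiv> sol v E0 0 1" and "q \<equiv> sol v E0 1 0"
  assumes s: "0 < sin \<theta>" and E0: "E0 = 2 * cos \<theta>"
    and L: "filterlim L at_top sequentially" "\<And>k. 0 < L k"
    and Ces: "(\<lambda>k. (\<Sum>n<L k. (norm (amp \<theta> p n - c))\<^sup>2 + (norm (amp \<theta> q n - d))\<^sup>2) / L k) \<longlonglongrightarrow> 0"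
    and c: "(\<lambda>k. amp \<theta> p (L k)) \<longlonglongrightarrow> c" and d: "(\<lambda>k. amp \<theta> q (L k)) \<longlonglongrightarrow> d"
    and z: "(\<lambda>k. cis (real (Suc (L k)) * \<theta>)) \<longlonglongrightarrow> \<zeta>"
  shows "uniform_limit (cball (0::complex) \<Lambda>) (\<lambda>k lam. sol v (of_real E0 + lam / L k) 0 1 (Suc (L k)))
    (\<lambda>lam. (\<zeta> * (exp (lam / (2 * \<i> * sin \<theta>)) * c) - cnj \<zeta> * (exp (- (lam / (2 * \<i> * sin \<theta>))) * cnj c)) / (2 * \<i> * sin \<theta>)) sequentially"
proof -
  define s where "s = sin \<theta>"
  define K where "K = max 1 (max (norm c) (norm d))"
  have K: "1 \<le> K" "norm c \<le> K" "norm d \<le> K" by (auto simp: K_def)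
  have s0: "0 < s" and sn: "s \<noteq> 0" using s by (auto simp: s_def)
  have cd: "Im (cnj c * d) = s"
    using amp_limit_Wronskian[OF c[unfolded p_def] d[unfolded q_def]] by (simp add: s_def)
  define r where "r n = \<bar>p (Suc n) - Im (cis (real (Suc n) * \<theta>) * c) / s\<bar> + \<bar>q (Suc n) - Im (cis (real (Suc n) * \<theta>) * d) / s\<bar>" for n
  define t where "t n = norm (amp \<theta> p n - c) + norm (amp \<theta> q n - d)" for n
  have diff: "\<bar>u (Suc n) - Im (cis (real (Suc n) * \<theta>) * b) / s\<bar> \<le> norm (amp \<theta> u n - b) / s" for u b n
  proof -
    have "u (Suc n) - Im (cis (real (Suc n) * \<theta>) * b) / s = Im (cis (real (Suc n) * \<theta>) * (amp \<theta> u n - b)) / s"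
      using Im_amp_Suc[of n \<theta> u] sn unfolding s_def[symmetric]
      by (simp only: right_diff_distrib minus_complex.sel diff_divide_distrib) (simp del: of_nat_Suc)
    also have "\<bar>\<dots>\<bar> \<le> norm (amp \<theta> u n - b) / s"
      using abs_Im_le_cmod[of "cis (real (Suc n) * \<theta>) * (amp \<theta> u n - b)"] s0
      by (simp only: norm_mult norm_cis abs_divide mult_1_left) (simp add: divide_right_mono)
    finally show ?thesis .
  qed
  have rt: "r n \<le> t n / s" for n
    using diff[of p n c] diff[of q n d] by (simp add: r_def t_def add_divide_distrib)
  have r0: "0 \<le> r n" and t0: "0 \<le> t n" for n by (auto simp: r_def t_def)
  define A where "A k = (\<Sum>n<L k. (norm (amp \<theta> p n - c))\<^sup>2 + (norm (amp \<theta> q n - d))\<^sup>2) / L k" for k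
  \<comment> \<open>\<open>\<rho> k\<close> dominates the mean of
    \<open>r n + (r n)\<^sup>2\<close>. Each \<open>r n\<close> is at most \<open>t n / s\<close>;
    the square root comes from Cauchy-Schwarz and the factors 2 from squaring a sum of two
    terms.\<close>
  define \<rho> where "\<rho> k = sqrt (2 * A k) / s + 2 * A k / s\<^sup>2" for k
  have A: "A \<longlonglongrightarrow> 0" using Ces unfolding A_def .
  have "\<rho> \<longlonglongrightarrow> sqrt (2 * 0) / s + 2 * 0 / s\<^sup>2" unfolding \<rho>_def using sn by (intro tendsto_intros A) auto
  then have rho: "\<rho> \<longlonglongrightarrow> 0" by simp
  have rS: "(\<Sum>n<L k. r n + (r n)\<^sup>2) \<le> L k * \<rho> k" for k
  proof -
    have t2: "(t n)\<^sup>2 \<le> 2 * ((norm (amp \<theta> p n - c))\<^sup>2 + (norm (amp \<theta> q n - d))\<^sup>2)" for n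
      unfolding t_def using sum_squares_bound[of "norm (amp \<theta> p n - c)" "norm (amp \<theta> q n - d)"]
      by (simp add: power2_sum)
    have "(\<Sum>n<L k. (t n)\<^sup>2) / L k \<le> (\<Sum>n<L k. 2 * ((norm (amp \<theta> p n - c))\<^sup>2 + (norm (amp \<theta> q n - d))\<^sup>2)) / L k"
      by (intro divide_right_mono sum_mono t2) simp
    also have "\<dots> = 2 * A k" unfolding A_def by (simp only: sum_distrib_left[symmetric] times_divide_eq_right)
    finally have T2: "(\<Sum>n<L k. (t n)\<^sup>2) / L k \<le> 2 * A k" .
    have T1: "(\<Sum>n<L k. t n) / L k \<le> sqrt (2 * A k)"
      using Cesaro_root_bound[OF t0 L(2)] real_sqrt_le_mono[OF T2] by (rule order_trans)
    have "(\<Sum>n<L k. r n + (r n)\<^sup>2) \<le> (\<Sum>n<L k. t n / s + (t n)\<^sup>2 / s\<^sup>2)"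
      using rt r0 power_mono[OF rt r0, of _ 2] by (intro sum_mono add_mono) (auto simp: power_divide)
    also have "\<dots> = L k * (((\<Sum>n<L k. t n) / L k) / s + ((\<Sum>n<L k. (t n)\<^sup>2) / L k) / s\<^sup>2)"
      using L(2)[of k] by (simp add: sum.distrib sum_divide_distrib[symmetric] field_simps)
    also have "\<dots> \<le> L k * \<rho> k"
      unfolding \<rho>_def using T1 T2 s0 by (intro mult_left_mono add_mono divide_right_mono) auto
    finally show ?thesis .
  qed
  define B where "B = 2 * K * exp (\<Lambda> / s + 2 * \<Lambda> * (K\<^sup>2 / s))"
  define G where "G = max (2 / norm (1 - cis (2 * \<theta>))) (2 / norm (1 - cis (-2 * \<theta>)))"
  define \<epsilon> where "\<epsilon> k = avg_err G B (\<Lambda> / (2 * s)) (\<Lambda> * (K\<^sup>2 / s)) (L k) (\<rho> k)" for k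
  have eps: "\<epsilon> \<longlonglongrightarrow> 0" unfolding \<epsilon>_def by (rule avg_err_tendsto[OF L(1) rho])
  \<comment> \<open>Three sources of error: the deviation of \<open>p\<close> and \<open>q\<close>
    from their asymptotic form at the last site, where \<open>K * B / (2 * s)\<close> bounds the
    coefficients; the averaging error of \<open>Y\<close> and of \<open>Y'\<close>; and the distance
    of the phase at \<open>Suc (L k)\<close> from \<open>\<zeta>\<close>.\<close>
  define \<beta> where "\<beta> k = K * B / (2 * s) * (t (L k) / s) + (2 * \<epsilon> k + 2 * (norm (cis (real (Suc (L k)) * \<theta>) - \<zeta>) * (exp (\<Lambda> / (2 * s)) * K))) / (2 * s)" for k
  have "\<beta> \<longlonglongrightarrow> K * B / (2 * s) * ((norm (c - c) + norm (d - d)) / s) + (2 * 0 + 2 * (norm (\<zeta> - \<zeta>) * (exp (\<Lambda> / (2 * s)) * K))) / (2 * s)"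
    unfolding \<beta>_def t_def using sn by (intro tendsto_intros eps c d z) auto
  then have beta: "\<beta> \<longlonglongrightarrow> 0" by simp
  have "eventually (\<lambda>k. \<rho> k < 1) sequentially" using rho by (rule order_tendstoD) simp
  then have main: "eventually (\<lambda>k. \<forall>lam\<in>cball (0::complex) \<Lambda>. norm (sol v (of_real E0 + lam / L k) 0 1 (Suc (L k)) -
      (\<zeta> * (exp (lam / (2 * \<i> * sin \<theta>)) * c) - cnj \<zeta> * (exp (- (lam / (2 * \<i> * sin \<theta>))) * cnj c)) / (2 * \<i> * sin \<theta>)) \<le> \<beta> k) sequentially"
  proof eventually_elim
    case (elim k)
    show ?case
    proof
      fix lam :: complex assume "lam \<in> cball 0 \<Lambda>"
      then have lam: "norm lam \<le> \<Lambda>" by simp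
      define j where "j = 2 * \<i> * complex_of_real s"
      have nj: "norm j = 2 * s" and j0: "j \<noteq> 0" using s0 by (auto simp: j_def norm_mult)
      define N where "N = L k"
      define x y where "x = fst (coeffs p q (lam / N) N)" and "y = snd (coeffs p q (lam / N) N)"
      define Y Y' where "Y = c * x + d * y" and "Y' = cnj c * x + cnj d * y"
      have s': "0 < sin \<theta>" "Im (cnj c * d) = sin \<theta>" using s cd by (auto simp: s_def)
      note est = coeffs_asymptotics[where p = p and q = q and N = N and \<rho> = "\<rho> k", OF s' K L(2)[of k, folded N_def] lam
         rS[of k, folded N_def, unfolded r_def s_def] less_imp_le[OF elim], folded s_def, folded B_def G_def j_def x_def y_def, folded Y_def Y'_def]
      have e1: "norm (Y - exp (lam / j) * c) \<le> \<epsilon> k" and e2: "norm (Y' - exp (- (lam / j)) * cnj c) \<le> \<epsilon> k"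
        and S: "norm Y + norm Y' \<le> B"
        using est unfolding \<epsilon>_def N_def by simp_all
      define \<zeta>k where "\<zeta>k = cis (real (Suc N) * \<theta>)"
      have nz: "norm \<zeta>k = 1" "norm (cnj \<zeta>k) = 1" by (auto simp: \<zeta>k_def)
      define P' Q' where "P' = p (Suc N) - Im (\<zeta>k * c) / s" and "Q' = q (Suc N) - Im (\<zeta>k * d) / s"
      have im: "of_real (Im w / s) = (w - cnj w) / j" for w
        using sn by (simp add: j_def complex_diff_cnj)
      have Pc: "of_real (p (Suc N)) = (\<zeta>k * c - cnj \<zeta>k * cnj c) / j + of_real P'"
        and Qc: "of_real (q (Suc N)) = (\<zeta>k * d - cnj \<zeta>k * cnj d) / j + of_real Q'"
        unfolding P'_def Q'_def of_real_diff im by simp_all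
      have "sol v (of_real E0 + lam / N) 0 1 (Suc N) = x * of_real (p (Suc N)) + y * of_real (q (Suc N))"
        unfolding x_def y_def p_def q_def by (rule sol_variation_of_constants)
      also have "\<dots> = (\<zeta>k * Y - cnj \<zeta>k * Y') / j + (x * of_real P' + y * of_real Q')"
        unfolding Pc Qc Y_def Y'_def using j0 by (simp add: field_simps)
      finally have sol: "sol v (of_real E0 + lam / N) 0 1 (Suc N) = \<dots>" .
      define a1 a2 where "a1 = exp (lam / j) * c" and "a2 = exp (- (lam / j)) * cnj c"
      have eq: "sol v (of_real E0 + lam / N) 0 1 (Suc N) - (\<zeta> * a1 - cnj \<zeta> * a2) / j =
         (x * of_real P' + y * of_real Q') +
         (\<zeta>k * (Y - a1) - cnj \<zeta>k * (Y' - a2) + ((\<zeta>k - \<zeta>) * a1 - cnj (\<zeta>k - \<zeta>) * a2)) / j"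
        unfolding sol using j0 by (simp add: field_simps)
      have ex: "norm (exp (lam / j)) \<le> exp (\<Lambda> / (2 * s))" "norm (exp (- (lam / j))) \<le> exp (\<Lambda> / (2 * s))"
      proof -
        have "norm (lam / j) \<le> \<Lambda> / (2 * s)" using lam s0 by (simp add: norm_divide nj divide_right_mono)
        then show "norm (exp (lam / j)) \<le> exp (\<Lambda> / (2 * s))" "norm (exp (- (lam / j))) \<le> exp (\<Lambda> / (2 * s))"
          using norm_exp[of "lam / j"] norm_exp[of "- (lam / j)"] unfolding norm_minus_cancel
          by (meson exp_le_cancel_iff order_trans)+
      qed
      have a1: "norm a1 \<le> exp (\<Lambda> / (2 * s)) * K" and a2: "norm a2 \<le> exp (\<Lambda> / (2 * s)) * K"
        unfolding a1_def a2_def norm_mult complex_mod_cnj using ex K by (auto intro!: mult_mono)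
      have K0: "0 \<le> K" using K by simp
      have "norm x \<le> K * B / (2 * s)" "norm y \<le> K * B / (2 * s)"
        using coordinates_bound[OF sn cd K(2,3), where x = x and y = y]
          mult_left_mono[OF S K0] s0 unfolding Y_def[symmetric] Y'_def[symmetric]
        by (smt (verit, best) divide_right_mono)+
      moreover have "\<bar>P'\<bar> + \<bar>Q'\<bar> \<le> t N / s"
        using rt[of N] unfolding r_def P'_def Q'_def \<zeta>k_def .
      moreover have "norm (x * of_real P' + y * of_real Q') \<le> norm x * \<bar>P'\<bar> + norm y * \<bar>Q'\<bar>"
        using norm_triangle_ineq[of "x * of_real P'" "y * of_real Q'"] by (simp add: norm_mult)
      ultimately have n1: "norm (x * of_real P' + y * of_real Q') \<le> K * B / (2 * s) * (t N / s)"
      proof -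
        assume nx: "norm x \<le> K * B / (2 * s)" and ny: "norm y \<le> K * B / (2 * s)"
          and PQ: "\<bar>P'\<bar> + \<bar>Q'\<bar> \<le> t N / s"
          and le: "norm (x * of_real P' + y * of_real Q') \<le> norm x * \<bar>P'\<bar> + norm y * \<bar>Q'\<bar>"
        note le
        also have "norm x * \<bar>P'\<bar> + norm y * \<bar>Q'\<bar> \<le> K * B / (2 * s) * \<bar>P'\<bar> + K * B / (2 * s) * \<bar>Q'\<bar>"
          using nx ny by (intro add_mono mult_right_mono) auto
        also have "\<dots> = K * B / (2 * s) * (\<bar>P'\<bar> + \<bar>Q'\<bar>)" by (simp only: distrib_left)
        also have "\<dots> \<le> K * B / (2 * s) * (t N / s)"
          by (intro mult_left_mono PQ order_trans[OF norm_ge_zero nx])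
        finally show ?thesis .
      qed
      have "norm (\<zeta>k * (Y - a1) - cnj \<zeta>k * (Y' - a2) + ((\<zeta>k - \<zeta>) * a1 - cnj (\<zeta>k - \<zeta>) * a2))
        \<le> norm (Y - a1) + norm (Y' - a2) + (norm (\<zeta>k - \<zeta>) * norm a1 + norm (\<zeta>k - \<zeta>) * norm a2)"
        using norm_triangle_ineq[of "\<zeta>k * (Y - a1) - cnj \<zeta>k * (Y' - a2)" "(\<zeta>k - \<zeta>) * a1 - cnj (\<zeta>k - \<zeta>) * a2"]
          norm_triangle_ineq4[of "\<zeta>k * (Y - a1)" "cnj \<zeta>k * (Y' - a2)"]
          norm_triangle_ineq4[of "(\<zeta>k - \<zeta>) * a1" "cnj (\<zeta>k - \<zeta>) * a2"]
        unfolding norm_mult complex_mod_cnj nz by linarith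
      also have "\<dots> \<le> \<epsilon> k + \<epsilon> k + (norm (\<zeta>k - \<zeta>) * (exp (\<Lambda> / (2 * s)) * K) + norm (\<zeta>k - \<zeta>) * (exp (\<Lambda> / (2 * s)) * K))"
        using e1 e2 a1 a2 unfolding a1_def[symmetric] a2_def[symmetric] by (intro add_mono mult_left_mono) auto
      finally have n2: "norm ((\<zeta>k * (Y - a1) - cnj \<zeta>k * (Y' - a2) + ((\<zeta>k - \<zeta>) * a1 - cnj (\<zeta>k - \<zeta>) * a2)) / j)
        \<le> (2 * \<epsilon> k + 2 * (norm (\<zeta>k - \<zeta>) * (exp (\<Lambda> / (2 * s)) * K))) / (2 * s)"
        unfolding norm_divide nj using s0 by (intro divide_right_mono) (simp_all add: mult_ac)
      have "norm (sol v (of_real E0 + lam / N) 0 1 (Suc N) - (\<zeta> * a1 - cnj \<zeta> * a2) / j) \<le> \<beta> k"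
        unfolding eq \<beta>_def N_def[symmetric] \<zeta>k_def[symmetric] by (rule norm_triangle_le[OF add_mono[OF n1 n2]])
      then show "norm (sol v (of_real E0 + lam / L k) 0 1 (Suc (L k)) -
        (\<zeta> * (exp (lam / (2 * \<i> * sin \<theta>)) * c) - cnj \<zeta> * (exp (- (lam / (2 * \<i> * sin \<theta>))) * cnj c)) / (2 * \<i> * sin \<theta>)) \<le> \<beta> k"
        unfolding N_def a1_def a2_def j_def s_def by simp
    qed
  qed
  show ?thesis
  proof (rule uniform_limitI)
    fix e :: real assume "0 < e"
    then have "eventually (\<lambda>k. \<beta> k < e) sequentially" using beta by (intro order_tendstoD)
    with main show "\<forall>\<^sub>F k in sequentially. \<forall>lam\<in>cball (0::complex) \<Lambda>. dist (sol v (of_real E0 + lam / L k) 0 1 (Suc (L k)))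
      ((\<zeta> * (exp (lam / (2 * \<i> * sin \<theta>)) * c) - cnj \<zeta> * (exp (- (lam / (2 * \<i> * sin \<theta>))) * cnj c)) / (2 * \<i> * sin \<theta>)) < e"
      by eventually_elim (auto simp: dist_norm intro: le_less_trans)
  qed
qed

section \<open>Convergence of zeros\<close>

text \<open>The sign change of \<open>g k\<close> at the endpoints gives a zero, the positive
  derivative excludes a second one. The radius is left free below \<open>e0\<close> because the
  application needs both a fixed radius, to isolate the zeros, and arbitrarily small ones, to show
  that they converge.\<close>

lemma zero_persists_pos:
  fixes g g' :: "nat \<Rightarrow> real \<Rightarrow> real" and h h' :: "real \<Rightarrow> real"
  assumes g: "\<And>k x. (g k has_real_derivative g' k x) (at x)"
    and h: "\<And>x. (h has_real_derivative h' x) (at x)" "continuous_on UNIV h'"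
    and lim: "\<And>T. uniform_limit {-T..T} g h sequentially" "\<And>T. uniform_limit {-T..T} g' h' sequentially"
    and z: "h s = 0" "0 < h' s"
  shows "\<exists>e0>0. \<forall>e. 0 < e \<and> e \<le> e0 \<longrightarrow> (\<forall>\<^sub>F k in sequentially. \<exists>!x. x \<in> {s - e..s + e} \<and> g k x = 0)"
proof -
  have "isCont h' s" using h(2) by (simp add: continuous_on_eq_continuous_at)
  then have "\<forall>\<^sub>F x in nhds s. h' s / 2 < h' x"
    unfolding isCont_def tendsto_at_iff_tendsto_nhds by (rule order_tendstoD) (use z in simp)
  then obtain d where d: "0 < d" "\<And>x. dist x s < d \<Longrightarrow> h' s / 2 < h' x"
    unfolding eventually_nhds_metric by blast
  define e0 where "e0 = d / 2"
  have h'pos: "h' s / 2 < h' x" if "x \<in> {s - e0..s + e0}" for x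
    by (rule d(2)) (use that d(1) in \<open>auto simp: e0_def dist_real_def\<close>)
  show ?thesis
  proof (intro exI[of _ e0] conjI allI impI)
    show "0 < e0" using d by (simp add: e0_def)
    fix e assume e: "0 < e \<and> e \<le> e0"
    define T where "T = \<bar>s\<bar> + e0"
    have sub: "{s - e..s + e} \<subseteq> {-T..T}" using e by (auto simp: T_def)
    have hinc: "h x < h y" if "s - e \<le> x" "x < y" "y \<le> s + e" for x y
    proof (rule DERIV_pos_imp_increasing[OF that(2)])
      fix t assume "x \<le> t" "t \<le> y"
      then show "\<exists>D. (h has_real_derivative D) (at t) \<and> 0 < D"
        using h(1)[of t] h'pos[of t] z that e by (intro exI[of _ "h' t"]) auto
    qed
    have hs: "h (s - e) < 0" "0 < h (s + e)" using hinc[of "s - e" s] hinc[of s "s + e"] e z by auto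
    have "\<forall>\<^sub>F k in sequentially. \<forall>x\<in>{-T..T}. dist (g' k x) (h' x) < h' s / 2"
      using lim(2) z by (intro uniform_limitD) auto
    moreover have gl: "((\<lambda>k. g k x) \<longlongrightarrow> h x) sequentially" if "x \<in> {s - e..s + e}" for x
      using tendsto_uniform_limitI[OF lim(1)] sub that by blast
    have "\<forall>\<^sub>F k in sequentially. g k (s - e) < 0"
      by (rule order_tendstoD(2)[OF gl hs(1)]) (use e in auto)
    moreover have "\<forall>\<^sub>F k in sequentially. 0 < g k (s + e)"
      by (rule order_tendstoD(1)[OF gl hs(2)]) (use e in auto)
    ultimately show "\<forall>\<^sub>F k in sequentially. \<exists>!x. x \<in> {s - e..s + e} \<and> g k x = 0"
    proof eventually_elim
      case (elim k)
      have ex: "\<exists>x\<ge>s - e. x \<le> s + e \<and> g k x = 0"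
        using elim e by (intro IVT) (auto intro!: DERIV_isCont[OF g])
      have ginc: "g k x < g k y" if "s - e \<le> x" "x < y" "y \<le> s + e" for x y
      proof (rule DERIV_pos_imp_increasing[OF that(2)])
        fix t assume t: "x \<le> t" "t \<le> y"
        then have "t \<in> {s - e..s + e}" using that by auto
        then have "dist (g' k t) (h' t) < h' s / 2" "h' s / 2 < h' t"
          using elim(1) sub h'pos[of t] e by auto
        then show "\<exists>D. (g k has_real_derivative D) (at t) \<and> 0 < D"
          using g[of k t] by (intro exI[of _ "g' k t"]) (auto simp: dist_real_def abs_if split: if_splits)
      qed
      have "x = y" if "x \<in> {s - e..s + e} \<and> g k x = 0" "y \<in> {s - e..s + e} \<and> g k y = 0" for x y
        using that ginc[of x y] ginc[of y x] by (cases x y rule: linorder_cases) simp_all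
      moreover have "\<exists>x. x \<in> {s - e..s + e} \<and> g k x = 0" using ex by auto
      ultimately show ?case by (rule ex_ex1I[rotated])
    qed
  qed
qed

lemma zero_persists:
  fixes g g' :: "nat \<Rightarrow> real \<Rightarrow> real" and h h' :: "real \<Rightarrow> real"
  assumes g: "\<And>k x. (g k has_real_derivative g' k x) (at x)"
    and h: "\<And>x. (h has_real_derivative h' x) (at x)" "continuous_on UNIV h'"
    and lim: "\<And>T. uniform_limit {-T..T} g h sequentially" "\<And>T. uniform_limit {-T..T} g' h' sequentially"
    and z: "h s = 0" "h' s \<noteq> 0"
  shows "\<exists>e0>0. \<forall>e. 0 < e \<and> e \<le> e0 \<longrightarrow> (\<forall>\<^sub>F k in sequentially. \<exists>!x. x \<in> {s - e..s + e} \<and> g k x = 0)"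
proof (cases "0 < h' s")
  case True
  then show ?thesis using zero_persists_pos[OF g h lim z(1)] by blast
next
  case False
  then have "0 < - h' s" using z by simp
  then have "\<exists>e0>0. \<forall>e. 0 < e \<and> e \<le> e0 \<longrightarrow> (\<forall>\<^sub>F k in sequentially. \<exists>!x. x \<in> {s - e..s + e} \<and> - g k x = 0)"
    using z(1)
    by (intro zero_persists_pos[where g = "\<lambda>k x. - g k x" and g' = "\<lambda>k x. - g' k x" and h = "\<lambda>x. - h x" and h' = "\<lambda>x. - h' x"])
      (simp_all add: DERIV_minus[OF g] DERIV_minus[OF h(1)] continuous_on_minus[OF h(2)] uniform_limit_uminus[OF lim(1)] uniform_limit_uminus[OF lim(2)])
  then show ?thesis by simp
qed

text \<open>Every zero of \<open>h\<close> in [-T, T] attracts exactly one zero of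
  \<open>g k\<close>. Any other zero of \<open>g k\<close> in [-T, T] is excluded because, by
  compactness, \<open>h\<close> is bounded away from 0 off small intervals around its zeros. Zeros
  of \<open>g k\<close> beyond \<open>T\<close> may exist but do not count, as \<open>f\<close>
  vanishes there; in particular nothing is lost when a zero near the boundary leaves
  [-T, T].\<close>

lemma zeros_sum_tendsto:
  fixes g g' :: "nat \<Rightarrow> real \<Rightarrow> real" and h h' f :: "real \<Rightarrow> real"
  assumes g: "\<And>k x. (g k has_real_derivative g' k x) (at x)"
    and h: "\<And>x. (h has_real_derivative h' x) (at x)" "continuous_on UNIV h'"
    and lim: "\<And>T. uniform_limit {-T..T} g h sequentially" "\<And>T. uniform_limit {-T..T} g' h' sequentially"
    and simple: "\<And>x. h x = 0 \<Longrightarrow> h' x \<noteq> 0"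
    and fin: "\<And>k. finite {x. g k x = 0}" "finite {x. h x = 0 \<and> \<bar>x\<bar> \<le> T}"
    and f: "continuous_on UNIV f" "\<And>x. T < \<bar>x\<bar> \<Longrightarrow> f x = 0"
  shows "(\<lambda>k. \<Sum>x | g k x = 0. f x) \<longlonglongrightarrow> (\<Sum>x | h x = 0 \<and> \<bar>x\<bar> \<le> T. f x)"
proof -
  define Z where "Z = {x. h x = 0 \<and> \<bar>x\<bar> \<le> T}"
  have finZ: "finite Z" using fin by (simp add: Z_def)
  have "\<exists>e0>0. \<forall>e. 0 < e \<and> e \<le> e0 \<longrightarrow> (\<forall>\<^sub>F k in sequentially. \<exists>!x. x \<in> {s - e..s + e} \<and> g k x = 0)"
    if "s \<in> Z" for s
  proof (rule zero_persists[OF g h lim])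
    show "h s = 0" using that by (simp add: Z_def)
    then show "h' s \<noteq> 0" by (rule simple)
  qed
  then have "\<forall>s\<in>Z. \<exists>e0. e0>0 \<and> (\<forall>e. 0 < e \<and> e \<le> e0 \<longrightarrow> (\<forall>\<^sub>F k in sequentially. \<exists>!x. x \<in> {s - e..s + e} \<and> g k x = 0))"
    by (intro ballI) simp
  from bchoice[OF this] obtain e0 where
    E: "\<forall>s\<in>Z. e0 s>0 \<and> (\<forall>e. 0 < e \<and> e \<le> e0 s \<longrightarrow> (\<forall>\<^sub>F k in sequentially. \<exists>!x. x \<in> {s - e..s + e} \<and> g k x = 0))" ..
  then have e0: "\<And>s. s \<in> Z \<Longrightarrow> 0 < e0 s" by simp
  have uq: "\<forall>\<^sub>F k in sequentially. \<exists>!x. x \<in> {s - e..s + e} \<and> g k x = 0" if "s \<in> Z" "0 < e" "e \<le> e0 s" for s e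
    using E[rule_format, OF that(1), THEN conjunct2, rule_format] that(2,3) by simp
  have "\<forall>\<^sub>F e in at_right 0. \<forall>s\<in>Z. e < e0 s \<and> (\<forall>t\<in>Z. s \<noteq> t \<longrightarrow> 2 * e < \<bar>s - t\<bar>)"
  proof (intro eventually_ball_finite[OF finZ] ballI eventually_conj)
    fix s t assume st: "s \<in> Z" "t \<in> Z"
    show "\<forall>\<^sub>F e in at_right 0. e < e0 s"
      unfolding eventually_at_right_field by (rule exI[of _ "e0 s"]) (use e0[OF st(1)] in auto)
    show "\<forall>\<^sub>F e in at_right 0. s \<noteq> t \<longrightarrow> 2 * e < \<bar>s - t\<bar>"
      unfolding eventually_at_right_field by (rule exI[of _ "if s = t then 1 else \<bar>s - t\<bar> / 2"]) auto
  qed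
  then obtain b :: real where b: "0 < b"
    "\<And>y. 0 < y \<Longrightarrow> y < b \<Longrightarrow> \<forall>s\<in>Z. y < e0 s \<and> (\<forall>t\<in>Z. s \<noteq> t \<longrightarrow> 2 * y < \<bar>s - t\<bar>)"
    unfolding eventually_at_right_field by blast
  \<comment> \<open>One radius satisfies finitely many smallness conditions: it is below every
    \<open>e0 s\<close>, and twice it is below every gap, so that the closed intervals around
    distinct zeros are disjoint and \<open>x k\<close> is injective.\<close>
  define \<epsilon> where "\<epsilon> = b / 2"
  have eps: "0 < \<epsilon>" and eps0: "\<And>s. s \<in> Z \<Longrightarrow> \<epsilon> < e0 s"
    and sep: "\<And>s t. s \<in> Z \<Longrightarrow> t \<in> Z \<Longrightarrow> s \<noteq> t \<Longrightarrow> 2 * \<epsilon> < \<bar>s - t\<bar>"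
    using b(1) b(2)[of \<epsilon>] by (auto simp: \<epsilon>_def)
  define x where "x k s = (THE x. x \<in> {s - \<epsilon>..s + \<epsilon>} \<and> g k x = 0)" for k s
  have U: "\<forall>\<^sub>F k in sequentially. \<forall>s\<in>Z. \<exists>!x. x \<in> {s - \<epsilon>..s + \<epsilon>} \<and> g k x = 0"
    by (intro eventually_ball_finite[OF finZ] ballI uq eps less_imp_le[OF eps0])
  have xI: "x k s \<in> {s - \<epsilon>..s + \<epsilon>} \<and> g k (x k s) = 0" if "\<exists>!x. x \<in> {s - \<epsilon>..s + \<epsilon>} \<and> g k x = 0" for k s
    unfolding x_def by (rule theI'[OF that])
  have xlim: "(\<lambda>k. x k s) \<longlonglongrightarrow> s" if s: "s \<in> Z" for s
  proof (rule tendstoI)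
    fix e :: real assume e: "0 < e"
    \<comment> \<open>The zero found at the smaller radius \<open>e'\<close> also lies in the
      interval of radius \<open>\<epsilon>\<close>, where the zero is unique; so it is
      \<open>x k s\<close>.\<close>
    define e' where "e' = min (e / 2) \<epsilon>"
    have e': "0 < e'" "e' \<le> e0 s" "e' < e" "e' \<le> \<epsilon>" using e eps eps0[OF s] by (auto simp: e'_def)
    show "\<forall>\<^sub>F k in sequentially. dist (x k s) s < e"
      using uq[OF s e'(1,2)] U
    proof eventually_elim
      case (elim k)
      then obtain y where y: "y \<in> {s - e'..s + e'}" "g k y = 0" by blast
      have "y \<in> {s - \<epsilon>..s + \<epsilon>} \<and> g k y = 0" using y e' by auto
      then have "x k s = y"
        unfolding x_def by (rule the1_equality[OF elim(2)[rule_format, OF s]])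
      then show ?case using y e' by (auto simp: dist_real_def)
    qed
  qed
  have contf: "isCont f y" for y using f(1) by (simp add: continuous_on_eq_continuous_at)
  have lim1: "(\<lambda>k. \<Sum>s\<in>Z. f (x k s)) \<longlonglongrightarrow> (\<Sum>s\<in>Z. f s)"
    by (rule tendsto_sum, rule isCont_tendsto_compose[OF contf], rule xlim)
  \<comment> \<open>Removing open intervals keeps \<open>C\<close> compact, which is what provides
    the lower bound \<open>m\<close> below.\<close>
  define C where "C = {-T..T} - (\<Union>s\<in>Z. {s - \<epsilon><..<s + \<epsilon>})"
  have C: "compact C" unfolding C_def by (intro compact_diff) auto
  have conth: "continuous_on C h" using h(1) by (meson DERIV_isCont continuous_at_imp_continuous_on)
  have hC: "h y \<noteq> 0" if "y \<in> C" for y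
  proof
    assume "h y = 0"
    then have "y \<in> Z" using that by (auto simp: Z_def C_def)
    then show False using that eps by (auto simp: C_def)
  qed
  have "\<exists>m>0. \<forall>y\<in>C. m \<le> \<bar>h y\<bar>"
  proof (cases "C = {}")
    case True then show ?thesis by (intro exI[of _ 1]) auto
  next
    case False
    obtain y0 where "y0 \<in> C" "\<And>y. y \<in> C \<Longrightarrow> \<bar>h y0\<bar> \<le> \<bar>h y\<bar>"
      using continuous_attains_inf[OF C False continuous_on_rabs[OF conth]] by blast
    then show ?thesis using hC by (intro exI[of _ "\<bar>h y0\<bar>"]) auto
  qed
  then obtain m where m: "0 < m" "\<And>y. y \<in> C \<Longrightarrow> m \<le> \<bar>h y\<bar>" by blast
  have NZ: "\<forall>\<^sub>F k in sequentially. \<forall>y\<in>{-T..T}. dist (g k y) (h y) < m"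
    using lim(1) m by (intro uniform_limitD) auto
  have "\<forall>\<^sub>F k in sequentially. (\<Sum>s\<in>Z. f (x k s)) = (\<Sum>x | g k x = 0. f x)"
    using U NZ
  proof eventually_elim
    case (elim k)
    have inj: "inj_on (x k) Z"
    proof (rule inj_onI, rule ccontr)
      fix s t assume st: "s \<in> Z" "t \<in> Z" "x k s = x k t" "s \<noteq> t"
      have "x k s \<in> {s - \<epsilon>..s + \<epsilon>}" "x k t \<in> {t - \<epsilon>..t + \<epsilon>}"
        using xI[OF elim(1)[rule_format, OF st(1)]] xI[OF elim(1)[rule_format, OF st(2)]] by simp_all
      then show False using sep[OF st(1,2,4)] st(3) by (simp add: abs_if split: if_splits)
    qed
    have xk: "x k s \<in> {s - \<epsilon>..s + \<epsilon>} \<and> g k (x k s) = 0" if "s \<in> Z" for s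
      by (rule xI[OF elim(1)[rule_format, OF that]])
    have "(\<Sum>s\<in>Z. f (x k s)) = (\<Sum>y\<in>x k ` Z. f y)" by (simp add: sum.reindex[OF inj])
    also have "\<dots> = (\<Sum>x | g k x = 0. f x)"
    proof (rule sum.mono_neutral_left[OF fin(1)])
      show "x k ` Z \<subseteq> {x. g k x = 0}" using xk by auto
      show "\<forall>y\<in>{x. g k x = 0} - x k ` Z. f y = 0"
      proof (rule ballI, rule ccontr)
        fix y assume y: "y \<in> {x. g k x = 0} - x k ` Z" and "f y \<noteq> 0"
        then have "\<not> T < \<bar>y\<bar>" using f(2)[of y] by blast
        then have T: "y \<in> {-T..T}" by (auto simp: abs_le_iff not_less)
        have "dist (g k y) (h y) < m" using elim(2) T by blast
        then have "y \<notin> C" using m(2)[of y] y by (auto simp: dist_real_def)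
        then obtain s where s: "s \<in> Z" "y \<in> {s - \<epsilon><..<s + \<epsilon>}" using T by (auto simp: C_def)
        then have "y \<in> {s - \<epsilon>..s + \<epsilon>} \<and> g k y = 0" using y by auto
        then have "x k s = y"
          unfolding x_def by (rule the1_equality[OF elim(1)[rule_format, OF s(1)]])
        then show False using y s by auto
      qed
    qed
    finally show ?case .
  qed
  then show ?thesis unfolding Z_def[symmetric] using lim1 by (rule Lim_transform_eventually[rotated])
qed

text \<open>Cauchy's inequality on circles of radius 1 around the points of the smaller disc. The
  lost unit of radius does no harm, since the convergence is available on every disc; this is why
  the spectral parameter was taken complex.\<close>

lemma deriv_uniform_limit:
  fixes F :: "nat \<Rightarrow> complex \<Rightarrow> complex"
  assumes F: "\<And>k. F k holomorphic_on UNIV" and G: "G holomorphic_on UNIV"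
    and lim: "uniform_limit (cball 0 (T + 1)) F G sequentially"
  shows "uniform_limit (cball 0 T) (\<lambda>k. deriv (F k)) (deriv G) sequentially"
proof (rule uniform_limitI)
  fix e :: real assume e: "0 < e"
  have "\<forall>\<^sub>F k in sequentially. \<forall>x\<in>cball 0 (T + 1). dist (F k x) (G x) < e / 2"
    using lim e by (intro uniform_limitD) auto
  then show "\<forall>\<^sub>F k in sequentially. \<forall>x\<in>cball 0 T. dist (deriv (F k) x) (deriv G x) < e"
  proof eventually_elim
    case (elim k)
    show ?case
    proof
      fix x :: complex assume x: "x \<in> cball 0 T"
      let ?D = "\<lambda>y. F k y - G y"
      have D: "?D holomorphic_on UNIV" by (intro holomorphic_intros F G)
      have "norm ((deriv ^^ 1) ?D x) \<le> fact 1 * (e / 2) / 1 ^ 1"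
      proof (rule Cauchy_inequality)
        show "?D holomorphic_on ball x 1" "continuous_on (cball x 1) ?D"
          using D holomorphic_on_imp_continuous_on holomorphic_on_subset continuous_on_subset by blast+
        fix y assume y: "norm (x - y) = 1"
        then have "norm y \<le> T + 1" using x norm_triangle_ineq2[of y x] by (simp add: norm_minus_commute)
        then show "norm (?D y) \<le> e / 2" using elim by (simp add: dist_norm less_imp_le)
      qed simp
      moreover have "deriv ?D x = deriv (F k) x - deriv G x"
        using F G by (intro deriv_diff) (auto simp: holomorphic_on_def field_differentiable_def)
      ultimately show "dist (deriv (F k) x) (deriv G x) < e" using e by (simp add: dist_norm)
    qed
  qed
qed

lemma has_real_derivative_Re_of_real:
  assumes "F holomorphic_on UNIV"
  shows "((\<lambda>x. Re (F (of_real x))) has_real_derivative Re (deriv F (of_real x))) (at x)"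
proof -
  have "(F has_field_derivative deriv F (of_real x)) (at (of_real x))"
    using assms by (simp add: holomorphic_derivI)
  then have "((\<lambda>x. F (of_real x)) has_vector_derivative deriv F (of_real x)) (at x)"
    by (rule has_vector_derivative_real_field)
  then show ?thesis
    unfolding has_real_derivative_iff_has_vector_derivative
    by (rule bounded_linear.has_vector_derivative[OF bounded_linear_Re])
qed

section \<open>Eigenvalues of the restricted operator\<close>

lemma restricted_op_carrier: "restricted_op a w L \<in> carrier_mat L L"
  by (simp add: restricted_op_def)

lemma restricted_op_mult_vec:
  assumes x: "x \<in> carrier_vec L" and i: "i < L"
  shows "vec_index (restricted_op a w L *\<^sub>v x) i =
    a (i + 1) * w (i + 1) * vec_index x i + (if i + 1 < L then vec_index x (i + 1) else 0) + (if 0 < i then vec_index x (i - 1) else 0)"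
proof -
  have "vec_index (restricted_op a w L *\<^sub>v x) i =
      (\<Sum>j = 0..<L. (if i = j then a (i + 1) * w (i + 1) else if i = j + 1 \<or> j = i + 1 then 1 else 0) * vec_index x j)"
    unfolding restricted_op_eq using x i by (auto simp: scalar_prod_def intro!: sum.cong)
  also have "\<dots> = (\<Sum>j = 0..<L. (if j = i then a (i + 1) * w (i + 1) * vec_index x j else 0) +
      (if j = i + 1 then vec_index x j else 0) + (if j = i - 1 then if 0 < i then vec_index x j else 0 else 0))"
    by (intro sum.cong refl) (auto split: if_splits)
  also have "\<dots> = a (i + 1) * w (i + 1) * vec_index x i + (if i + 1 < L then vec_index x (i + 1) else 0) + (if 0 < i then vec_index x (i - 1) else 0)"
    unfolding sum.distrib using i by (simp add: sum.delta' less_imp_diff_less)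
  finally show ?thesis .
qed

text \<open>Padded by zeros at the sites 0 and \<open>L + 1\<close>, an eigenvector satisfies the
  full recursion, so it is determined by its first entry. That entry cannot vanish, hence the
  padding at \<open>L + 1\<close> forces \<open>u (Suc L) = 0\<close>.\<close>

lemma eigenvector_restricted_op:
  fixes e :: real
  assumes ev: "eigenvector (restricted_op a w L) x e"
  defines "u \<equiv> sol (\<lambda>n. a n * w n) e 0 1"
  shows "\<And>i. i < L \<Longrightarrow> vec_index x i = vec_index x 0 * u (Suc i)" and "u (Suc L) = 0"
proof -
  have x: "x \<in> carrier_vec L" and x0: "x \<noteq> 0\<^sub>v L" and Ax: "restricted_op a w L *\<^sub>v x = e \<cdot>\<^sub>v x"
    using ev by (auto simp: eigenvector_def restricted_op_def)
  define y where "y n = (if 1 \<le> n \<and> n \<le> L then vec_index x (n - 1) else 0)" for n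
  have rec: "y (Suc (Suc n)) = (e - a (Suc n) * w (Suc n)) * y (Suc n) - y n" if "n < L" for n
  proof -
    have "e * vec_index x n = vec_index (restricted_op a w L *\<^sub>v x) n" unfolding Ax using x that by simp
    then show ?thesis unfolding restricted_op_mult_vec[OF x that] using that
      by (cases n) (auto simp: y_def algebra_simps)
  qed
  have yu: "n \<le> L \<Longrightarrow> y n = y 1 * u n \<and> y (Suc n) = y 1 * u (Suc n)" for n
  proof (induction n)
    case 0 then show ?case by (simp add: u_def y_def)
  next
    case (Suc n)
    then have "y (Suc (Suc n)) = y 1 * u (Suc (Suc n))"
      using rec[of n] by (simp add: u_def algebra_simps)
    then show ?case using Suc by simp
  qed
  show *: "vec_index x i = vec_index x 0 * u (Suc i)" if "i < L" for i
    using yu[of i] that by (simp add: y_def)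
  have "vec_index x 0 \<noteq> 0"
  proof
    assume "vec_index x 0 = 0"
    then have "x = 0\<^sub>v L" using * x by (intro eq_vecI) auto
    then show False using x0 by simp
  qed
  moreover have "0 < L"
  proof (rule ccontr)
    assume "\<not> 0 < L"
    then have "x = 0\<^sub>v L" using x by (intro eq_vecI) auto
    then show False using x0 by simp
  qed
  ultimately show "u (Suc L) = 0" using yu[of L] by (simp add: y_def)
qed

lemma eigenvector_restricted_op_sol:
  fixes e :: real
  assumes L: "0 < L" and z: "sol (\<lambda>n. a n * w n) e 0 1 (Suc L) = 0"
  shows "eigenvector (restricted_op a w L) (Matrix.vec L (\<lambda>i. sol (\<lambda>n. a n * w n) e 0 1 (Suc i))) e"
proof -
  let ?u = "sol (\<lambda>n. a n * w n) e 0 1" and ?x = "Matrix.vec L (\<lambda>i. sol (\<lambda>n. a n * w n) e 0 1 (Suc i))"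
  have x: "?x \<in> carrier_vec L" by simp
  have "vec_index ?x 0 \<noteq> vec_index (0\<^sub>v L) 0" using L by simp
  then have "?x \<noteq> 0\<^sub>v L" by metis
  moreover have "restricted_op a w L *\<^sub>v ?x = e \<cdot>\<^sub>v ?x"
  proof (rule eq_vecI)
    fix i assume "i < dim_vec (e \<cdot>\<^sub>v ?x)"
    then have i: "i < L" by simp
    have s: "?u (Suc (Suc i)) = (e - a (Suc i) * w (Suc i)) * ?u (Suc i) - ?u i" by simp
    have 1: "(if i + 1 < L then vec_index ?x (i + 1) else 0) = ?u (Suc (Suc i))"
    proof (cases "i + 1 < L")
      case False
      then have "Suc L = Suc (Suc i)" using i by simp
      then show ?thesis using z False by metis
    qed simp
    have 2: "(if 0 < i then vec_index ?x (i - 1) else 0) = ?u i" using i by (cases i) auto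
    show "vec_index (restricted_op a w L *\<^sub>v ?x) i = vec_index (e \<cdot>\<^sub>v ?x) i"
      unfolding restricted_op_mult_vec[OF x i] 1 2 s using i by (simp add: algebra_simps)
  qed (simp add: restricted_op_def)
  ultimately show ?thesis using x by (simp add: eigenvector_def restricted_op_def)
qed

section \<open>Diagonalization, simplicity of the spectrum and linear statistics\<close>

lemma similar_mat_wit_diag_trace:
  fixes A :: "real mat"
  assumes A: "A \<in> carrier_mat n n" and wit: "similar_mat_wit A (mat_diag n d) P Q"
  shows "(\<Sum>i<n. A $$ (i, i)) = (\<Sum>i<n. d i)"
proof -
  note D = similar_mat_witD2[OF A wit]
  have "(\<Sum>i<n. A $$ (i, i)) = (\<Sum>i<n. (P * mat_diag n d * Q) $$ (i, i))" using D(3) by simp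
  also have "\<dots> = (\<Sum>i<n. \<Sum>j<n. P $$ (i, j) * d j * Q $$ (j, i))"
    unfolding mat_diag_mult_right[OF D(6)] using D
    by (simp add: atLeast0LessThan scalar_prod_def)
  also have "\<dots> = (\<Sum>j<n. d j * (\<Sum>i<n. Q $$ (j, i) * P $$ (i, j)))"
    by (subst sum.swap) (simp add: sum_distrib_left mult_ac)
  also have "\<dots> = (\<Sum>j<n. d j * (Q * P) $$ (j, j))"
    using D(6,7) by (intro sum.cong refl) (simp add: scalar_prod_def atLeast0LessThan)
  finally show ?thesis unfolding D(2) by simp
qed

lemma mat_diag_pow: "mat_diag n (d :: nat \<Rightarrow> real) ^\<^sub>m k = mat_diag n (\<lambda>i. d i ^ k)"
proof (induction k)
  case 0 then show ?case by (auto simp: mat_diag_def intro!: eq_matI)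
next
  case (Suc k) then show ?case by (simp add: mat_diag_diag mult.commute)
qed

lemma restricted_op_similar_diag:
  obtains d P Q where "similar_mat_wit (restricted_op a w L) (mat_diag L d) P Q"
proof -
  have "transpose_mat (restricted_op a w L) = restricted_op a w L"
    unfolding restricted_op_eq by (intro eq_matI) auto
  then show ?thesis
    using symmetric_diagonalizable[OF restricted_op_carrier] that unfolding similar_mat_def by blast
qed

text \<open>The sum is symmetric in the eigenvalues, so the sorted list may be replaced by the
  diagonal of any diagonalization.\<close>

lemma integral_eigval_process:
  fixes f :: "real \<Rightarrow> real"
  assumes f: "continuous_on UNIV f" and wit: "similar_mat_wit (restricted_op a w L) (mat_diag L d) P Q"
  shows "(\<integral>x. f x \<partial>eigval_process a E0 L w) = (\<Sum>i<L. f (real L * (d i - E0)))"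
proof -
  let ?H = "restricted_op a w L" and ?g = "\<lambda>x. real L * (x - E0)"
  have "similar_mat ?H (mat_diag L d)" using wit unfolding similar_mat_def by blast
  note ev = eigvals_list_diag[OF this]
  have len: "length (eigvals_list ?H) = L"
    using arg_cong[OF ev, of size] by simp
  have "f \<in> borel_measurable borel" using f by (intro borel_measurable_continuous_onI)
  then have "(\<integral>x. f x \<partial>eigval_process a E0 L w) = (\<Sum>i<L. f (?g (eigvals_list ?H ! i)))"
    unfolding eigval_process_def point_measure_of_def
    by (subst integral_distr) (auto simp: lebesgue_integral_count_space_finite)
  also have "\<dots> = (\<Sum>x\<leftarrow>eigvals_list ?H. f (?g x))"
    using len by (simp add: sum_list_sum_nth atLeast0LessThan)
  also have "\<dots> = (\<Sum>x\<in>#mset (eigvals_list ?H). f (?g x))"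
    by (simp flip: sum_mset_sum_list)
  also have "\<dots> = (\<Sum>i<L. f (?g (d i)))"
    unfolding ev by (simp add: image_mset.compositionality comp_def sum_unfold_sum_mset)
  finally show ?thesis .
qed

lemma similar_mat_wit_diag_eigenvector:
  fixes A :: "real mat"
  assumes A: "A \<in> carrier_mat n n" and wit: "similar_mat_wit A (mat_diag n d) P Q" and j: "j < n"
  shows "eigenvector A (col P j) (d j)"
proof -
  note D = similar_mat_witD2[OF A wit]
  have "A * P = (P * mat_diag n d) * (Q * P)"
    unfolding D(3) using D by (simp add: assoc_mult_mat[of _ n n _ n _ n] mult_carrier_mat[of _ n n _ n])
  then have AP: "A * P = P * mat_diag n d" using D by (simp add: right_mult_one_mat[of _ n n])
  have cj: "col P j \<in> carrier_vec n" using D j by auto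
  have "A *\<^sub>v col P j = col (A * P) j" by (rule col_mult2[OF A D(6) j, symmetric])
  also have "\<dots> = d j \<cdot>\<^sub>v col P j"
    unfolding AP mat_diag_mult_right[OF D(6)] using D j by (intro eq_vecI) auto
  finally have e: "A *\<^sub>v col P j = d j \<cdot>\<^sub>v col P j" .
  have "col P j \<noteq> 0\<^sub>v n"
  proof
    assume "col P j = 0\<^sub>v n"
    then have "(Q * P) $$ (j, j) = 0" using D(6,7) j by simp
    then show False unfolding D(2) using j by simp
  qed
  then show ?thesis using e cj A unfolding eigenvector_def by auto
qed

text \<open>The spectrum is simple because an eigenvector is determined by the eigenvalue up to a
  factor: two columns of \<open>P\<close> with the same eigenvalue would be proportional, against
  the invertibility of \<open>P\<close>.\<close>

lemma restricted_op_eigenvalues: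
  assumes L: "0 < L" and wit: "similar_mat_wit (restricted_op a w L) (mat_diag L d) P Q"
  shows "inj_on d {..<L}" and "d ` {..<L} = {e::real. sol (\<lambda>n. a n * w n) e 0 1 (Suc L) = 0}"
proof -
  let ?A = "restricted_op a w L"
  note A = restricted_op_carrier[of a w L]
  note D = similar_mat_witD2[OF A wit]
  note ev = similar_mat_wit_diag_eigenvector[OF A wit]
  show "inj_on d {..<L}"
  proof (rule inj_onI, rule ccontr)
    fix j k assume jk: "j \<in> {..<L}" "k \<in> {..<L}" "d j = d k" "j \<noteq> k"
    define u where "u = sol (\<lambda>n. a n * w n) (d j) 0 1"
    have P: "P $$ (i, m) = P $$ (0, m) * u (Suc i)" if "i < L" "m = j \<or> m = k" for i m
    proof -
      have "m < L" "d m = d j" using that jk by auto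
      then show ?thesis using eigenvector_restricted_op(1)[OF ev, of m i] that D(6) L by (simp add: u_def)
    qed
    define t where "t m = (\<Sum>i<L. Q $$ (m, i) * u (Suc i))" for m
    have QP: "(Q * P) $$ (l, m) = P $$ (0, m) * t l" if "l < L" "m = j \<or> m = k" for l m
    proof -
      have "m < L" using that jk by auto
      then have "(Q * P) $$ (l, m) = (\<Sum>i<L. Q $$ (l, i) * P $$ (i, m))"
        using that D(6,7) by (simp add: scalar_prod_def atLeast0LessThan)
      also have "\<dots> = (\<Sum>i<L. P $$ (0, m) * (Q $$ (l, i) * u (Suc i)))"
      proof (rule sum.cong)
        fix i assume "i \<in> {..<L}"
        then show "Q $$ (l, i) * P $$ (i, m) = P $$ (0, m) * (Q $$ (l, i) * u (Suc i))"
          using P[of i m] that(2) by (simp add: mult_ac)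
      qed simp
      finally show ?thesis by (simp add: t_def sum_distrib_left)
    qed
    \<comment> \<open>Entries of the identity \<open>Q * P\<close>: the middle equation makes one of
      the factors zero, but each of them also occurs in a product equal to 1.\<close>
    have "P $$ (0, j) * t j = 1" "P $$ (0, k) * t j = 0" "P $$ (0, k) * t k = 1"
      using QP[of j j] QP[of j k] QP[of k k] jk unfolding D(2) by auto
    then show False by auto
  qed
  show "d ` {..<L} = {e::real. sol (\<lambda>n. a n * w n) e 0 1 (Suc L) = 0}"
  proof (intro equalityI subsetI)
    fix e assume "e \<in> d ` {..<L}"
    then show "e \<in> {e::real. sol (\<lambda>n. a n * w n) e 0 1 (Suc L) = 0}"
      using eigenvector_restricted_op(2)[OF ev] by auto
  next
    fix e assume "e \<in> {e::real. sol (\<lambda>n. a n * w n) e 0 1 (Suc L) = 0}"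
    then have "eigenvector ?A (Matrix.vec L (\<lambda>i. sol (\<lambda>n. a n * w n) e 0 1 (Suc i))) e"
      using eigenvector_restricted_op_sol[OF L] by simp
    then have "eigenvalue ?A e" by (auto simp: eigenvalue_def)
    then have "poly (char_poly ?A) e = 0" using eigenvalue_root_char_poly[OF A] by simp
    moreover have "char_poly ?A \<noteq> 0" using degree_monic_char_poly[OF A] L by auto
    ultimately have "e \<in> set (eigvals_list ?A)" unfolding eigvals_list_def by simp
    moreover have "similar_mat ?A (mat_diag L d)" using wit unfolding similar_mat_def by blast
    then have "set (eigvals_list ?A) = d ` {..<L}" using arg_cong[OF eigvals_list_diag, of _ L d set_mset] by simp
    ultimately show "e \<in> d ` {..<L}" by simp
  qed
qed

text \<open>By simplicity of the spectrum, summing over the set of zeros loses no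
  multiplicities.\<close>

lemma integral_eigval_process_zeros:
  fixes f :: "real \<Rightarrow> real"
  assumes f: "continuous_on UNIV f" and L: "0 < L"
  shows "(\<integral>x. f x \<partial>eigval_process a E0 L w) =
    (\<Sum>x | sol (\<lambda>n. a n * w n) (E0 + x / real L) 0 1 (Suc L) = 0. f x)"
    and "finite {x. sol (\<lambda>n. a n * w n) (E0 + x / real L) 0 1 (Suc L) = 0}"
proof -
  obtain d P Q where wit: "similar_mat_wit (restricted_op a w L) (mat_diag L d) P Q"
    by (rule restricted_op_similar_diag)
  let ?g = "\<lambda>e. real L * (e - E0)" and ?Z = "{x. sol (\<lambda>n. a n * w n) (E0 + x / real L) 0 1 (Suc L) = 0}"
  note ev = restricted_op_eigenvalues[OF L wit]
  have Z: "?Z = (\<lambda>i. ?g (d i)) ` {..<L}"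
  proof (intro equalityI subsetI)
    fix x assume "x \<in> ?Z"
    then have "E0 + x / real L \<in> d ` {..<L}" unfolding ev(2) by simp
    then obtain i where i: "i < L" "E0 + x / real L = d i" by auto
    then have "x = ?g (d i)" using L by (simp add: field_simps)
    then show "x \<in> (\<lambda>i. ?g (d i)) ` {..<L}" using i by blast
  next
    fix x assume "x \<in> (\<lambda>i. ?g (d i)) ` {..<L}"
    then obtain i where i: "i < L" "x = ?g (d i)" by auto
    then have "E0 + x / real L = d i" using L by (simp add: field_simps)
    then show "x \<in> ?Z" using i ev(2) by auto
  qed
  have inj: "inj_on (\<lambda>i. ?g (d i)) {..<L}" using ev(1) L by (simp add: inj_on_def)
  show "(\<integral>x. f x \<partial>eigval_process a E0 L w) = (\<Sum>x | sol (\<lambda>n. a n * w n) (E0 + x / real L) 0 1 (Suc L) = 0. f x)"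
    unfolding integral_eigval_process[OF f wit] Z sum.reindex[OF inj] by simp
  show "finite ?Z" unfolding Z by simp
qed

text \<open>Measurability of the individual eigenvalues is bypassed. Power sums of eigenvalues are
  traces of matrix powers, hence polynomials in the matrix entries; polynomial approximation of
  \<open>h\<close> then exhibits the statistic as a pointwise limit of measurable functions.\<close>

lemma borel_measurable_integral_eigval_process:
  fixes X :: "nat \<Rightarrow> 'a \<Rightarrow> real" and f :: "real \<Rightarrow> real"
  assumes f: "continuous_on UNIV f" and X: "\<And>n. 1 \<le> n \<Longrightarrow> X n \<in> borel_measurable M"
  shows "(\<lambda>\<omega>. \<integral>x. f x \<partial>eigval_process a E0 L (\<lambda>n. X n \<omega>)) \<in> borel_measurable M"
proof -
  define h where "h x = f (real L * (x - E0))" for x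
  have h: "continuous_on S h" for S
    unfolding h_def by (intro continuous_on_compose2[OF f] continuous_intros) auto
  \<comment> \<open>The intervals grow while the error shrinks, so the approximation converges at
    every real point. No bound on the spectrum that is uniform in the random parameter is
    needed.\<close>
  have "\<exists>b. \<forall>n. real_polynomial_function (b n) \<and> (\<forall>x\<in>{-real n..real n}. \<bar>h x - b n x\<bar> < 1 / Suc n)"
  proof (rule choice, rule allI)
    fix n
    show "\<exists>g. real_polynomial_function g \<and> (\<forall>x\<in>{-real n..real n}. \<bar>h x - g x\<bar> < 1 / Suc n)"
    proof (rule Stone_Weierstrass_real_polynomial_function[OF compact_Icc h, of "1 / Suc n" "- real n" "real n"])
      fix g assume "real_polynomial_function g" "\<And>x. x \<in> {-real n..real n} \<Longrightarrow> \<bar>h x - g x\<bar> < 1 / real (Suc n)"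
      then show ?thesis by (intro exI[of _ g]) simp
    qed simp
  qed
  then obtain b where b: "\<And>n. real_polynomial_function (b n)"
    "\<And>n x. x \<in> {-real n..real n} \<Longrightarrow> \<bar>h x - b n x\<bar> < 1 / Suc n" by blast
  define H where "H \<omega> = restricted_op a (\<lambda>n. X n \<omega>) L" for \<omega>
  have H: "H \<omega> \<in> carrier_mat L L" for \<omega> unfolding H_def by (rule restricted_op_carrier)
  have "\<forall>\<omega>. \<exists>d P Q. similar_mat_wit (H \<omega>) (mat_diag L d) P Q"
  proof
    fix \<omega>
    obtain d P Q where "similar_mat_wit (H \<omega>) (mat_diag L d) P Q"
      unfolding H_def by (rule restricted_op_similar_diag)
    then show "\<exists>d P Q. similar_mat_wit (H \<omega>) (mat_diag L d) P Q" by (intro exI)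
  qed
  \<comment> \<open>These diagonalizations are picked pointwise, so \<open>d\<close> need not be
    measurable; only sums that are symmetric in its entries are used below.\<close>
  from choice[OF this] obtain d where "\<forall>\<omega>. \<exists>P Q. similar_mat_wit (H \<omega>) (mat_diag L (d \<omega>)) P Q" ..
  from choice[OF this] obtain P where "\<forall>\<omega>. \<exists>Q. similar_mat_wit (H \<omega>) (mat_diag L (d \<omega>)) (P \<omega>) Q" ..
  from choice[OF this] obtain Q where Q: "\<forall>\<omega>. similar_mat_wit (H \<omega>) (mat_diag L (d \<omega>)) (P \<omega>) (Q \<omega>)" ..
  note wit = Q[rule_format]
  have power: "(\<Sum>i<L. d \<omega> i ^ k) = (\<Sum>i<L. (H \<omega> ^\<^sub>m k) $$ (i, i))" for \<omega> k
    using similar_mat_wit_diag_trace[OF pow_carrier_mat[OF H] similar_mat_wit_pow[OF wit, unfolded mat_diag_pow]] by simp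
  have Hm: "(\<lambda>\<omega>. H \<omega> $$ (i, j)) \<in> borel_measurable M" if "i < L" "j < L" for i j
    unfolding H_def restricted_op_eq using that X[of "i + 1"] by (cases "i = j") simp_all
  have Hpow: "i < L \<Longrightarrow> j < L \<Longrightarrow> (\<lambda>\<omega>. (H \<omega> ^\<^sub>m k) $$ (i, j)) \<in> borel_measurable M" for i j k
  proof (induction k arbitrary: i j)
    case 0
    have "(H \<omega> ^\<^sub>m 0) $$ (i, j) = (if i = j then 1 else 0)" for \<omega> using 0 H[of \<omega>] by simp
    then show ?case by simp
  next
    case (Suc k)
    have "(H \<omega> ^\<^sub>m Suc k) $$ (i, j) = (\<Sum>l<L. (H \<omega> ^\<^sub>m k) $$ (i, l) * H \<omega> $$ (l, j))" for \<omega>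
      using Suc.prems H[of \<omega>] pow_carrier_mat[OF H[of \<omega>], where k = k] by (simp add: scalar_prod_def atLeast0LessThan)
    then show ?case
      by (simp only:) (intro borel_measurable_sum borel_measurable_times Suc Hm, auto intro: Suc.prems)
  qed
  have bm: "(\<lambda>\<omega>. \<Sum>i<L. b n (d \<omega> i)) \<in> borel_measurable M" for n
  proof -
    obtain c m where "b n = (\<lambda>x. \<Sum>k\<le>m. c k * x ^ k)"
      using b(1)[of n] unfolding real_polynomial_function_iff_sum by blast
    then have "(\<Sum>i<L. b n (d \<omega> i)) = (\<Sum>i<L. \<Sum>k\<le>m. c k * d \<omega> i ^ k)" for \<omega>
      by simp
    also have "(\<Sum>i<L. \<Sum>k\<le>m. c k * d \<omega> i ^ k) = (\<Sum>k\<le>m. c k * (\<Sum>i<L. (H \<omega> ^\<^sub>m k) $$ (i, i)))" for \<omega>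
      unfolding power[symmetric] sum_distrib_left by (rule sum.swap)
    finally have "(\<Sum>i<L. b n (d \<omega> i)) = (\<Sum>k\<le>m. c k * (\<Sum>i<L. (H \<omega> ^\<^sub>m k) $$ (i, i)))" for \<omega> .
    then show ?thesis
      by (simp only:) (intro borel_measurable_sum borel_measurable_times borel_measurable_const Hpow, auto)
  qed
  have "(\<lambda>n. \<Sum>i<L. b n (d \<omega> i)) \<longlonglongrightarrow> (\<Sum>i<L. h (d \<omega> i))" for \<omega>
  proof (rule tendsto_sum)
    fix i
    have "eventually (\<lambda>n. norm (b n (d \<omega> i) - h (d \<omega> i)) \<le> 1 / Suc n) sequentially"
      using eventually_ge_at_top[of "nat \<lceil>\<bar>d \<omega> i\<bar>\<rceil>"]
    proof eventually_elim
      case (elim n)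
      then have "d \<omega> i \<in> {-real n..real n}" by (auto simp: nat_le_iff ceiling_le_iff abs_le_iff)
      from b(2)[OF this] show ?case by (simp add: abs_minus_commute less_imp_le)
    qed
    then have "(\<lambda>n. b n (d \<omega> i) - h (d \<omega> i)) \<longlonglongrightarrow> 0"
      by (rule Lim_null_comparison) (use LIMSEQ_inverse_real_of_nat in \<open>simp add: inverse_eq_divide\<close>)
    then show "(\<lambda>n. b n (d \<omega> i)) \<longlonglongrightarrow> h (d \<omega> i)" by (rule LIM_zero_cancel)
  qed
  then have "(\<lambda>\<omega>. \<Sum>i<L. h (d \<omega> i)) \<in> borel_measurable M"
    by (rule borel_measurable_LIMSEQ_real) (rule bm)
  moreover have "(\<lambda>\<omega>. \<integral>x. f x \<partial>eigval_process a E0 L (\<lambda>n. X n \<omega>)) = (\<lambda>\<omega>. \<Sum>i<L. h (d \<omega> i))"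
  proof
    fix \<omega>
    have "similar_mat_wit (restricted_op a (\<lambda>n. X n \<omega>) L) (mat_diag L (d \<omega>)) (P \<omega>) (Q \<omega>)"
      using wit[of \<omega>] by (simp only: H_def)
    from integral_eigval_process[OF f this, of E0]
    show "(\<integral>x. f x \<partial>eigval_process a E0 L (\<lambda>n. X n \<omega>)) = (\<Sum>i<L. h (d \<omega> i))"
      by (simp only: h_def)
  qed
  ultimately show ?thesis by (rule ssubst[rotated])
qed

section \<open>Moment bounds for small random potentials\<close>

text \<open>Note the delay by one site: the value at \<open>Suc n\<close> depends on the potential
  only up to \<open>n\<close>. Therefore \<open>V (Suc n)\<close> is independent of the solution at
  \<open>Suc n\<close> and of the amplitude at \<open>n\<close>.\<close>

lemma sol_cong:
  assumes "\<And>i. 1 \<le> i \<Longrightarrow> i \<le> n \<Longrightarrow> v i = w i"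
  shows "m \<le> Suc n \<Longrightarrow> sol v E x y m = sol w E x y m"
proof (induction m rule: less_induct)
  case (less m)
  consider "m = 0" | "m = Suc 0" | k where "m = Suc (Suc k)" by (metis not0_implies_Suc)
  then show ?case
  proof cases
    case 3
    then show ?thesis using less assms[of "Suc k"] by simp
  qed simp_all
qed

text \<open>As \<open>2 * cos \<theta>\<close> equals
  \<open>cis \<theta> + cis (- \<theta>)\<close>, the free evolution drops out. The increment is
  \<open>v (Suc n)\<close> times a function of the past: a martingale increment when the potential
  is centred and independent.\<close>

lemma amp_sol_Suc:
  fixes E x y \<theta> :: real and v :: "nat \<Rightarrow> real"
  assumes E: "E = 2 * cos \<theta>"
  defines "u \<equiv> sol v E x y"
  shows "amp \<theta> u (Suc n) = amp \<theta> u n - of_real (v (Suc n) * u (Suc n)) * cis (- (real (Suc n) * \<theta>))"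
proof -
  have E': "complex_of_real E = cis \<theta> + cis (- \<theta>)" unfolding E by (simp add: complex_eq_iff)
  have s: "cis (- (real n * \<theta>)) = cis (- (real (Suc n) * \<theta>)) * cis \<theta>"
    by (simp add: cis_mult algebra_simps)
  have one: "cis \<theta> * cis (- \<theta>) = 1" by (simp add: cis_mult)
  have h1: "amp \<theta> u n = cis (- (real (Suc n) * \<theta>)) * (cis \<theta> * of_real (u (Suc n)) - (cis \<theta> * cis (- \<theta>)) * of_real (u n))"
    unfolding amp_def s by (simp add: algebra_simps)
  have h2: "complex_of_real (u (Suc (Suc n))) = (cis \<theta> + cis (- \<theta>) - of_real (v (Suc n))) * of_real (u (Suc n)) - of_real (u n)"
    unfolding E'[symmetric] by (simp add: u_def)
  show ?thesis unfolding h1 amp_def[of \<theta> u "Suc n"] h2 one by (simp add: algebra_simps)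
qed

lemma abs_sol_le_amp:
  assumes "0 < sin \<theta>"
  shows "\<bar>u (Suc n)\<bar> \<le> norm (amp \<theta> u n) / sin \<theta>"
proof -
  have "u (Suc n) = Im (cis (real (Suc n) * \<theta>) * amp \<theta> u n) / sin \<theta>"
    unfolding Im_amp_Suc using assms by simp
  moreover have "\<bar>Im (cis (real (Suc n) * \<theta>) * amp \<theta> u n)\<bar> \<le> norm (amp \<theta> u n)"
    using abs_Im_le_cmod[of "cis (real (Suc n) * \<theta>) * amp \<theta> u n"] by (simp only: norm_mult norm_cis mult_1_left)
  ultimately show ?thesis using assms by (simp add: divide_right_mono)
qed

lemma amp_cong:
  assumes "\<And>i. 1 \<le> i \<Longrightarrow> i \<le> n \<Longrightarrow> v i = w i"
  shows "amp \<theta> (sol v E x y) n = amp \<theta> (sol w E x y) n"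
  unfolding amp_def using sol_cong[of n v w "Suc n" E x y] sol_cong[of n v w n E x y] assms by simp

lemma sol_borel_measurable:
  fixes E :: real
  assumes "{1..n} \<subseteq> J"
  shows "m \<le> Suc n \<Longrightarrow> (\<lambda>v. sol v E x y m) \<in> borel_measurable (PiM J (\<lambda>_. borel))"
proof (induction m rule: less_induct)
  case (less m)
  consider "m = 0" | "m = Suc 0" | k where "m = Suc (Suc k)" by (metis not0_implies_Suc)
  then show ?case
  proof cases
    case 3
    have "Suc k \<in> J" using assms less.prems 3 by auto
    then have [measurable]: "(\<lambda>v. v (Suc k)) \<in> borel_measurable (PiM J (\<lambda>_. borel :: real measure))"
      by (rule measurable_component_singleton)
    have [measurable]: "(\<lambda>v. sol v E x y (Suc k)) \<in> borel_measurable (PiM J (\<lambda>_. borel))"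
      "(\<lambda>v. sol v E x y k) \<in> borel_measurable (PiM J (\<lambda>_. borel))"
      using less 3 by auto
    show ?thesis unfolding 3 sol.simps of_real_eq_id id_apply by measurable
  qed simp_all
qed

lemma amp_borel_measurable:
  assumes "{1..n} \<subseteq> J"
  shows "(\<lambda>v. amp \<theta> (sol v E x y) n) \<in> borel_measurable (PiM J (\<lambda>_. borel))"
proof -
  have [measurable]: "(\<lambda>v. sol v E x y (Suc n)) \<in> borel_measurable (PiM J (\<lambda>_. borel))"
    "(\<lambda>v. sol v E x y n) \<in> borel_measurable (PiM J (\<lambda>_. borel))"
    using sol_borel_measurable[OF assms] by auto
  show ?thesis unfolding amp_def by measurable
qed

text \<open>The setting of the truncated potential. The bounds \<open>b n\<close> are deterministic,
  so all integrability questions at a fixed site reduce to boundedness.\<close>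

locale small_potential = prob_space +
  fixes V :: "nat \<Rightarrow> 'a \<Rightarrow> real" and b :: "nat \<Rightarrow> real" and \<theta> E :: real
  assumes indep: "indep_vars (\<lambda>_. borel) V {1..}"
    and bound: "\<And>n \<omega>. 1 \<le> n \<Longrightarrow> \<bar>V n \<omega>\<bar> \<le> b n"
    and mean: "\<And>n. 1 \<le> n \<Longrightarrow> expectation (V n) = 0"
    and summable: "summable (\<lambda>n. (b n)\<^sup>2)"
    and sin: "0 < sin \<theta>" and E: "E = 2 * cos \<theta>"
begin

abbreviation "C x y n \<omega> \<equiv> amp \<theta> (sol (\<lambda>i. V i \<omega>) E x y) n"

lemma V_measurable: "1 \<le> n \<Longrightarrow> V n \<in> borel_measurable M"
  using indep unfolding indep_vars_def by auto

lemma b_nonneg: "1 \<le> n \<Longrightarrow> 0 \<le> b n"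
  using bound[of n] abs_ge_zero order_trans by blast

lemma restrict_measurable: "(\<lambda>\<omega>. \<lambda>i\<in>{1..n}. V i \<omega>) \<in> measurable M (PiM {1..n} (\<lambda>_. borel))"
  by (rule measurable_restrict) (simp add: V_measurable)

lemma C_restrict: "m \<le> n \<Longrightarrow> C x y m \<omega> = amp \<theta> (sol (\<lambda>i\<in>{1..n}. V i \<omega>) E x y) m"
  by (rule amp_cong) simp

lemma C_measurable: "C x y n \<in> borel_measurable M"
  unfolding C_restrict[OF order_refl]
  by (rule measurable_compose[OF restrict_measurable amp_borel_measurable]) simp

text \<open>The constant depends on \<open>n\<close> and serves integrability only; the bound that
  is uniform in \<open>n\<close> is \<open>second_moment_bounded\<close>.\<close>

lemma C_bounded: "\<exists>K. \<forall>\<omega>. norm (C x y n \<omega>) \<le> K"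
proof (induction n)
  case 0
  show ?case by (rule exI[of _ "norm (of_real y - cis (- \<theta>) * of_real x)"]) (simp add: amp_def)
next
  case (Suc n)
  then obtain K where K: "\<And>\<omega>. norm (C x y n \<omega>) \<le> K" by blast
  show ?case
  proof (intro exI allI)
    fix \<omega>
    let ?u = "sol (\<lambda>i. V i \<omega>) E x y (Suc n)"
    have "norm (C x y (Suc n) \<omega>) \<le> norm (C x y n \<omega>) + \<bar>V (Suc n) \<omega>\<bar> * \<bar>?u\<bar>"
      unfolding amp_sol_Suc[OF E]
      using norm_triangle_ineq4[of "C x y n \<omega>" "of_real (V (Suc n) \<omega> * ?u) * cis (- (real (Suc n) * \<theta>))"]
      by (simp only: norm_mult norm_cis norm_of_real abs_mult mult_1_right)
    also have "\<dots> \<le> K + b (Suc n) * (K / sin \<theta>)"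
      using order_trans[OF abs_sol_le_amp[OF sin, of "sol (\<lambda>i. V i \<omega>) E x y" n] divide_right_mono[OF K[of \<omega>]]]
        sin K[of \<omega>] b_nonneg[of "Suc n"] bound[of "Suc n" \<omega>]
      by (intro add_mono mult_mono) auto
    finally show "norm (C x y (Suc n) \<omega>) \<le> K + b (Suc n) * (K / sin \<theta>)" .
  qed
qed

lemma integrable_bounded:
  fixes f :: "'a \<Rightarrow> 'b::{banach, second_countable_topology}"
  shows "f \<in> borel_measurable M \<Longrightarrow> \<forall>\<omega>. norm (f \<omega>) \<le> K \<Longrightarrow> integrable M f"
  by (rule integrable_const_bound[where B = K]) auto

text \<open>The cross term vanishes because \<open>V (Suc n)\<close> is centred and independent of the past.\<close>

lemma second_moment_step:
  assumes G: "G \<in> borel_measurable (PiM {1..n} (\<lambda>_. borel))"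
    and Gb: "\<forall>\<omega>. norm (G (\<lambda>i\<in>{1..n}. V i \<omega>)) \<le> KG"
  shows "expectation (\<lambda>\<omega>. (norm (C x y (Suc n) \<omega> - G (\<lambda>i\<in>{1..n}. V i \<omega>)))\<^sup>2)
    \<le> expectation (\<lambda>\<omega>. (norm (C x y n \<omega> - G (\<lambda>i\<in>{1..n}. V i \<omega>)))\<^sup>2)
      + (b (Suc n) / sin \<theta>)\<^sup>2 * expectation (\<lambda>\<omega>. (norm (C x y n \<omega>))\<^sup>2)"
proof -
  define T where "T \<omega> = (\<lambda>i\<in>{1..n}. V i \<omega>)" for \<omega>
  define w where "w = cis (- (real (Suc n) * \<theta>))"
  \<comment> \<open>Apart from the factor -2, \<open>V (Suc n) \<omega> * g (T \<omega>)\<close> is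
    the cross term in the expansion of the square. Written with real and imaginary parts,
    \<open>g\<close> is a real measurable function of the past alone.\<close>
  define g where "g v = (Re (amp \<theta> (sol v E x y) n - G v) * Re w + Im (amp \<theta> (sol v E x y) n - G v) * Im w) * sol v E x y (Suc n)" for v
  have Tm: "T \<in> measurable M (PiM {1..n} (\<lambda>_. borel))" unfolding T_def by (rule restrict_measurable)
  have [measurable]: "(\<lambda>v. sol v E x y (Suc n)) \<in> borel_measurable (PiM {1..n} (\<lambda>_. borel))"
    "(\<lambda>v. amp \<theta> (sol v E x y) n) \<in> borel_measurable (PiM {1..n} (\<lambda>_. borel))"
    using sol_borel_measurable[of n "{1..n}"] amp_borel_measurable[of n "{1..n}"] by auto
  note G[measurable]
  have gm: "g \<in> borel_measurable (PiM {1..n} (\<lambda>_. borel))" unfolding g_def by measurable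
  have u: "sol (\<lambda>i. V i \<omega>) E x y (Suc n) = sol (T \<omega>) E x y (Suc n)" for \<omega>
    by (rule sol_cong[of n]) (simp_all add: T_def)
  have CT: "C x y n \<omega> = amp \<theta> (sol (T \<omega>) E x y) n" for \<omega>
    unfolding T_def by (rule C_restrict) simp
  define U where "U \<omega> = V (Suc n) \<omega> * sol (T \<omega>) E x y (Suc n)" for \<omega>
  obtain K where K: "\<And>\<omega>. norm (C x y n \<omega>) \<le> K" using C_bounded by blast
  have K0: "0 \<le> K" using K norm_ge_zero order_trans by blast
  have KG0: "0 \<le> KG" using Gb norm_ge_zero order_trans by blast
  have ub: "\<bar>sol (T \<omega>) E x y (Suc n)\<bar> \<le> norm (C x y n \<omega>) / sin \<theta>" for \<omega>
    using abs_sol_le_amp[OF sin, of "sol (\<lambda>i. V i \<omega>) E x y" n] unfolding u .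
  have ub': "\<bar>sol (T \<omega>) E x y (Suc n)\<bar> \<le> K / sin \<theta>" for \<omega>
    using ub[of \<omega>] divide_right_mono[OF K[of \<omega>], of "sin \<theta>"] sin by linarith
  have expand: "(norm (C x y (Suc n) \<omega> - G (T \<omega>)))\<^sup>2 =
      (norm (C x y n \<omega> - G (T \<omega>)))\<^sup>2 - 2 * (V (Suc n) \<omega> * g (T \<omega>)) + (U \<omega>)\<^sup>2" for \<omega>
  proof -
    define A where "A = C x y n \<omega> - G (T \<omega>)"
    have nw: "(Re w)\<^sup>2 + (Im w)\<^sup>2 = 1" by (simp add: w_def)
    have 1: "C x y (Suc n) \<omega> - G (T \<omega>) = A - of_real (U \<omega>) * w"
      unfolding amp_sol_Suc[OF E] u A_def U_def w_def by simp
    have 2: "V (Suc n) \<omega> * g (T \<omega>) = U \<omega> * Re (cnj A * w)"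
      unfolding g_def U_def A_def CT by (simp add: algebra_simps)
    have "(norm (A - of_real (U \<omega>) * w))\<^sup>2 = (norm A)\<^sup>2 - 2 * (U \<omega> * Re (cnj A * w)) + (U \<omega>)\<^sup>2 * ((Re w)\<^sup>2 + (Im w)\<^sup>2)"
      unfolding cmod_power2 by (simp add: algebra_simps power2_eq_square)
    then show ?thesis unfolding 1 2 nw A_def[symmetric] by simp
  qed
  have gTb: "\<bar>g (T \<omega>)\<bar> \<le> (K + KG) * (K / sin \<theta>)" for \<omega>
  proof -
    have "Re z * Re w + Im z * Im w = Re (cnj z * w)" for z by simp
    then have "\<bar>Re (C x y n \<omega> - G (T \<omega>)) * Re w + Im (C x y n \<omega> - G (T \<omega>)) * Im w\<bar> \<le> norm (C x y n \<omega> - G (T \<omega>))"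
      using abs_Re_le_cmod[of "cnj (C x y n \<omega> - G (T \<omega>)) * w"]
      by (simp only: norm_mult norm_cis complex_mod_cnj mult_1_right w_def)
    also have "\<dots> \<le> K + KG" using K[of \<omega>] Gb norm_triangle_ineq4[of "C x y n \<omega>" "G (T \<omega>)"]
      unfolding T_def by (meson add_mono order_trans)
    finally show ?thesis unfolding g_def abs_mult CT[symmetric]
      using ub'[of \<omega>] K0 KG0 by (intro mult_mono) auto
  qed
  have gTm: "(\<lambda>\<omega>. g (T \<omega>)) \<in> borel_measurable M" by (rule measurable_compose[OF Tm gm])
  have VSm: "V (Suc n) \<in> borel_measurable M" by (rule V_measurable) simp
  have gTi: "integrable M (\<lambda>\<omega>. g (T \<omega>))" by (rule integrable_bounded[OF gTm]) (use gTb in auto)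
  have Vi: "integrable M (V (Suc n))" by (rule integrable_bounded[OF VSm]) (use bound[of "Suc n"] in auto)
  have Um: "U \<in> borel_measurable M"
    unfolding U_def using VSm measurable_compose[OF Tm sol_borel_measurable[of n "{1..n}" "Suc n" E x y]] by measurable
  have Ub: "\<bar>U \<omega>\<bar> \<le> b (Suc n) * (norm (C x y n \<omega>) / sin \<theta>)" for \<omega>
    unfolding U_def abs_mult using bound[of "Suc n" \<omega>] ub[of \<omega>] b_nonneg[of "Suc n"] by (intro mult_mono) auto
  have indg: "indep_var borel (V (Suc n)) borel (\<lambda>\<omega>. g (T \<omega>))"
  proof -
    have "indep_var (PiM {Suc n} (\<lambda>_. borel)) (\<lambda>\<omega>. \<lambda>i\<in>{Suc n}. V i \<omega>) (PiM {1..n} (\<lambda>_. borel)) (\<lambda>\<omega>. \<lambda>i\<in>{1..n}. V i \<omega>)"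
      by (rule indep_var_restrict[OF indep]) auto
    then have "indep_var borel ((\<lambda>v. v (Suc n)) \<circ> (\<lambda>\<omega>. \<lambda>i\<in>{Suc n}. V i \<omega>)) borel (g \<circ> (\<lambda>\<omega>. \<lambda>i\<in>{1..n}. V i \<omega>))"
      by (rule indep_var_compose[OF _ _ gm]) (rule measurable_component_singleton, simp)
    then show ?thesis by (simp add: comp_def T_def)
  qed
  have "expectation (\<lambda>\<omega>. V (Suc n) \<omega> * g (T \<omega>)) = 0"
    using indep_var_lebesgue_integral[OF indg Vi gTi] mean[of "Suc n"] by simp
  moreover have Vgi: "integrable M (\<lambda>\<omega>. V (Suc n) \<omega> * g (T \<omega>))"
    by (rule indep_var_integrable[OF indg Vi gTi])
  moreover have CGi: "integrable M (\<lambda>\<omega>. (norm (C x y n \<omega> - G (T \<omega>)))\<^sup>2)"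
  proof (rule integrable_bounded)
    show "(\<lambda>\<omega>. (norm (C x y n \<omega> - G (T \<omega>)))\<^sup>2) \<in> borel_measurable M"
      using C_measurable measurable_compose[OF Tm G] by measurable
    have "norm (C x y n \<omega> - G (T \<omega>)) \<le> K + KG" for \<omega>
      using K[of \<omega>] Gb[rule_format, of \<omega>] norm_triangle_ineq4[of "C x y n \<omega>" "G (T \<omega>)"]
      unfolding T_def by linarith
    then show "\<forall>\<omega>. norm ((norm (C x y n \<omega> - G (T \<omega>)))\<^sup>2) \<le> (K + KG)\<^sup>2"
      by (simp add: power_mono)
  qed
  moreover have C2i: "integrable M (\<lambda>\<omega>. (norm (C x y n \<omega>))\<^sup>2)"
  proof (rule integrable_bounded)
    show "(\<lambda>\<omega>. (norm (C x y n \<omega>))\<^sup>2) \<in> borel_measurable M" using C_measurable by measurable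
    show "\<forall>\<omega>. norm ((norm (C x y n \<omega>))\<^sup>2) \<le> K\<^sup>2" using K by (auto intro!: power_mono)
  qed
  have U2le: "(U \<omega>)\<^sup>2 \<le> (b (Suc n) / sin \<theta>)\<^sup>2 * (norm (C x y n \<omega>))\<^sup>2" for \<omega>
  proof -
    have "(U \<omega>)\<^sup>2 \<le> (b (Suc n) * (norm (C x y n \<omega>) / sin \<theta>))\<^sup>2"
      using Ub[of \<omega>] by (metis abs_ge_zero power2_abs power_mono)
    then show ?thesis by (simp add: power_mult_distrib power_divide)
  qed
  have U2i: "integrable M (\<lambda>\<omega>. (U \<omega>)\<^sup>2)"
    by (rule Bochner_Integration.integrable_bound[OF integrable_mult_right[OF C2i, of "(b (Suc n) / sin \<theta>)\<^sup>2"]])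
      (use Um U2le in \<open>auto intro!: AE_I2\<close>)
  have U2e: "expectation (\<lambda>\<omega>. (U \<omega>)\<^sup>2) \<le> (b (Suc n) / sin \<theta>)\<^sup>2 * expectation (\<lambda>\<omega>. (norm (C x y n \<omega>))\<^sup>2)"
    using integral_mono[OF U2i integrable_mult_right[OF C2i] U2le] by simp
  show ?thesis unfolding T_def[symmetric] expand using U2e U2i Vgi CGi
    by (simp add: calculation(1))
qed

end

section \<open>Limits in mean square and along subsequences\<close>

lemma Cesaro_mean_tendsto_zero:
  fixes t :: "nat \<Rightarrow> real"
  assumes t: "t \<longlonglongrightarrow> 0"
  shows "(\<lambda>N. (\<Sum>n<N. t n) / N) \<longlonglongrightarrow> 0"
proof (rule LIMSEQ_I)
  fix e :: real assume e: "0 < e"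
  then obtain n0 where n0: "\<And>n. n \<ge> n0 \<Longrightarrow> \<bar>t n\<bar> < e / 2"
    using LIMSEQ_D[OF t, of "e / 2"] by auto
  define A where "A = (\<Sum>n<n0. \<bar>t n\<bar>)"
  obtain N1 :: nat where N1: "2 * A / e < N1" using reals_Archimedean2 by blast
  show "\<exists>no. \<forall>n\<ge>no. norm ((\<Sum>n<n. t n) / real n - 0) < e"
  proof (intro exI allI impI)
    fix N assume N: "N \<ge> max (Suc n0) N1"
    have "2 * A / e < real N" using N1 N by (smt (verit) max.bounded_iff of_nat_mono)
    then have A: "A < real N * (e / 2)" using e by (simp add: field_simps)
    have "(\<Sum>n<N. t n) = (\<Sum>n<n0. t n) + (\<Sum>n\<in>{n0..<N}. t n)"
      using N by (metis (no_types, lifting) atLeast0LessThan le_trans less_imp_le_nat lessI max.bounded_iff sum.atLeastLessThan_concat zero_le)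
    moreover have "\<bar>\<Sum>n<n0. t n\<bar> \<le> A" unfolding A_def by (rule sum_abs)
    moreover have "\<bar>\<Sum>n\<in>{n0..<N}. t n\<bar> \<le> (\<Sum>n\<in>{n0..<N}. e / 2)"
      using n0 by (intro order_trans[OF sum_abs] sum_mono) (auto intro: less_imp_le)
    moreover have "(\<Sum>n\<in>{n0..<N}. e / 2) \<le> real N * (e / 2)" using e by (simp add: mult_right_mono)
    ultimately have "\<bar>\<Sum>n<N. t n\<bar> < real N * e" using A by (simp add: field_simps)
    then show "norm ((\<Sum>n<N. t n) / real N - 0) < e" using N by (simp add: field_simps)
  qed
qed

text \<open>The limit is constructed in L^1, where a Cauchy sequence has an almost surely Cauchy
  subsequence. Fatou's lemma along that subsequence then returns the L^2 estimate for the whole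
  sequence, with the same \<tau>.\<close>

lemma (in prob_space) L2_limit:
  fixes Z :: "nat \<Rightarrow> 'a \<Rightarrow> complex"
  assumes Zm: "\<And>n. Z n \<in> borel_measurable M" and Zb: "\<And>n. \<exists>K. \<forall>\<omega>. norm (Z n \<omega>) \<le> K"
    and Z: "\<And>m n. m \<le> n \<Longrightarrow> expectation (\<lambda>\<omega>. (norm (Z n \<omega> - Z m \<omega>))\<^sup>2) \<le> \<tau> m"
    and \<tau>: "\<tau> \<longlonglongrightarrow> 0"
  obtains W where "W \<in> borel_measurable M" "\<And>n. integrable M (\<lambda>\<omega>. (norm (Z n \<omega> - W \<omega>))\<^sup>2)"
    "\<And>n. expectation (\<lambda>\<omega>. (norm (Z n \<omega> - W \<omega>))\<^sup>2) \<le> \<tau> n"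
proof -
  note [measurable] = Zm
  have Zi: "integrable M (Z n)" for n
  proof -
    obtain K where "\<And>\<omega>. norm (Z n \<omega>) \<le> K" using Zb by blast
    then show ?thesis by (intro integrable_const_bound[where B = K]) auto
  qed
  have D2i: "integrable M (\<lambda>\<omega>. (norm (Z n \<omega> - Z m \<omega>))\<^sup>2)" for m n
  proof -
    obtain K K' where K: "\<And>\<omega>. norm (Z n \<omega>) \<le> K" "\<And>\<omega>. norm (Z m \<omega>) \<le> K'" using Zb by meson
    have "norm (Z n \<omega> - Z m \<omega>) \<le> K + K'" for \<omega>
      using K(1)[of \<omega>] K(2)[of \<omega>] norm_triangle_ineq4[of "Z n \<omega>" "Z m \<omega>"] by linarith
    then show ?thesis by (intro integrable_const_bound[where B = "(K + K')\<^sup>2"]) (auto intro!: power_mono)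
  qed
  have \<tau>0: "0 \<le> \<tau> n" for n
    using Z[of n n] by simp
  have small: "\<exists>N. \<forall>i\<ge>N. \<forall>j\<ge>N. LINT \<omega>|M. norm (Z i \<omega> - Z j \<omega>) < e" if e: "e > 0" for e
  proof -
    have "eventually (\<lambda>n. \<tau> n < e\<^sup>2) sequentially" using \<tau> e by (intro order_tendstoD) auto
    then obtain N where N: "\<And>n. n \<ge> N \<Longrightarrow> \<tau> n < e\<^sup>2" unfolding eventually_sequentially by blast
    have *: "LINT \<omega>|M. norm (Z i \<omega> - Z j \<omega>) < e" if "N \<le> j" "j \<le> i" for i j
    proof -
      \<comment> \<open>A weighted arithmetic-geometric inequality in place of Cauchy-Schwarz: the
        weight is chosen so that a second moment below \<open>e\<^sup>2\<close> gives a first moment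
        below \<open>e\<close>.\<close>
      have le: "norm (Z i \<omega> - Z j \<omega>) \<le> e / 2 + (norm (Z i \<omega> - Z j \<omega>))\<^sup>2 / (2 * e)" for \<omega>
        using sum_squares_bound[of e "norm (Z i \<omega> - Z j \<omega>)"] e by (simp add: field_simps power2_eq_square)
      have "LINT \<omega>|M. norm (Z i \<omega> - Z j \<omega>) \<le> LINT \<omega>|M. e / 2 + (norm (Z i \<omega> - Z j \<omega>))\<^sup>2 / (2 * e)"
        using D2i Zi le by (intro integral_mono) auto
      also have "\<dots> = e / 2 + expectation (\<lambda>\<omega>. (norm (Z i \<omega> - Z j \<omega>))\<^sup>2) / (2 * e)"
        using D2i[of i j] by (simp add: prob_space)
      also have "\<dots> \<le> e / 2 + \<tau> j / (2 * e)" using Z[OF that(2)] e by (simp add: divide_right_mono)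
      also have "\<dots> < e" using N[OF that(1)] e by (simp add: field_simps power2_eq_square)
      finally show ?thesis .
    qed
    show ?thesis
    proof (intro exI allI impI)
      fix i j assume ij: "N \<le> i" "N \<le> j"
      show "LINT \<omega>|M. norm (Z i \<omega> - Z j \<omega>) < e"
      proof (cases "j \<le> i")
        case True
        then show ?thesis by (rule *[OF ij(2)])
      next
        case False
        then show ?thesis using *[OF ij(1), of j] by (subst norm_minus_commute) simp
      qed
    qed
  qed
  obtain r where r: "strict_mono r" "AE \<omega> in M. Cauchy (\<lambda>i. Z (r i) \<omega>)"
    using cauchy_L1_AE_cauchy_subseq[OF Zi small] by blast
  define W where "W \<omega> = lim (\<lambda>i. Z (r i) \<omega>)" for \<omega>
  have Wm[measurable]: "W \<in> borel_measurable M" unfolding W_def by measurable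
  have nn: "(\<integral>\<^sup>+\<omega>. ennreal ((norm (Z n \<omega> - W \<omega>))\<^sup>2) \<partial>M) \<le> ennreal (\<tau> n)" for n
  proof -
    have "AE \<omega> in M. ennreal ((norm (Z n \<omega> - W \<omega>))\<^sup>2) = liminf (\<lambda>i. ennreal ((norm (Z n \<omega> - Z (r i) \<omega>))\<^sup>2))"
      using r(2)
    proof eventually_elim
      case (elim \<omega>)
      then have "(\<lambda>i. Z (r i) \<omega>) \<longlonglongrightarrow> W \<omega>"
        unfolding W_def using Cauchy_convergent convergent_LIMSEQ_iff by blast
      then have "(\<lambda>i. ennreal ((norm (Z n \<omega> - Z (r i) \<omega>))\<^sup>2)) \<longlonglongrightarrow> ennreal ((norm (Z n \<omega> - W \<omega>))\<^sup>2)"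
        by (intro tendsto_intros)
      then show ?case using lim_imp_Liminf[OF sequentially_bot] by metis
    qed
    then have "(\<integral>\<^sup>+\<omega>. ennreal ((norm (Z n \<omega> - W \<omega>))\<^sup>2) \<partial>M) = (\<integral>\<^sup>+\<omega>. liminf (\<lambda>i. ennreal ((norm (Z n \<omega> - Z (r i) \<omega>))\<^sup>2)) \<partial>M)"
      by (rule nn_integral_cong_AE)
    also have "\<dots> \<le> liminf (\<lambda>i. \<integral>\<^sup>+\<omega>. ennreal ((norm (Z n \<omega> - Z (r i) \<omega>))\<^sup>2) \<partial>M)"
      by (rule nn_integral_liminf) measurable
    also have "\<dots> \<le> liminf (\<lambda>i. ennreal (\<tau> n))"
    proof (rule Liminf_mono)
      show "\<forall>\<^sub>F i in sequentially. (\<integral>\<^sup>+\<omega>. ennreal ((norm (Z n \<omega> - Z (r i) \<omega>))\<^sup>2) \<partial>M) \<le> ennreal (\<tau> n)"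
        using eventually_ge_at_top[of n]
      proof eventually_elim
        case (elim i)
        then have "n \<le> r i" using seq_suble[OF r(1), of i] by simp
        from Z[OF this] have "expectation (\<lambda>\<omega>. (norm (Z n \<omega> - Z (r i) \<omega>))\<^sup>2) \<le> \<tau> n" by (simp add: norm_minus_commute)
        then show ?case using nn_integral_eq_integral[OF D2i] by (simp add: ennreal_leI)
      qed
    qed
    also have "\<dots> = ennreal (\<tau> n)" by (simp add: Liminf_const)
    finally show ?thesis .
  qed
  show ?thesis
  proof (rule that[OF Wm])
    fix n
    show i: "integrable M (\<lambda>\<omega>. (norm (Z n \<omega> - W \<omega>))\<^sup>2)"
      by (rule integrableI_bounded) (use nn[of n] in \<open>auto intro: le_less_trans\<close>)
    show "expectation (\<lambda>\<omega>. (norm (Z n \<omega> - W \<omega>))\<^sup>2) \<le> \<tau> n"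
      using nn[of n] nn_integral_eq_integral[OF i] \<tau>0[of n] by simp
  qed
qed

text \<open>Exactly the two modes of convergence that \<open>sol_asymptotics\<close> consumes.
  Almost sure convergence along all sites would imply both, but these follow from L^2 convergence
  along a subsequence of lengths.\<close>

definition mean_square_limit :: "(nat \<Rightarrow> complex) \<Rightarrow> (nat \<Rightarrow> nat) \<Rightarrow> complex \<Rightarrow> bool" where
  "mean_square_limit z L c \<longleftrightarrow> (\<lambda>k. (\<Sum>n<L k. (norm (z n - c))\<^sup>2) / L k) \<longlonglongrightarrow> 0 \<and> (\<lambda>k. z (L k)) \<longlonglongrightarrow> c"

context small_potential begin

lemma summable_b_Suc: "summable (\<lambda>n. (b (Suc n))\<^sup>2 / c)"
  using summable summable_Suc_iff[of "\<lambda>n. (b n)\<^sup>2"] by (intro summable_divide) simp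

text \<open>With \<open>G = 0\<close> the moment step is a growth by the factor
  \<open>1 + \<beta> n\<close>, and the product of these factors converges because the squares of
  \<open>b\<close> are summable.\<close>

lemma second_moment_bounded: "\<exists>K\<ge>0. \<forall>n. expectation (\<lambda>\<omega>. (norm (C x y n \<omega>))\<^sup>2) \<le> K"
proof -
  define S where "S n = expectation (\<lambda>\<omega>. (norm (C x y n \<omega>))\<^sup>2)" for n
  define \<beta> where "\<beta> n = (b (Suc n) / sin \<theta>)\<^sup>2" for n
  have S0: "0 \<le> S n" for n unfolding S_def by (rule Bochner_Integration.integral_nonneg) simp
  have \<beta>s: "summable \<beta>"
    unfolding \<beta>_def power_divide by (rule summable_b_Suc)
  have \<beta>0: "0 \<le> \<beta> n" for n by (simp add: \<beta>_def)
  have step: "S (Suc n) \<le> (1 + \<beta> n) * S n" for n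
    using second_moment_step[of "\<lambda>_. 0" n 0 x y] by (simp add: S_def \<beta>_def algebra_simps)
  have "S n \<le> exp (suminf \<beta>) * S 0" for n
  proof -
    have "S n \<le> exp (\<Sum>k<n. \<beta> k) * S 0"
      by (rule discrete_Gronwall[where L = n]) (use step S0 in \<open>auto simp: \<beta>_def\<close>)
    also have "\<dots> \<le> exp (suminf \<beta>) * S 0"
      using S0[of 0] sum_le_suminf[OF \<beta>s, of "{..<n}"] \<beta>0 by (intro mult_right_mono) simp_all
    finally show ?thesis .
  qed
  then show ?thesis unfolding S_def[symmetric] using S0[of 0] by (intro exI[of _ "exp (suminf \<beta>) * S 0"]) auto
qed

text \<open>Here \<open>G\<close> is the amplitude at the earlier site \<open>m\<close>. The moment
  steps then add up, by orthogonality of the increments, to a tail of a convergent series.\<close>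

lemma second_moment_diff:
  "\<exists>\<tau>. \<tau> \<longlonglongrightarrow> 0 \<and> (\<forall>m n. m \<le> n \<longrightarrow> expectation (\<lambda>\<omega>. (norm (C x y n \<omega> - C x y m \<omega>))\<^sup>2) \<le> \<tau> m)"
proof -
  obtain K where K: "0 \<le> K" "\<And>n. expectation (\<lambda>\<omega>. (norm (C x y n \<omega>))\<^sup>2) \<le> K"
    using second_moment_bounded by blast
  define \<beta> where "\<beta> n = K * (b (Suc n) / sin \<theta>)\<^sup>2" for n
  have \<beta>s: "summable \<beta>"
    unfolding \<beta>_def power_divide by (intro summable_mult summable_b_Suc)
  have \<beta>0: "0 \<le> \<beta> n" for n using K by (simp add: \<beta>_def)
  have diff: "m \<le> n \<Longrightarrow> expectation (\<lambda>\<omega>. (norm (C x y n \<omega> - C x y m \<omega>))\<^sup>2) \<le> (\<Sum>k<n. \<beta> k) - (\<Sum>k<m. \<beta> k)" for m n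
  proof (induction n rule: dec_induct)
    case base show ?case by simp
  next
    case (step n)
    obtain B where B: "\<And>\<omega>. norm (C x y m \<omega>) \<le> B" using C_bounded by blast
    have G: "amp \<theta> (sol (\<lambda>i\<in>{1..n}. V i \<omega>) E x y) m = C x y m \<omega>" for \<omega>
      using C_restrict[OF step(1), where x = x and y = y and \<omega> = \<omega>] by simp
    have "expectation (\<lambda>\<omega>. (norm (C x y (Suc n) \<omega> - C x y m \<omega>))\<^sup>2) \<le> expectation (\<lambda>\<omega>. (norm (C x y n \<omega> - C x y m \<omega>))\<^sup>2)
      + (b (Suc n) / sin \<theta>)\<^sup>2 * expectation (\<lambda>\<omega>. (norm (C x y n \<omega>))\<^sup>2)"
      using second_moment_step[where G = "\<lambda>v. amp \<theta> (sol v E x y) m" and n = n and KG = B and x = x and y = y, OF amp_borel_measurable] step(1) B unfolding G by simp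
    also have "\<dots> \<le> ((\<Sum>k<n. \<beta> k) - (\<Sum>k<m. \<beta> k)) + \<beta> n"
      using step.IH mult_left_mono[OF K(2)[of n], of "(b (Suc n) / sin \<theta>)\<^sup>2"] unfolding \<beta>_def by (intro add_mono) (auto simp: mult.commute)
    finally show ?case by simp
  qed
  show ?thesis
  proof (intro exI[of _ "\<lambda>m. suminf \<beta> - (\<Sum>k<m. \<beta> k)"] conjI allI impI)
    have "(\<lambda>m. suminf \<beta> - (\<Sum>k<m. \<beta> k)) \<longlonglongrightarrow> suminf \<beta> - suminf \<beta>"
      by (intro tendsto_intros summable_LIMSEQ[OF \<beta>s])
    then show "(\<lambda>m. suminf \<beta> - (\<Sum>k<m. \<beta> k)) \<longlonglongrightarrow> 0" by simp
    fix m n :: nat assume "m \<le> n"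
    then show "expectation (\<lambda>\<omega>. (norm (C x y n \<omega> - C x y m \<omega>))\<^sup>2) \<le> suminf \<beta> - (\<Sum>k<m. \<beta> k)"
      using diff[of m n] sum_le_suminf[OF \<beta>s, of "{..<n}"] \<beta>0 by simp
  qed
qed

text \<open>Both modes of convergence are put into one nonnegative variable \<open>A k\<close> whose
  expectation tends to zero, so that a single subsequence serves both. Averaging over the sites
  preserves the L^2 rate in the sense of Cesaro means.\<close>

lemma AE_mean_square_limit:
  assumes L: "filterlim L at_top sequentially"
  obtains r where "strict_mono r" "AE \<omega> in M. \<exists>c. mean_square_limit (\<lambda>n. C x y n \<omega>) (L \<circ> r) c"
proof -
  obtain \<tau> where \<tau>: "\<tau> \<longlonglongrightarrow> 0" "\<And>m n. m \<le> n \<Longrightarrow> expectation (\<lambda>\<omega>. (norm (C x y n \<omega> - C x y m \<omega>))\<^sup>2) \<le> \<tau> m"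
    using second_moment_diff by blast
  obtain W where Wm: "W \<in> borel_measurable M" and Wi: "\<And>n. integrable M (\<lambda>\<omega>. (norm (C x y n \<omega> - W \<omega>))\<^sup>2)"
    and We: "\<And>n. expectation (\<lambda>\<omega>. (norm (C x y n \<omega> - W \<omega>))\<^sup>2) \<le> \<tau> n"
    using L2_limit[OF C_measurable C_bounded \<tau>(2,1)] by blast
  define A where "A k \<omega> = (\<Sum>n<L k. (norm (C x y n \<omega> - W \<omega>))\<^sup>2) / L k + (norm (C x y (L k) \<omega> - W \<omega>))\<^sup>2" for k \<omega>
  have A0: "0 \<le> (\<Sum>n<L k. (norm (C x y n \<omega> - W \<omega>))\<^sup>2) / L k" for k \<omega> by (intro divide_nonneg_nonneg sum_nonneg) auto
  have Ai: "integrable M (A k)" for k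
    unfolding A_def using Wi by (intro Bochner_Integration.integrable_add integrable_divide Bochner_Integration.integrable_sum) auto
  have EA: "expectation (A k) \<le> (\<Sum>n<L k. \<tau> n) / L k + \<tau> (L k)" for k
  proof -
    have "expectation (A k) = (\<Sum>n<L k. expectation (\<lambda>\<omega>. (norm (C x y n \<omega> - W \<omega>))\<^sup>2)) / L k + expectation (\<lambda>\<omega>. (norm (C x y (L k) \<omega> - W \<omega>))\<^sup>2)"
    proof -
      have "integrable M (\<lambda>\<omega>. (\<Sum>n<L k. (norm (C x y n \<omega> - W \<omega>))\<^sup>2) / L k)"
        using Wi by (intro integrable_divide Bochner_Integration.integrable_sum) auto
      from Bochner_Integration.integral_add[OF this Wi[of "L k"]]
      show ?thesis unfolding A_def using Bochner_Integration.integral_sum[of "{..<L k}" M "\<lambda>n \<omega>. (norm (C x y n \<omega> - W \<omega>))\<^sup>2"] Wi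
        by (simp only: integral_divide_zero) 
    qed
    also have "\<dots> \<le> (\<Sum>n<L k. \<tau> n) / L k + \<tau> (L k)"
      using We by (intro add_mono divide_right_mono sum_mono) auto
    finally show ?thesis .
  qed
  have "(\<lambda>k. (\<Sum>n<L k. \<tau> n) / L k + \<tau> (L k)) \<longlonglongrightarrow> 0 + 0"
    by (intro tendsto_add filterlim_compose[OF Cesaro_mean_tendsto_zero[OF \<tau>(1)] L] filterlim_compose[OF \<tau>(1) L])
  then have lim: "(\<lambda>k. (\<Sum>n<L k. \<tau> n) / L k + \<tau> (L k)) \<longlonglongrightarrow> 0" by simp
  have AA: "norm (A k \<omega>) = A k \<omega>" for k \<omega> by (simp add: A_def A0 abs_of_nonneg add_nonneg_nonneg)
  have "(\<lambda>k. expectation (\<lambda>\<omega>. norm (A k \<omega>))) \<longlonglongrightarrow> 0"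
  proof (rule tendsto_sandwich[OF _ _ tendsto_const lim])
    show "\<forall>\<^sub>F k in sequentially. 0 \<le> expectation (\<lambda>\<omega>. norm (A k \<omega>))"
      by (intro always_eventually allI Bochner_Integration.integral_nonneg) simp
    show "\<forall>\<^sub>F k in sequentially. expectation (\<lambda>\<omega>. norm (A k \<omega>)) \<le> (\<Sum>n<L k. \<tau> n) / L k + \<tau> (L k)"
      unfolding AA by (intro always_eventually allI EA)
  qed
  from tendsto_L1_AE_subseq[OF Ai this]
  obtain r where r: "strict_mono r" "AE \<omega> in M. (\<lambda>k. A (r k) \<omega>) \<longlonglongrightarrow> 0" by blast
  have "AE \<omega> in M. \<exists>c. mean_square_limit (\<lambda>n. C x y n \<omega>) (L \<circ> r) c"
    using r(2)
  proof eventually_elim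
    case (elim \<omega>)
    have "(\<lambda>k. (\<Sum>n<L (r k). (norm (C x y n \<omega> - W \<omega>))\<^sup>2) / L (r k)) \<longlonglongrightarrow> 0"
      by (rule tendsto_sandwich[OF _ _ tendsto_const elim]) (use A0 in \<open>auto simp: A_def\<close>)
    moreover have "(\<lambda>k. (norm (C x y (L (r k)) \<omega> - W \<omega>))\<^sup>2) \<longlonglongrightarrow> 0"
      by (rule tendsto_sandwich[OF _ _ tendsto_const elim]) (use A0 in \<open>auto simp: A_def\<close>)
    then have "(\<lambda>k. sqrt ((norm (C x y (L (r k)) \<omega> - W \<omega>))\<^sup>2)) \<longlonglongrightarrow> sqrt 0" by (intro tendsto_intros)
    then have "(\<lambda>k. C x y (L (r k)) \<omega>) \<longlonglongrightarrow> W \<omega>" by (simp add: tendsto_norm_zero_iff LIM_zero_iff)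
    ultimately show ?case unfolding mean_square_limit_def by (intro exI[of _ "W \<omega>"]) (simp add: comp_def)
  qed
  then show ?thesis using r(1) that by blast
qed

end

section \<open>Truncation\<close>

lemma mean_square_limit_subseq:
  assumes "mean_square_limit z L c" "strict_mono r"
  shows "mean_square_limit z (L \<circ> r) c"
  using LIMSEQ_subseq_LIMSEQ[OF conjunct1[OF assms(1)[unfolded mean_square_limit_def]] assms(2)]
    LIMSEQ_subseq_LIMSEQ[OF conjunct2[OF assms(1)[unfolded mean_square_limit_def]] assms(2)]
  unfolding mean_square_limit_def by (simp add: comp_def)

text \<open>The sites below \<open>N\<close>, where the linear relation may fail, contribute a fixed
  amount \<open>P\<close> that is divided by \<open>L k\<close>.\<close>

lemma mean_square_limit_linear:
  fixes A B :: real
  assumes z: "mean_square_limit z L c" and w: "mean_square_limit w L d" and L: "filterlim L at_top sequentially"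
    and y: "\<And>n. n \<ge> N \<Longrightarrow> y n = of_real A * z n + of_real B * w n"
  shows "mean_square_limit y L (of_real A * c + of_real B * d)"
proof -
  define e where "e = of_real A * c + of_real B * d"
  define P where "P = (\<Sum>n<N. (norm (y n - e))\<^sup>2)"
  have P0: "0 \<le> P" unfolding P_def by (intro sum_nonneg) simp
  have le: "(norm (y n - e))\<^sup>2 \<le> 2 * A\<^sup>2 * (norm (z n - c))\<^sup>2 + 2 * B\<^sup>2 * (norm (w n - d))\<^sup>2" if "n \<ge> N" for n
  proof -
    have "y n - e = of_real A * (z n - c) + of_real B * (w n - d)" unfolding y[OF that] e_def by (simp add: algebra_simps)
    then have "norm (y n - e) \<le> \<bar>A\<bar> * norm (z n - c) + \<bar>B\<bar> * norm (w n - d)"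
      using norm_triangle_ineq[of "of_real A * (z n - c)" "of_real B * (w n - d)"] by (simp add: norm_mult)
    then have "(norm (y n - e))\<^sup>2 \<le> (\<bar>A\<bar> * norm (z n - c) + \<bar>B\<bar> * norm (w n - d))\<^sup>2" by (rule power_mono) simp
    also have "\<dots> \<le> 2 * (\<bar>A\<bar> * norm (z n - c))\<^sup>2 + 2 * (\<bar>B\<bar> * norm (w n - d))\<^sup>2"
      using sum_squares_bound[of "\<bar>A\<bar> * norm (z n - c)" "\<bar>B\<bar> * norm (w n - d)"] by (simp add: power2_sum)
    finally show ?thesis by (simp add: power_mult_distrib)
  qed
  have sum_le: "(\<Sum>n<m. (norm (y n - e))\<^sup>2) \<le> P + 2 * A\<^sup>2 * (\<Sum>n<m. (norm (z n - c))\<^sup>2) + 2 * B\<^sup>2 * (\<Sum>n<m. (norm (w n - d))\<^sup>2)" for m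
  proof -
    have "(\<Sum>n<m. (norm (y n - e))\<^sup>2) \<le> (\<Sum>n<m. (if n < N then (norm (y n - e))\<^sup>2 else 0) + (2 * A\<^sup>2 * (norm (z n - c))\<^sup>2 + 2 * B\<^sup>2 * (norm (w n - d))\<^sup>2))"
      using le by (intro sum_mono) auto
    also have "\<dots> = (\<Sum>n<m. (if n < N then (norm (y n - e))\<^sup>2 else 0)) + 2 * A\<^sup>2 * (\<Sum>n<m. (norm (z n - c))\<^sup>2) + 2 * B\<^sup>2 * (\<Sum>n<m. (norm (w n - d))\<^sup>2)"
      by (simp add: sum.distrib sum_distrib_left)
    also have "(\<Sum>n<m. (if n < N then (norm (y n - e))\<^sup>2 else 0)) = (\<Sum>n\<in>{..<m} \<inter> {..<N}. (norm (y n - e))\<^sup>2)"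
      by (simp add: sum.inter_restrict)
    also have "\<dots> \<le> P" unfolding P_def by (intro sum_mono2) auto
    finally show ?thesis by simp
  qed
  have Linf: "(\<lambda>k. P / real (L k)) \<longlonglongrightarrow> 0"
    by (intro tendsto_divide_0[OF tendsto_const] filterlim_compose[OF filterlim_at_top_imp_at_infinity]
       filterlim_compose[OF filterlim_real_sequentially L] filterlim_at_top_imp_at_infinity)
  have "(\<lambda>k. P / real (L k) + 2 * A\<^sup>2 * ((\<Sum>n<L k. (norm (z n - c))\<^sup>2) / L k) + 2 * B\<^sup>2 * ((\<Sum>n<L k. (norm (w n - d))\<^sup>2) / L k))
     \<longlonglongrightarrow> 0 + 2 * A\<^sup>2 * 0 + 2 * B\<^sup>2 * 0"
    using z w Linf unfolding mean_square_limit_def by (intro tendsto_intros) auto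
  then have lim: "(\<lambda>k. P / real (L k) + 2 * A\<^sup>2 * ((\<Sum>n<L k. (norm (z n - c))\<^sup>2) / L k) + 2 * B\<^sup>2 * ((\<Sum>n<L k. (norm (w n - d))\<^sup>2) / L k)) \<longlonglongrightarrow> 0"
    by simp
  have "(\<lambda>k. (\<Sum>n<L k. (norm (y n - e))\<^sup>2) / L k) \<longlonglongrightarrow> 0"
  proof (rule tendsto_sandwich[OF _ _ tendsto_const lim]; intro always_eventually allI)
    fix k
    show "0 \<le> (\<Sum>n<L k. (norm (y n - e))\<^sup>2) / L k" by (intro divide_nonneg_nonneg sum_nonneg) auto
    show "(\<Sum>n<L k. (norm (y n - e))\<^sup>2) / L k \<le> P / real (L k) + 2 * A\<^sup>2 * ((\<Sum>n<L k. (norm (z n - c))\<^sup>2) / L k) + 2 * B\<^sup>2 * ((\<Sum>n<L k. (norm (w n - d))\<^sup>2) / L k)"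
      using divide_right_mono[OF sum_le[of "L k"], of "real (L k)"] by (simp add: add_divide_distrib)
  qed
  moreover have "(\<lambda>k. of_real A * z (L k) + of_real B * w (L k)) \<longlonglongrightarrow> e"
    unfolding e_def using z w unfolding mean_square_limit_def by (intro tendsto_intros) auto
  then have "(\<lambda>k. y (L k)) \<longlonglongrightarrow> e"
  proof (rule Lim_transform_eventually)
    have "\<forall>\<^sub>F k in sequentially. N \<le> L k" using L by (simp add: filterlim_at_top)
    then show "\<forall>\<^sub>F k in sequentially. of_real A * z (L k) + of_real B * w (L k) = y (L k)"
      by eventually_elim (simp add: y)
  qed
  ultimately show ?thesis unfolding mean_square_limit_def e_def by blast
qed

text \<open>Past \<open>N\<close> the two potentials define the same recursion, so only the values
  at \<open>N\<close> and \<open>Suc N\<close> have to be matched. Cramer's rule does this for any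
  data, the determinant being the Wronskian 1.\<close>

lemma sol_eventually_combination:
  fixes E x y :: real
  assumes vw: "\<And>n. n > N \<Longrightarrow> v n = w n"
  shows "\<exists>A B. \<forall>n\<ge>N. sol v E x y n = A * sol w E 0 1 n + B * sol w E 1 0 n"
proof -
  define u p q where "u = sol v E x y" and "p = sol w E 0 1" and "q = sol w E 1 0"
  define A where "A = u (Suc N) * q N - u N * q (Suc N)"
  define B where "B = u N * p (Suc N) - u (Suc N) * p N"
  have W: "p (Suc N) * q N - p N * q (Suc N) = 1" unfolding p_def q_def by (rule sol_Wronskian)
  have "u (N + k) = A * p (N + k) + B * q (N + k) \<and> u (Suc (N + k)) = A * p (Suc (N + k)) + B * q (Suc (N + k))" for k
  proof (induction k)
    case 0
    have "A * p N + B * q N = u N * (p (Suc N) * q N - p N * q (Suc N))"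
      "A * p (Suc N) + B * q (Suc N) = u (Suc N) * (p (Suc N) * q N - p N * q (Suc N))"
      by (simp_all add: A_def B_def algebra_simps)
    then show ?case unfolding W by simp
  next
    case (Suc k)
    have "v (Suc (N + k)) = w (Suc (N + k))" by (rule vw) simp
    then have "u (Suc (Suc (N + k))) = A * p (Suc (Suc (N + k))) + B * q (Suc (Suc (N + k)))"
      using Suc by (simp add: u_def p_def q_def algebra_simps)
    then show ?case using Suc by simp
  qed
  note * = this
  have "u n = A * p n + B * q n" if n: "n \<ge> N" for n using *[of "n - N"] n by simp
  then show ?thesis unfolding u_def p_def q_def by (intro exI[of _ A] exI[of _ B]) simp
qed

text \<open>The finitely many differing sites act like a change of initial values. Hence limits for
  both fundamental solutions of \<open>w\<close> are required, even for one solution of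
  \<open>v\<close>.\<close>

lemma mean_square_limit_sol_transfer:
  assumes vw: "\<And>n. n > N \<Longrightarrow> v n = w n" and L: "filterlim L at_top sequentially"
    and p: "mean_square_limit (amp \<theta> (sol w E 0 1)) L c" and q: "mean_square_limit (amp \<theta> (sol w E 1 0)) L d"
  shows "\<exists>e. mean_square_limit (amp \<theta> (sol v E x y)) L e"
proof -
  obtain A B :: real where AB: "\<And>n. n \<ge> N \<Longrightarrow> sol v E x y n = A * sol w E 0 1 n + B * sol w E 1 0 n"
    using sol_eventually_combination[of N v w E x y] vw by blast
  have "amp \<theta> (sol v E x y) n = of_real A * amp \<theta> (sol w E 0 1) n + of_real B * amp \<theta> (sol w E 1 0) n" if "n \<ge> N" for n
    unfolding amp_def using AB[OF that] AB[of "Suc n"] that by (simp add: algebra_simps)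
  from mean_square_limit_linear[OF p q L this] show ?thesis by blast
qed

lemma AE_mean_square_limit_sol:
  fixes \<alpha> \<delta> Cd \<theta> :: real and a :: "nat \<Rightarrow> real" and M :: "'a measure" and X :: "nat \<Rightarrow> 'a \<Rightarrow> real" and \<mu> :: "real measure" and L :: "nat \<Rightarrow> nat"
  assumes \<delta>: "\<delta> > 0" and \<alpha>\<delta>: "\<alpha> - 1 / \<delta> > 1 / 2"
    and a: "(\<lambda>n. a n * real n powr \<alpha>) \<longlonglongrightarrow> 1"
    and M: "prob_space M"
    and ind: "prob_space.indep_vars M (\<lambda>_. borel) X {1..}"
    and dist: "\<And>n. n \<ge> 1 \<Longrightarrow> distr M borel (X n) = \<mu>"
    and cent: "\<And>K. K > 0 \<Longrightarrow> (LINT x:{-K..K}|\<mu>. x) = 0"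
    and tail: "\<forall>\<^sub>F R in at_top. measure \<mu> (- {-R<..<R}) \<le> Cd / R powr \<delta>"
    and \<theta>: "0 < sin \<theta>" and L: "strict_mono L"
  defines "E \<equiv> 2 * cos \<theta>"
  obtains r where "strict_mono r" "AE \<omega> in M. \<forall>x y. \<exists>c. mean_square_limit (amp \<theta> (sol (\<lambda>n. a n * X n \<omega>) E x y)) (L \<circ> r) c"
proof -
  interpret prob_space M by (rule M)
  \<comment> \<open>The midpoint of the interval left open by the hypothesis. Being below
    \<open>\<alpha> - 1 / 2\<close>, the exponent makes the truncated potential square summable;
    being above \<open>1 / \<delta>\<close>, it makes the probabilities of exceeding the threshold
    summable.\<close>
  define \<gamma> where "\<gamma> = (1 / \<delta> + (\<alpha> - 1 / 2)) / 2"
  have \<gamma>: "1 / \<delta> < \<gamma>" "\<gamma> < \<alpha> - 1 / 2" using \<alpha>\<delta> by (auto simp: \<gamma>_def field_simps)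
  define cut where "cut n x = (if \<bar>x\<bar> \<le> real n powr \<gamma> then x else 0)" for n x
  define V where "V n \<omega> = a n * cut n (X n \<omega>)" for n \<omega>
  define b where "b n = \<bar>a n\<bar> * real n powr \<gamma>" for n
  have Xm: "X n \<in> borel_measurable M" if "n \<ge> 1" for n
    using ind that unfolding indep_vars_def by auto
  have cutm[measurable]: "cut n \<in> borel_measurable borel" for n unfolding cut_def by measurable
  interpret small_potential M V b \<theta> E
  proof
    show "indep_vars (\<lambda>_. borel) V {1..}"
      unfolding V_def by (rule indep_vars_compose2[OF ind]) measurable
    show "\<bar>V n \<omega>\<bar> \<le> b n" for n \<omega>
      unfolding V_def b_def abs_mult cut_def by (intro mult_left_mono) auto
    \<comment> \<open>The cut is symmetric and closed, so the mean is the integral over [-K, K] with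
      \<open>K = real n powr \<gamma>\<close>, covered by the hypothesis on \<mu> for each site
      separately.\<close>
    show "expectation (V n) = 0" if n: "1 \<le> n" for n
    proof -
      have K: "0 < real n powr \<gamma>" using n by simp
      have "expectation (V n) = a n * expectation (\<lambda>\<omega>. cut n (X n \<omega>))" unfolding V_def by simp
      also have "expectation (\<lambda>\<omega>. cut n (X n \<omega>)) = (\<integral>x. cut n x \<partial>distr M borel (X n))"
        by (rule integral_distr[symmetric]) (use Xm[OF n] in auto)
      also have "\<dots> = (LINT x:{- (real n powr \<gamma>)..real n powr \<gamma>}|\<mu>. x)"
        unfolding dist[OF n] set_lebesgue_integral_def
        by (intro Bochner_Integration.integral_cong) (auto simp: cut_def indicator_def abs_le_iff)
      also have "\<dots> = 0" by (rule cent[OF K])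
      finally show ?thesis by simp
    qed
    show "summable (\<lambda>n. (b n)\<^sup>2)"
    proof (rule summable_comparison_test_ev)
      have "\<forall>\<^sub>F n in sequentially. \<bar>a n * real n powr \<alpha> - 1\<bar> < 1"
        using tendstoD[OF a, of 1] by (simp add: dist_real_def)
      then show "\<forall>\<^sub>F n in sequentially. norm ((b n)\<^sup>2) \<le> 4 * real n powr (2 * (\<gamma> - \<alpha>))"
        using eventually_gt_at_top[of 0]
      proof eventually_elim
        case (elim n)
        have n: "0 < real n powr \<alpha>" "real n > 0" using elim by auto
        have "\<bar>a n * real n powr \<alpha>\<bar> \<le> 2" using elim(1) by linarith
        then have "\<bar>a n\<bar> * real n powr \<alpha> \<le> 2" by (simp add: abs_mult)
        then have "\<bar>a n\<bar> \<le> 2 * real n powr (- \<alpha>)" using n by (simp add: powr_minus field_simps)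
        then have "b n \<le> 2 * real n powr (- \<alpha>) * real n powr \<gamma>" unfolding b_def by (intro mult_right_mono) auto
        also have "\<dots> = 2 * real n powr (\<gamma> - \<alpha>)" by (simp add: powr_add[symmetric])
        finally have "(b n)\<^sup>2 \<le> (2 * real n powr (\<gamma> - \<alpha>))\<^sup>2" by (intro power_mono) (simp_all add: b_def)
        also have "\<dots> = 4 * real n powr (2 * (\<gamma> - \<alpha>))"
          using n by (simp add: power_mult_distrib power2_eq_square powr_add[symmetric])
        finally show ?case by simp
      qed
      show "summable (\<lambda>n. 4 * real n powr (2 * (\<gamma> - \<alpha>)))"
        using \<gamma> by (intro summable_mult) (simp add: summable_real_powr_iff)
    qed
    show "0 < sin \<theta>" by (rule \<theta>)
    show "E = 2 * cos \<theta>" by (simp only: E_def)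
  qed
  have Linf: "filterlim L at_top sequentially" by (rule filterlim_subseq[OF L])
  obtain r1 where r1: "strict_mono r1" "AE \<omega> in M. \<exists>c. mean_square_limit (\<lambda>n. C 0 1 n \<omega>) (L \<circ> r1) c"
    by (rule AE_mean_square_limit[OF Linf])
  have Linf1: "filterlim (L \<circ> r1) at_top sequentially" by (rule filterlim_subseq[OF strict_mono_o[OF L r1(1)]])
  obtain r2 where r2: "strict_mono r2" "AE \<omega> in M. \<exists>c. mean_square_limit (\<lambda>n. C 1 0 n \<omega>) (L \<circ> r1 \<circ> r2) c"
    by (rule AE_mean_square_limit[OF Linf1])
  \<comment> \<open>The event that truncation changes the variable at the site \<open>Suc n\<close>;
    the shift leaves out site 0, about which nothing is assumed.\<close>
  define A where "A n = {\<omega> \<in> space M. real (Suc n) powr \<gamma> < \<bar>X (Suc n) \<omega>\<bar>}" for n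
  have Am: "A n \<in> sets M" for n
    unfolding A_def using Xm[of "Suc n"] by measurable
  have \<gamma>0: "0 < \<gamma>" by (rule less_trans[OF _ \<gamma>(1)]) (use \<delta> in simp)
  have "AE \<omega> in M. \<forall>\<^sub>F n in sequentially. \<omega> \<in> space M - A n"
  proof (rule borel_cantelli_AE1[OF Am])
    show "emeasure M (A n) < \<infinity>" for n by (simp add: emeasure_eq_measure)
    have "summable (\<lambda>n. Cd * real n powr (- (\<gamma> * \<delta>)))"
    proof -
      have "1 < \<gamma> * \<delta>" using \<gamma>(1) \<delta> by (simp add: field_simps)
      then show ?thesis by (intro summable_mult) (simp add: summable_real_powr_iff)
    qed
    then have s: "summable (\<lambda>n. Cd * real (Suc n) powr (- (\<gamma> * \<delta>)))" by (subst summable_Suc_iff)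
    show "summable (\<lambda>n. measure M (A n))"
    proof (rule summable_comparison_test_ev[OF _ s])
      have "filterlim (\<lambda>n. real (Suc n) powr \<gamma>) at_top sequentially"
        using \<gamma>0 by real_asymp
      from eventually_compose_filterlim[OF tail this]
      show "\<forall>\<^sub>F n in sequentially. norm (measure M (A n)) \<le> Cd * real (Suc n) powr (- (\<gamma> * \<delta>))"
      proof eventually_elim
        case (elim n)
        let ?R = "real (Suc n) powr \<gamma>"
        have "measure M (A n) \<le> measure M (X (Suc n) -` (- {-?R<..<?R}) \<inter> space M)"
          using Xm[of "Suc n"] by (intro finite_measure_mono) (auto simp: A_def intro: measurable_sets)
        also have "\<dots> = measure (distr M borel (X (Suc n))) (- {-?R<..<?R})"
          using Xm[of "Suc n"] by (intro measure_distr[symmetric]) auto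
        also have "\<dots> \<le> Cd / ?R powr \<delta>" unfolding dist[of "Suc n", simplified] using elim by simp
        also have "\<dots> = Cd * real (Suc n) powr (- (\<gamma> * \<delta>))" by (simp add: powr_powr powr_minus field_simps)
        finally show ?case by simp
      qed
    qed
  qed
  \<comment> \<open>The exceptional null set does not depend on the initial values, because the two
    fundamental solutions of the truncated problem control all solutions. The random index from
    which truncation has no effect plays the part of \<open>N\<close> in the transfer.\<close>
  then have "AE \<omega> in M. \<forall>x y. \<exists>c. mean_square_limit (amp \<theta> (sol (\<lambda>n. a n * X n \<omega>) E x y)) (L \<circ> (r1 \<circ> r2)) c"
    using r1(2) r2(2) AE_space
  proof eventually_elim
    case (elim \<omega>)
    obtain N where N: "\<And>n. n \<ge> N \<Longrightarrow> \<omega> \<notin> A n" using elim(1) unfolding eventually_sequentially by auto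
    have vw: "a n * X n \<omega> = V n \<omega>" if "n > N" for n
    proof -
      have n: "Suc (n - 1) = n" "n - 1 \<ge> N" using that by auto
      have "\<not> real n powr \<gamma> < \<bar>X n \<omega>\<bar>" using N[OF n(2)] elim(4) unfolding A_def n(1) by simp
      then show ?thesis by (simp add: V_def cut_def)
    qed
    from elim(2) obtain c where c: "mean_square_limit (\<lambda>n. C 0 1 n \<omega>) (L \<circ> r1) c" ..
    from elim(3) obtain d where d: "mean_square_limit (\<lambda>n. C 1 0 n \<omega>) (L \<circ> r1 \<circ> r2) d" ..
    have "filterlim (L \<circ> r1 \<circ> r2) at_top sequentially" by (rule filterlim_subseq[OF strict_mono_o[OF strict_mono_o[OF L r1(1)] r2(1)]])
    from mean_square_limit_sol_transfer[where v = "\<lambda>n. a n * X n \<omega>" and w = "\<lambda>n. V n \<omega>", OF vw this mean_square_limit_subseq[OF c r2(1)] d]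
    show ?case by (simp add: comp_assoc)
  qed
  then show ?thesis
    using that[of "r1 \<circ> r2"] strict_mono_o[OF r1(1) r2(1)] by simp
qed

section \<open>Convergence to the clock process\<close>

lemma sol_holomorphic: "(\<lambda>E. sol v E x y n) holomorphic_on (S :: complex set)"
proof (induction n rule: less_induct)
  case (less n)
  consider "n = 0" | "n = Suc 0" | k where "n = Suc (Suc k)" by (metis not0_implies_Suc)
  then show ?case
  proof cases
    case 3
    then have "(\<lambda>E. sol v E x y (Suc k)) holomorphic_on S" "(\<lambda>E. sol v E x y k) holomorphic_on S"
      using less by auto
    then show ?thesis unfolding 3 sol.simps by (intro holomorphic_intros)
  qed auto
qed

lemma uniform_limit_Re_of_real:
  fixes F :: "nat \<Rightarrow> complex \<Rightarrow> complex"
  assumes "uniform_limit (cball 0 T) F G sequentially"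
  shows "uniform_limit {-T..T} (\<lambda>k x. Re (F k (of_real x))) (\<lambda>x. Re (G (of_real x))) sequentially"
proof (rule uniform_limitI)
  fix e :: real assume "0 < e"
  with assms have "\<forall>\<^sub>F k in sequentially. \<forall>x\<in>cball 0 T. dist (F k x) (G x) < e" by (rule uniform_limitD)
  then show "\<forall>\<^sub>F k in sequentially. \<forall>x\<in>{-T..T}. dist (Re (F k (of_real x))) (Re (G (of_real x))) < e"
  proof eventually_elim
    case (elim k)
    show ?case
    proof
      fix x assume "x \<in> {-T..T}"
      then have "complex_of_real x \<in> cball 0 T" by (auto simp: abs_le_iff)
      with elim have "dist (F k (of_real x)) (G (of_real x)) < e" by blast
      moreover have "dist (Re a) (Re b) \<le> dist a b" for a b :: complex
        using abs_Re_le_cmod[of "a - b"] by (simp add: dist_norm)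
      ultimately show "dist (Re (F k (of_real x))) (Re (G (of_real x))) < e" using le_less_trans by blast
    qed
  qed
qed

lemma finite_clock_points:
  assumes "0 < sin \<theta>"
  shows "finite {k::int. \<bar>- 2 * (real_of_int k * pi + \<phi>) * sin \<theta>\<bar> \<le> T}"
proof -
  define B where "B = T / (2 * sin \<theta>) + \<bar>\<phi>\<bar>"
  have "k \<in> {- \<lceil>B\<rceil>..\<lceil>B\<rceil>}" if "\<bar>- 2 * (real_of_int k * pi + \<phi>) * sin \<theta>\<bar> \<le> T" for k :: int
  proof -
    have "- 2 * (real_of_int k * pi + \<phi>) * sin \<theta> = - ((real_of_int k * pi + \<phi>) * (2 * sin \<theta>))" by (simp add: algebra_simps)
    then have "\<bar>real_of_int k * pi + \<phi>\<bar> * (2 * sin \<theta>) \<le> T"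
      using that assms by (simp add: abs_mult)
    then have "\<bar>real_of_int k * pi + \<phi>\<bar> \<le> T / (2 * sin \<theta>)" using assms by (simp add: field_simps)
    then have "\<bar>real_of_int k * pi\<bar> \<le> B" unfolding B_def by linarith
    moreover have "\<bar>real_of_int k\<bar> * 1 \<le> \<bar>real_of_int k\<bar> * pi" using pi_ge_two by (intro mult_left_mono) auto
    ultimately have "\<bar>real_of_int k\<bar> \<le> B" by (simp add: abs_mult)
    then have "real_of_int k \<le> B" "real_of_int (- k) \<le> B" by auto
    then have "k \<le> \<lceil>B\<rceil>" "- k \<le> \<lceil>B\<rceil>" using le_of_int_ceiling order_trans of_int_le_iff by metis+
    then show ?thesis by simp
  qed
  then show ?thesis by (intro finite_subset[OF _ finite_atLeastAtMost_int]) blast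
qed

lemma integral_clock_process:
  assumes s: "0 < sin \<theta>" and f: "continuous_on UNIV f" and T: "\<And>x. T < \<bar>x\<bar> \<Longrightarrow> f x = (0::real)"
    and J: "finite J" "\<And>k::int. \<bar>- 2 * (real_of_int k * pi + \<phi>) * sin \<theta>\<bar> \<le> T \<Longrightarrow> k \<in> J"
  shows "(\<integral>x. f x \<partial>clock_process \<theta> \<phi>) = (\<Sum>k\<in>J. f (- 2 * (real_of_int k * pi + \<phi>) * sin \<theta>))"
proof -
  let ?x = "\<lambda>k::int. - 2 * (real_of_int k * pi + \<phi>) * sin \<theta>"
  have "f \<in> borel_measurable borel" using f by (intro borel_measurable_continuous_onI)
  then have "(\<integral>x. f x \<partial>clock_process \<theta> \<phi>) = (\<integral>k. f (?x k) \<partial>count_space UNIV)"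
    unfolding clock_process_def point_measure_of_def by (intro integral_distr) auto
  also have sub: "{k. f (?x k) \<noteq> 0} \<subseteq> J" using T J(2) by (metis (mono_tags, lifting) linorder_not_le mem_Collect_eq subsetI)
  have "(\<integral>k. f (?x k) \<partial>count_space UNIV) = (\<Sum>k | k \<in> UNIV \<and> f (?x k) \<noteq> 0. f (?x k))"
    by (rule lebesgue_integral_count_space_finite_support) (use finite_subset[OF sub J(1)] in simp)
  also have "\<dots> = (\<Sum>k\<in>J. f (?x k))"
    using sub J(1) by (intro sum.mono_neutral_left) auto
  finally show ?thesis .
qed

lemma integral_eigval_process_tendsto:
  fixes \<theta> E0 T :: real and f :: "real \<Rightarrow> real" and L :: "nat \<Rightarrow> nat" and c d \<zeta> :: complex
  assumes s: "0 < sin \<theta>" and E0: "E0 = 2 * cos \<theta>" and L: "filterlim L at_top sequentially" "\<And>k. 0 < L k"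
    and p: "mean_square_limit (amp \<theta> (sol (\<lambda>n. a n * w n) E0 0 1)) L c"
    and q: "mean_square_limit (amp \<theta> (sol (\<lambda>n. a n * w n) E0 1 0)) L d"
    and z: "(\<lambda>k. cis (real (Suc (L k)) * \<theta>)) \<longlonglongrightarrow> \<zeta>"
    and f: "continuous_on UNIV f" "\<And>x. T < \<bar>x\<bar> \<Longrightarrow> f x = 0"
  shows "(\<lambda>k. \<integral>x. f x \<partial>eigval_process a E0 (L k) w) \<longlonglongrightarrow> (\<integral>x. f x \<partial>clock_process \<theta> (- Arg (\<zeta> * c)))"
proof -
  define v where "v = (\<lambda>n. a n * w n)"
  define F where "F k lam = sol v (of_real E0 + lam / of_nat (L k)) 0 1 (Suc (L k))" for k and lam :: complex
  define G where "G lam = (\<zeta> * (exp (lam / (2 * \<i> * sin \<theta>)) * c) - cnj \<zeta> * (exp (- (lam / (2 * \<i> * sin \<theta>))) * cnj c)) / (2 * \<i> * sin \<theta>)" for lam :: complex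
  have pc: "(\<lambda>k. amp \<theta> (sol v E0 0 1) (L k)) \<longlonglongrightarrow> c" and qd: "(\<lambda>k. amp \<theta> (sol v E0 1 0) (L k)) \<longlonglongrightarrow> d"
    using p q unfolding mean_square_limit_def v_def by auto
  \<comment> \<open>If \<open>c\<close> were zero the limit function would vanish identically; the
    second solution enters here through the Wronskian.\<close>
  have c0: "c \<noteq> 0" using amp_limit_Wronskian[OF pc qd] s by auto
  have z1: "norm \<zeta> = 1"
  proof -
    have "(\<lambda>k. norm (cis (real (Suc (L k)) * \<theta>))) \<longlonglongrightarrow> norm \<zeta>" by (intro tendsto_norm z)
    then show ?thesis unfolding norm_cis using LIMSEQ_unique tendsto_const by blast
  qed
  have "(\<lambda>k. (\<Sum>n<L k. (norm (amp \<theta> (sol v E0 0 1) n - c))\<^sup>2) / L k + (\<Sum>n<L k. (norm (amp \<theta> (sol v E0 1 0) n - d))\<^sup>2) / L k) \<longlonglongrightarrow> 0 + 0"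
    using p q unfolding mean_square_limit_def v_def by (intro tendsto_add) auto
  then have Ces: "(\<lambda>k. (\<Sum>n<L k. (norm (amp \<theta> (sol v E0 0 1) n - c))\<^sup>2 + (norm (amp \<theta> (sol v E0 1 0) n - d))\<^sup>2) / L k) \<longlonglongrightarrow> 0"
    by (simp add: sum.distrib add_divide_distrib)
  have lim: "uniform_limit (cball 0 \<Lambda>) F G sequentially" for \<Lambda>
    using sol_asymptotics[OF s E0 L Ces pc qd z, of \<Lambda>] unfolding F_def[abs_def] G_def[abs_def] by simp
  have Fhol: "F k holomorphic_on UNIV" for k
  proof -
    have "((\<lambda>E. sol v E 0 1 (Suc (L k))) \<circ> (\<lambda>lam. of_real E0 + lam / of_nat (L k))) holomorphic_on UNIV"
      by (rule holomorphic_on_compose_gen[OF _ sol_holomorphic[where S = UNIV]]) (use L(2)[of k] in \<open>auto intro!: holomorphic_intros\<close>)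
    then show ?thesis by (simp add: F_def[abs_def] comp_def)
  qed
  have Ghol: "G holomorphic_on UNIV" unfolding G_def[abs_def] using s by (intro holomorphic_intros) auto
  define A where "A = Arg (\<zeta> * c)"
  define h where "h x = norm c / sin \<theta> * sin (A - x / (2 * sin \<theta>))" for x
  define h' where "h' x = - (norm c / sin \<theta>) * (cos (A - x / (2 * sin \<theta>)) / (2 * sin \<theta>))" for x
  \<comment> \<open>On the real axis the two exponentials are conjugate phases, so \<open>G\<close>
    is the imaginary part of the rotated \<open>\<zeta> * c\<close>, divided by
    \<open>sin \<theta>\<close>. Its argument \<open>A\<close> becomes the phase of the
    sine.\<close>
  have Gh: "Re (G (of_real x)) = h x" for x
  proof -
    define W where "W = rcis (norm c) (A - x / (2 * sin \<theta>))"
    have zc: "\<zeta> * c = rcis (norm c) A"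
      unfolding A_def using rcis_cmod_Arg[of "\<zeta> * c"] z1 by (simp add: norm_mult)
    have e: "exp (of_real x / (2 * \<i> * sin \<theta>)) = cis (- (x / (2 * sin \<theta>)))"
      unfolding cis_conv_exp using s by (intro arg_cong[where f = exp]) (simp add: complex_eq_iff Re_divide Im_divide power2_eq_square field_simps)
    have e': "exp (- (of_real x / (2 * \<i> * sin \<theta>))) = cis (x / (2 * sin \<theta>))"
      unfolding exp_minus e by (simp add: cis_inverse)
    have "\<zeta> * (exp (of_real x / (2 * \<i> * sin \<theta>)) * c) = (\<zeta> * c) * cis (- (x / (2 * sin \<theta>)))"
      unfolding e by (simp add: mult_ac)
    also have "\<dots> = W" unfolding zc W_def rcis_def by (simp add: mult.assoc cis_mult)
    finally have 1: "\<zeta> * (exp (of_real x / (2 * \<i> * sin \<theta>)) * c) = W" .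
    have "cnj \<zeta> * (exp (- (of_real x / (2 * \<i> * sin \<theta>))) * cnj c) = cnj W"
      unfolding e' 1[symmetric] e by (simp add: cis_cnj)
    with 1 have "G (of_real x) = (W - cnj W) / (2 * \<i> * sin \<theta>)" unfolding G_def by simp
    also have "\<dots> = of_real (Im W / sin \<theta>)" using s by (simp add: complex_diff_cnj)
    finally show ?thesis by (simp add: W_def h_def)
  qed
  define g where "g k x = Re (F k (of_real x))" for k x
  have gsol: "g k x = sol v (E0 + x / real (L k)) 0 1 (Suc (L k))" for k x
  proof -
    have "F k (of_real x) = sol v (of_real (E0 + x / real (L k))) (of_real 0) (of_real 1) (Suc (L k))"
      unfolding F_def by simp
    then show ?thesis unfolding sol_of_real g_def by (simp del: sol.simps)
  qed
  have gd: "(g k has_real_derivative Re (deriv (F k) (of_real x))) (at x)" for k x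
    unfolding g_def[abs_def] by (rule has_real_derivative_Re_of_real[OF Fhol])
  have hd: "(h has_real_derivative h' x) (at x)" for x
    unfolding h_def[abs_def] h'_def using s by (auto intro!: derivative_eq_intros simp: mult.commute mult.left_commute)
  have "Re (deriv G (of_real x)) = h' x" for x
    using has_real_derivative_Re_of_real[OF Ghol, of x] hd[of x] unfolding Gh by (rule DERIV_unique)
  then have lim': "uniform_limit {-t..t} (\<lambda>k x. Re (deriv (F k) (of_real x))) h' sequentially" for t
    using uniform_limit_Re_of_real[OF deriv_uniform_limit[OF Fhol Ghol lim], of t] by simp
  have limg: "uniform_limit {-t..t} g h sequentially" for t
    using uniform_limit_Re_of_real[OF lim, of t] unfolding Gh g_def[abs_def] .
  have h'c: "continuous_on UNIV h'" unfolding h'_def[abs_def] using s by (intro continuous_intros) auto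
  have simple: "h' x \<noteq> 0" if "h x = 0" for x
  proof -
    have "sin (A - x / (2 * sin \<theta>)) = 0" using that s c0 by (simp add: h_def)
    then have "cos (A - x / (2 * sin \<theta>)) \<noteq> 0" using sin_cos_squared_add[of "A - x / (2 * sin \<theta>)"] by auto
    then show ?thesis using s c0 by (simp add: h'_def)
  qed
  \<comment> \<open>The solutions of \<open>A - x / (2 * sin \<theta>) = k * pi\<close>, written as
    the clock points for the shift \<open>- A\<close>.\<close>
  define pt where "pt k = - 2 * (real_of_int k * pi + - A) * sin \<theta>" for k :: int
  define J where "J = {k. \<bar>pt k\<bar> \<le> T}"
  have J: "finite J" unfolding J_def pt_def by (rule finite_clock_points[OF s])
  have h0: "h x = 0 \<longleftrightarrow> (\<exists>k. x = pt k)" for x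
  proof -
    have "h x = 0 \<longleftrightarrow> sin (A - x / (2 * sin \<theta>)) = 0" using s c0 by (simp add: h_def)
    also have "\<dots> \<longleftrightarrow> (\<exists>k::int. A - x / (2 * sin \<theta>) = of_int k * pi)" by (rule sin_zero_iff_int2)
    also have "\<dots> \<longleftrightarrow> (\<exists>k. x = pt k)"
      using s by (intro ex_cong1) (auto simp: pt_def field_simps)
    finally show ?thesis .
  qed
  have Z: "{x. h x = 0 \<and> \<bar>x\<bar> \<le> T} = pt ` J" unfolding h0 J_def by auto
  have inj: "inj_on pt J" using s by (auto simp: inj_on_def pt_def)
  have "(\<lambda>k. \<Sum>x | g k x = 0. f x) \<longlonglongrightarrow> (\<Sum>x | h x = 0 \<and> \<bar>x\<bar> \<le> T. f x)"
  proof (rule zeros_sum_tendsto[OF gd hd h'c limg lim' simple _ _ f])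
    show "finite {x. g k x = 0}" for k
      unfolding gsol v_def by (rule integral_eigval_process_zeros(2)[OF f(1) L(2)])
    show "finite {x. h x = 0 \<and> \<bar>x\<bar> \<le> T}" unfolding Z using J by simp
  qed
  moreover have "(\<Sum>x | g k x = 0. f x) = (\<integral>x. f x \<partial>eigval_process a E0 (L k) w)" for k
    unfolding gsol v_def by (rule integral_eigval_process_zeros(1)[OF f(1) L(2), symmetric])
  moreover have "(\<Sum>x | h x = 0 \<and> \<bar>x\<bar> \<le> T. f x) = (\<integral>x. f x \<partial>clock_process \<theta> (- Arg (\<zeta> * c)))"
  proof -
    have "(\<integral>x. f x \<partial>clock_process \<theta> (- A)) = (\<Sum>k\<in>J. f (- 2 * (real_of_int k * pi + - A) * sin \<theta>))"
    proof (rule integral_clock_process[OF s f J])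
      fix k :: int assume "\<bar>- 2 * (real_of_int k * pi + - A) * sin \<theta>\<bar> \<le> T"
      then show "k \<in> J" unfolding J_def pt_def by (rule CollectI)
    qed
    then show ?thesis unfolding Z sum.reindex[OF inj] A_def pt_def by simp
  qed
  ultimately show ?thesis by (simp only:)
qed

text \<open>For each outcome the finite sums over \<open>{- int n..int n}\<close> are eventually
  equal to the integral; the index from which they agree may depend on the outcome.\<close>

lemma borel_measurable_integral_clock_process:
  assumes s: "0 < sin \<theta>" and f: "continuous_on UNIV f" and T: "\<And>x. T < \<bar>x\<bar> \<Longrightarrow> f x = (0::real)"
    and \<phi>: "\<phi> \<in> borel_measurable M"
  shows "(\<lambda>\<omega>. \<integral>x. f x \<partial>clock_process \<theta> (\<phi> \<omega>)) \<in> borel_measurable M"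
proof (rule borel_measurable_LIMSEQ_real)
  let ?S = "\<lambda>n \<omega>. \<Sum>k\<in>{- int n..int n}. f (- 2 * (real_of_int k * pi + \<phi> \<omega>) * sin \<theta>)"
  have [measurable]: "f \<in> borel_measurable borel" using f by (intro borel_measurable_continuous_onI)
  note \<phi>[measurable]
  show "?S n \<in> borel_measurable M" for n by measurable
  fix \<omega>
  let ?J = "{k::int. \<bar>- 2 * (real_of_int k * pi + \<phi> \<omega>) * sin \<theta>\<bar> \<le> T}"
  have "bdd_above (abs ` ?J)" using finite_clock_points[OF s] by (intro bdd_above_finite) simp
  then obtain B where B: "\<And>k. k \<in> ?J \<Longrightarrow> \<bar>k\<bar> \<le> B" unfolding bdd_above_def by auto
  have "\<forall>\<^sub>F n in sequentially. ?S n \<omega> = (\<integral>x. f x \<partial>clock_process \<theta> (\<phi> \<omega>))"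
    using eventually_ge_at_top[of "nat B"]
  proof eventually_elim
    case (elim n)
    show ?case
    proof (rule integral_clock_process[OF s f T, symmetric])
      fix k :: int assume "\<bar>- 2 * (real_of_int k * pi + \<phi> \<omega>) * sin \<theta>\<bar> \<le> T"
      then have "\<bar>k\<bar> \<le> B" using B by simp
      then show "k \<in> {- int n..int n}" using elim by auto
    qed simp_all
  qed
  then show "(\<lambda>n. ?S n \<omega>) \<longlonglongrightarrow> (\<integral>x. f x \<partial>clock_process \<theta> (\<phi> \<omega>))" by (rule tendsto_eventually)
qed

text \<open>\<open>Arg\<close> is continuous off the closed negative axis, equals pi on the open
  negative axis, and takes the value 0 at the origin; the plane is split accordingly.\<close>

lemma borel_measurable_Arg: "Arg \<in> borel_measurable borel"
proof -
  have S: "- \<real>\<^sub>\<le>\<^sub>0 \<in> sets (borel :: complex measure)"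
    by (intro borel_open open_Compl closed_nonpos_Reals_complex)
  have "continuous_on (- \<real>\<^sub>\<le>\<^sub>0) Arg"
    by (intro continuous_at_imp_continuous_on ballI continuous_at_Arg) simp
  then have m: "(\<lambda>z. indicator (- \<real>\<^sub>\<le>\<^sub>0) z *\<^sub>R Arg z) \<in> borel_measurable borel"
    by (rule borel_measurable_continuous_on_indicator[OF S])
  have "Arg z = indicator (- \<real>\<^sub>\<le>\<^sub>0) z *\<^sub>R Arg z + indicator (- (- \<real>\<^sub>\<le>\<^sub>0) - {0}) z * pi" for z
  proof (cases "z \<in> \<real>\<^sub>\<le>\<^sub>0")
    case True
    then obtain r where r: "z = of_real r" "r \<le> 0" by (auto simp: nonpos_Reals_def)
    then show ?thesis using True by (cases "r = 0") (auto simp: Arg_of_real Arg_zero)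
  qed simp
  moreover have "(\<lambda>z. indicator (- \<real>\<^sub>\<le>\<^sub>0) z *\<^sub>R Arg z + indicator (- (- \<real>\<^sub>\<le>\<^sub>0) - {0}) z * pi) \<in> borel_measurable borel"
  proof (intro borel_measurable_add m borel_measurable_times borel_measurable_const borel_measurable_indicator)
    show "- (- \<real>\<^sub>\<le>\<^sub>0) - {0} \<in> sets (borel :: complex measure)"
      by (intro borel_comp S sets.Diff) auto
  qed
  ultimately show ?thesis by presburger
qed

theorem theorem1p1:
  fixes \<alpha> \<delta> C E0 \<theta> :: real
    and a :: "nat \<Rightarrow> real"
    and M :: "'a measure"
    and X :: "nat \<Rightarrow> 'a \<Rightarrow> real"
    and \<mu> :: "real measure"
    and L :: "nat \<Rightarrow> nat"
  assumes "\<alpha> > 0" and "\<delta> > 0" and "\<alpha> - 1 / \<delta> > 1 / 2"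
    and "(\<lambda>n. a n * real n powr \<alpha>) \<longlonglongrightarrow> 1"
    and "prob_space M"
    and "prob_space.indep_vars M (\<lambda>_. borel) X {1..}"
    and "\<And>n. n \<ge> 1 \<Longrightarrow> distr M borel (X n) = \<mu>"
    and "\<And>K. K > 0 \<Longrightarrow> (LINT x:{-K..K}|\<mu>. x) = 0"
    and "C > 0"
    and "\<forall>\<^sub>F R in at_top. measure \<mu> (- {-R<..<R}) \<le> C / R powr \<delta>"
    and "-2 < E0" and "E0 < 2"
    and "0 < \<theta>" and "\<theta> < pi" and "E0 = 2 * cos \<theta>"
    and "strict_mono L" and "\<And>n. L n \<ge> 1"
  shows "\<exists>r :: nat \<Rightarrow> nat. strict_mono r \<and>
           (\<exists>\<phi> \<in> borel_measurable M.
              converges_in_distribution M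
                (\<lambda>k \<omega>. eigval_process a E0 (L (r k)) (\<lambda>n. X n \<omega>))
                (\<lambda>\<omega>. clock_process \<theta> (\<phi> \<omega>)))"
proof -
  interpret prob_space M by fact
  have s: "0 < sin \<theta>" using assms(13,14) by (rule sin_gt_zero)
  note E0 = \<open>E0 = 2 * cos \<theta>\<close>
  have Xm: "X n \<in> borel_measurable M" if "1 \<le> n" for n
    using assms(6) that unfolding indep_vars_def by auto
  \<comment> \<open>Nothing relates the given lengths to the angle, so compactness of the circle has
    to supply a limit for the phases.\<close>
  have "seq_compact (sphere (0::complex) 1)" using compact_imp_seq_compact compact_sphere by blast
  then obtain \<zeta> r1 where r1: "strict_mono (r1 :: nat \<Rightarrow> nat)"
    and z1: "((\<lambda>k. cis (real (Suc (L k)) * \<theta>)) \<circ> r1) \<longlonglongrightarrow> \<zeta>"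
    by (rule seq_compactE[where f = "\<lambda>k. cis (real (Suc (L k)) * \<theta>)"]) (auto simp del: of_nat_Suc)
  have L1: "strict_mono (L \<circ> r1)" by (rule strict_mono_o[OF assms(16) r1])
  obtain r2 where r2: "strict_mono r2"
    and lim: "AE \<omega> in M. \<forall>x y. \<exists>c. mean_square_limit (amp \<theta> (sol (\<lambda>n. a n * X n \<omega>) (2 * cos \<theta>) x y)) (L \<circ> r1 \<circ> r2) c"
    by (rule AE_mean_square_limit_sol[OF assms(2-8) assms(10) s L1])
  define r where "r = r1 \<circ> r2"
  have r: "strict_mono r" unfolding r_def by (rule strict_mono_o[OF r1 r2])
  have Lr: "L \<circ> r1 \<circ> r2 = (\<lambda>k. L (r k))" by (simp add: r_def comp_def)
  have Linf: "filterlim (\<lambda>k. L (r k)) at_top sequentially"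
    using filterlim_subseq[OF strict_mono_o[OF assms(16) r]] by (simp add: comp_def)
  have L0: "0 < L (r k)" for k using assms(17)[of "r k"] by simp
  have z: "(\<lambda>k. cis (real (Suc (L (r k))) * \<theta>)) \<longlonglongrightarrow> \<zeta>"
    using LIMSEQ_subseq_LIMSEQ[OF z1 r2] by (simp add: r_def comp_def)
  define u where "u k \<omega> = amp \<theta> (sol (\<lambda>n. a n * X n \<omega>) E0 0 1) (L (r k))" for k \<omega>
  \<comment> \<open>\<open>lim\<close> is defined for every outcome and is measurable as a limit of
    measurable functions; its arbitrary values where the sequence diverges matter only on a null
    set.\<close>
  define \<phi> where "\<phi> \<omega> = - Arg (\<zeta> * lim (\<lambda>k. u k \<omega>))" for \<omega>
  have um: "u k \<in> borel_measurable M" for k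
  proof -
    let ?N = "L (r k)"
    have "(\<lambda>\<omega>. \<lambda>i\<in>{1..?N}. a i * X i \<omega>) \<in> measurable M (PiM {1..?N} (\<lambda>_. borel))"
      using Xm by (intro measurable_restrict) simp
    from measurable_compose[OF this amp_borel_measurable[OF order_refl, where \<theta> = \<theta> and E = E0 and x = 0 and y = 1]]
    have "(\<lambda>\<omega>. amp \<theta> (sol (\<lambda>i\<in>{1..?N}. a i * X i \<omega>) E0 0 1) ?N) \<in> borel_measurable M" .
    moreover have "u k \<omega> = amp \<theta> (sol (\<lambda>i\<in>{1..?N}. a i * X i \<omega>) E0 0 1) ?N" for \<omega>
      unfolding u_def by (rule amp_cong) simp
    ultimately show ?thesis by presburger
  qed
  have \<phi>m: "\<phi> \<in> borel_measurable M"
  proof -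
    have "(\<lambda>\<omega>. \<zeta> * lim (\<lambda>k. u k \<omega>)) \<in> borel_measurable M"
      by (intro borel_measurable_times borel_measurable_const borel_measurable_lim_metric um)
    from borel_measurable_uminus[OF measurable_compose[OF this borel_measurable_Arg]]
    show ?thesis by (simp add: \<phi>_def[abs_def])
  qed
  have "converges_in_distribution M (\<lambda>k \<omega>. eigval_process a E0 (L (r k)) (\<lambda>n. X n \<omega>)) (\<lambda>\<omega>. clock_process \<theta> (\<phi> \<omega>))"
    unfolding converges_in_distribution_def
  proof (intro allI impI)
    fix f :: "real \<Rightarrow> real" assume "compactly_supported_continuous f"
    then have f: "continuous_on UNIV f" and cpt: "compact (closure {x. f x \<noteq> 0})"
      unfolding compactly_supported_continuous_def by auto
    from cpt have "bounded {x. f x \<noteq> 0}" using bounded_closure_image compact_imp_bounded bounded_subset closure_subset by metis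
    then obtain T where "\<forall>x\<in>{x. f x \<noteq> 0}. norm x \<le> T" unfolding bounded_iff by blast
    then have T: "f x = 0" if "T < \<bar>x\<bar>" for x using that by force
    let ?e = "\<lambda>I. exp (\<i> * complex_of_real I)"
    let ?I = "\<lambda>k \<omega>. \<integral>x. f x \<partial>eigval_process a E0 (L (r k)) (\<lambda>n. X n \<omega>)"
    let ?J = "\<lambda>\<omega>. \<integral>x. f x \<partial>clock_process \<theta> (\<phi> \<omega>)"
    have em: "(\<lambda>\<omega>. ?e (I \<omega>)) \<in> borel_measurable M" if "I \<in> borel_measurable M" for I
    proof -
      have "?e \<in> borel_measurable borel" by (intro borel_measurable_continuous_onI continuous_intros)
      from measurable_compose[OF that this] show ?thesis .
    qed
    show "(\<lambda>k. \<integral>\<omega>. ?e (?I k \<omega>) \<partial>M) \<longlonglongrightarrow> (\<integral>\<omega>. ?e (?J \<omega>) \<partial>M)"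
    proof (rule integral_dominated_convergence[where w = "\<lambda>_. 1"])
      show "(\<lambda>\<omega>. ?e (?J \<omega>)) \<in> borel_measurable M"
        by (rule em[OF borel_measurable_integral_clock_process[OF s f T \<phi>m]])
      show "(\<lambda>\<omega>. ?e (?I k \<omega>)) \<in> borel_measurable M" for k
        by (rule em[OF borel_measurable_integral_eigval_process[OF f Xm]])
      show "AE \<omega> in M. (\<lambda>k. ?e (?I k \<omega>)) \<longlonglongrightarrow> ?e (?J \<omega>)"
        using lim
      proof eventually_elim
        case (elim \<omega>)
        obtain c where c: "mean_square_limit (amp \<theta> (sol (\<lambda>n. a n * X n \<omega>) E0 0 1)) (\<lambda>k. L (r k)) c"
          using elim unfolding E0[symmetric] Lr by blast
        obtain d where d: "mean_square_limit (amp \<theta> (sol (\<lambda>n. a n * X n \<omega>) E0 1 0)) (\<lambda>k. L (r k)) d"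
          using elim unfolding E0[symmetric] Lr by blast
        \<comment> \<open>The constant \<open>c\<close> was obtained separately for each outcome;
          uniqueness of limits identifies it with the value that defines
          \<open>\<phi>\<close>.\<close>
        have "(\<lambda>k. u k \<omega>) \<longlonglongrightarrow> c" using c unfolding mean_square_limit_def u_def by blast
        then have "\<phi> \<omega> = - Arg (\<zeta> * c)" unfolding \<phi>_def by (simp add: limI)
        then have "(\<lambda>k. ?I k \<omega>) \<longlonglongrightarrow> ?J \<omega>"
          using integral_eigval_process_tendsto[OF s E0 Linf L0 c d z f T] by simp
        then show ?case by (intro tendsto_intros)
      qed
      show "AE \<omega> in M. norm (?e (?I k \<omega>)) \<le> 1" for k by simp
    qed simp
  qed
  then show ?thesis using r \<phi>m by blast
qed

end
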